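(* Let $N\geq 1$ be an integer and let $m\geq p>1$ be real numbers with $\frac{N(m-1)}{2}\geq p$. Let $f:\mathbb{R}\to\mathbb{R}$ satisfy $f(0)=0$ and, for some constants $C_0>0$ and $\lambda>0$, $$|f(u)-f(v)|\leq C_0\,|u-v|\left(|u|^{m-1}e^{\lambda|u|^p}+|v|^{m-1}e^{\lambda|v|^p}\right)\qquad\text{for all }u,v\in\mathbb{R}.$$ Then there exists $\varepsilon>0$ such that for every $u_0\in\exp L^p(\mathbb{R}^N)$ with $\|u_0\|_{\exp L^p(\mathbb{R}^N)}\leq\varepsilon$ there exists a weak-mild solution $u\in L^\infty(0,\infty;\exp L^p(\mathbb{R}^N))$ of the Cauchy problem $\partial_t u-\Delta u=f(u)$, $u(0)=u_0$, satisfying $$\lim_{t\to 0}\|u(t)-e^{t\Delta}u_0\|_{\exp L^p(\mathbb{R}^N)}=0.$$ Moreover, there is a constant $C>0$ (independent of $t$) such that $$\|u(t)\|_{L^a(\mathbb{R}^N)}\leq C\,t^{-\left(\frac{1}{m-1}-\frac{N}{2a}\right)},\qquad t>0,$$ where $a$ satisfies: (i) if $\frac N2>\frac{p}{p-1}$, then $\frac N2(m-1)<a<\frac N2(m-1)\frac{1}{(2-m)_+}$; (ii) if $\frac N2=\frac{p}{p-1}$, then $\frac N2(m-1)<a<\frac N2(m-1)\frac{1}{(2-m)_+}$; (iii) if $\frac N2<\frac{p}{p-1}$ and $(2-m)_+<\frac{N(p-1)}{2p}$, then $\frac{p}{p-1}(m-1)<a<\frac N2(m-1)\frac{1}{(2-m)_+}$.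 In particular, in all the cases (i)–(iii), $0<\frac{1}{m-1}-\frac{N}{2a}<1$.
   Context: Orlicz space. For $p>1$, $\exp L^p(\mathbb{R}^N)$ is the set of $u\in L^1_{loc}(\mathbb{R}^N)$ such that $\int_{\mathbb{R}^N}\big(e^{|u(x)|^p/\lambda^p}-1\big)\,dx<\infty$ for some $\lambda>0$, with the Luxemburg norm $$\|u\|_{\exp L^p(\mathbb{R}^N)}=\inf\Big\{\lambda>0:\ \int_{\mathbb{R}^N}\big(e^{|u(x)|^p/\lambda^p}-1\big)\,dx\leq 1\Big\}.$$ Heat semigroup. $e^{t\Delta}\varphi=G_t\star\varphi$ for $t>0$, with $G_t(x)=(4\pi t)^{-N/2}e^{-|x|^2/(4t)}$. Weak-mild solution. For $0<T\leq\infty$, $u\in L^\infty(0,T;\exp L^p(\mathbb{R}^N))$ is a weak-mild solution of $\partial_t u-\Delta u=f(u)$, $u(0)=u_0$, on $(0,T)$ if $$u(t)=e^{t\Delta}u_0+\int_0^t e^{(t-s)\Delta}f(u(s))\,ds$$ holds in $\exp L^p(\mathbb{R}^N)$ for almost all $t\in(0,T)$, and $u(t)\to u_0$ in the weak$^*$ topology as $t\searrow 0$. Here the weak$^*$ topology is that of $\exp L^p(\mathbb{R}^N)$ viewed as the dual of the Orlicz space $L^\psi(\mathbb{R}^N)$, where $\psi(t)=\sup_{s\geq0}\big(st-(e^{s^p}-1)\big)$ is the complementary function of $s\mapsto e^{s^p}-1$; that is, $\int u(t)g\,dx\to\int u_0\,g\,dx$ for every $g\in L^\psi(\mathbb{R}^N)$.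 Conventions. $(x)_+=\max(x,0)$; when $m\geq 2$, $\frac{1}{(2-m)_+}$ is read as $+\infty$, so the upper bound on $a$ is just $a<\infty$. No decay estimate is asserted when none of (i)–(iii) applies. *)

theory Defs
  imports "HOL-Analysis.Analysis"
begin

text \<open>
  Elements of the function spaces on \<open>R^N\<close> are represented by functions on
  \<^typ>\<open>real^'n\<close>; equality in a space is equality almost everywhere.
\<close>

definition L1_loc :: "(real^'n \<Rightarrow> real) set" where
  "L1_loc = {u. \<forall>K. compact K \<longrightarrow> u absolutely_integrable_on K}"

definition orlicz_space :: "(real \<Rightarrow> real) \<Rightarrow> (real^'n \<Rightarrow> real) set" where
  "orlicz_space \<phi> = {u \<in> L1_loc. \<exists>l>0.
     (\<integral>\<^sup>+x. ennreal (\<phi> (\<bar>u x\<bar> / l)) \<partial>lebesgue) < \<infinity>}"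

text \<open>For \<open>u\<close> in \<open>orlicz_space \<phi>\<close> (\<open>\<phi>\<close> a Young function) the set below is nonempty;
  outside that space the value is meaningless.\<close>

definition luxemburg_norm :: "(real \<Rightarrow> real) \<Rightarrow> (real^'n \<Rightarrow> real) \<Rightarrow> real" where
  "luxemburg_norm \<phi> u = Inf {l. l > 0 \<and>
     (\<integral>\<^sup>+x. ennreal (\<phi> (\<bar>u x\<bar> / l)) \<partial>lebesgue) \<le> 1}"

definition complementary_fun :: "(real \<Rightarrow> real) \<Rightarrow> real \<Rightarrow> real" where
  "complementary_fun \<phi> t = (SUP s\<in>{0..}. s * t - \<phi> s)"

definition exp_young :: "real \<Rightarrow> real \<Rightarrow> real" where
  "exp_young p s = exp (s powr p) - 1"

abbreviation expL :: "real \<Rightarrow> (real^'n \<Rightarrow> real) set" where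
  "expL p \<equiv> orlicz_space (exp_young p)"

abbreviation expL_norm :: "real \<Rightarrow> (real^'n \<Rightarrow> real) \<Rightarrow> real" where
  "expL_norm p \<equiv> luxemburg_norm (exp_young p)"

definition Lp_space :: "real \<Rightarrow> (real^'n \<Rightarrow> real) set" where
  "Lp_space a = {v \<in> borel_measurable lebesgue. integrable lebesgue (\<lambda>x. \<bar>v x\<bar> powr a)}"

definition Lp_norm :: "real \<Rightarrow> (real^'n \<Rightarrow> real) \<Rightarrow> real" where
  "Lp_norm a v = (\<integral>x. \<bar>v x\<bar> powr a \<partial>lebesgue) powr (1 / a)"

definition heat_kernel :: "real \<Rightarrow> real^'n \<Rightarrow> real" where
  "heat_kernel t x = (4 * pi * t) powr (- (real CARD('n) / 2)) * exp (- (norm x)\<^sup>2 / (4 * t))"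

definition heat :: "real \<Rightarrow> (real^'n \<Rightarrow> real) \<Rightarrow> real^'n \<Rightarrow> real" where
  "heat t \<phi> x = (\<integral>y. heat_kernel t (x - y) * \<phi> y \<partial>lebesgue)"

definition time_interval :: "ereal \<Rightarrow> real set" where
  "time_interval T = {t. 0 < t \<and> ereal t < T}"

text \<open>Strong (Bochner) measurability on \<open>I\<close>: almost everywhere limit, in the norm of
  \<open>exp L^p\<close>, of measurable functions with finitely many values.\<close>

definition strongly_measurable_expL ::
    "real \<Rightarrow> real set \<Rightarrow> (real \<Rightarrow> real^'n \<Rightarrow> real) \<Rightarrow> bool" where
  "strongly_measurable_expL p I u \<longleftrightarrow>
     (\<exists>S :: nat \<Rightarrow> real \<Rightarrow> real^'n \<Rightarrow> real.
        (\<forall>n. S n ` I \<subseteq> expL p \<and> finite (S n ` I) \<and>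
             (\<forall>v. {t \<in> I. S n t = v} \<in> sets lebesgue)) \<and>
        (AE t in lebesgue. t \<in> I \<longrightarrow>
           (\<lambda>n. expL_norm p (\<lambda>x. S n t x - u t x)) \<longlonglongrightarrow> 0))"

definition Linf_expL :: "real \<Rightarrow> ereal \<Rightarrow> (real \<Rightarrow> real^'n \<Rightarrow> real) set" where
  "Linf_expL p T = {u. (\<forall>t\<in>time_interval T. u t \<in> expL p) \<and>
     strongly_measurable_expL p (time_interval T) u \<and>
     (\<exists>M. AE t in lebesgue. t \<in> time_interval T \<longrightarrow> expL_norm p (u t) \<le> M)}"

text \<open>The integral equation is an equality of functions of \<open>x\<close> almost everywhere. Since the
  library integral of a nonintegrable function is \<open>0\<close>, the existence of both the
  convolution integral and the time integral is part of the requirement.\<close>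

definition duhamel_eq ::
    "(real \<Rightarrow> real) \<Rightarrow> (real^'n \<Rightarrow> real) \<Rightarrow> (real \<Rightarrow> real^'n \<Rightarrow> real) \<Rightarrow> real \<Rightarrow> bool" where
  "duhamel_eq f u0 u t \<longleftrightarrow> (AE x in lebesgue.
     (AE s in lebesgue. s \<in> {0<..<t} \<longrightarrow>
        integrable lebesgue (\<lambda>y. heat_kernel (t - s) (x - y) * f (u s y))) \<and>
     set_integrable lebesgue {0<..<t} (\<lambda>s. heat (t - s) (\<lambda>y. f (u s y)) x) \<and>
     u t x = heat t u0 x +
       set_lebesgue_integral lebesgue {0<..<t} (\<lambda>s. heat (t - s) (\<lambda>y. f (u s y)) x))"

text \<open>Weak* convergence as \<open>t\<close> decreases to \<open>0\<close>, with \<open>exp L^p\<close> as the dual of the Orlicz space of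
  the complementary function.\<close>

definition weak_star_initial ::
    "real \<Rightarrow> (real^'n \<Rightarrow> real) \<Rightarrow> (real \<Rightarrow> real^'n \<Rightarrow> real) \<Rightarrow> bool" where
  "weak_star_initial p u0 u \<longleftrightarrow>
     (\<forall>g \<in> orlicz_space (complementary_fun (exp_young p)).
        ((\<lambda>t. \<integral>x. u t x * g x \<partial>lebesgue) \<longlongrightarrow> (\<integral>x. u0 x * g x \<partial>lebesgue)) (at_right 0))"

definition weak_mild_solution ::
    "real \<Rightarrow> (real \<Rightarrow> real) \<Rightarrow> ereal \<Rightarrow> (real^'n \<Rightarrow> real) \<Rightarrow> (real \<Rightarrow> real^'n \<Rightarrow> real) \<Rightarrow> bool" where
  "weak_mild_solution p f T u0 u \<longleftrightarrow>
     u \<in> Linf_expL p T \<and>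
     (AE t in lebesgue. t \<in> time_interval T \<longrightarrow> duhamel_eq f u0 u t) \<and>
     weak_star_initial p u0 u"

text \<open>\<open>(N/2) (m - 1) / (2 - m)_+\<close>, read as infinity for \<open>m \<ge> 2\<close>.\<close>

definition upper_exponent :: "real \<Rightarrow> real \<Rightarrow> ereal" where
  "upper_exponent N m =
     (if m < 2 then ereal (N / 2 * (m - 1) * (1 / (2 - m))) else \<infinity>)"

definition admissible_exponent :: "real \<Rightarrow> real \<Rightarrow> real \<Rightarrow> real \<Rightarrow> bool" where
  "admissible_exponent N m p a \<longleftrightarrow>
     (N / 2 > p / (p - 1) \<and>
        N / 2 * (m - 1) < a \<and> ereal a < upper_exponent N m) \<or>
     (N / 2 = p / (p - 1) \<and>
        N / 2 * (m - 1) < a \<and> ereal a < upper_exponent N m) \<or>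
     (N / 2 < p / (p - 1) \<and> max (2 - m) 0 < N * (p - 1) / (2 * p) \<and>
        p / (p - 1) * (m - 1) < a \<and> ereal a < upper_exponent N m)"

end

theory Submission
  imports Defs "HOL-Probability.Distributions" "HOL-Real_Asymp.Real_Asymp"
begin

text \<open>
  Write \<open>S(t)\<close> for the heat semigroup, \<open>d = N/2\<close>, and let \<open>F(w) = 2 C0 w^m exp(lam w^p)\<close>. Everything
  follows from an explicit pointwise supersolution. Fix \<open>1 < r < p\<close>, put \<open>\<beta> = (r-1)/(m-1)\<close> and
  \<open>Q(t) = S(t) |u0|^r\<close>. By Jensen's inequality \<open>Q\<close> inherits all bounds of \<open>u0\<close>: for every \<open>q \<ge> p\<close> it is
  at most a multiple of \<open>t^(-d r/q)\<close>, and \<open>exp((Q/e^r)^(p/r)) - 1 \<le> t^(-d)\<close> if \<open>u0\<close> has size \<open>e\<close>.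
  Using \<open>q = N(m-1)/2\<close> for large times and a large \<open>q\<close> for small times, the function
  \<open>W = Q^(1/r) + t^\<beta> Q\<close> satisfies \<open>F(W(s)) \<le> \<beta> s^(\<beta>-1) Q(s)\<close> once \<open>e\<close> is small, so by the semigroup law
  the Duhamel integral of \<open>F(W)\<close> is at most \<open>t^\<beta> Q(t)\<close>, and \<open>W\<close> is a supersolution. Picard iteration
  then converges pointwise to a solution with \<open>|u| \<le> W\<close> and \<open>|u(t) - S(t) u0| \<le> t^\<beta> Q(t)\<close>, from which the
  bounds in \<open>exp L^p\<close> and \<open>L^a\<close> and the behaviour at \<open>t = 0\<close> can be read off.
\<close>

section \<open>The heat kernel\<close>

text \<open>Why \<open>r > 1\<close>: at the scale \<open>q = d (m-1)\<close> the free evolution of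
  \<open>|u0|\<close> is of order \<open>s^(-1/(m-1))\<close>, so a bound of the nonlinear term
  linear in \<open>S(s) |u0|\<close> has a coefficient of order \<open>1/s\<close>, and its time
  integral diverges. With \<open>|u0|^r\<close> one factor \<open>Q\<close> leaves
  \<open>Q^((m-r)/r)\<close>, of order \<open>s^(-(m-r)/(m-1)) = s^(\<beta>-1)\<close>, whose
  integral is a multiple of \<open>t^\<beta>\<close>. The growth \<open>t^\<beta>\<close> is
  harmless, because \<open>Q\<close> itself decays like \<open>t^(-r/(m-1))\<close> and
  \<open>\<beta> < r/(m-1)\<close>. The condition \<open>r < p\<close> keeps the power
  \<open>p/r\<close> convex for Jensen, and with \<open>p \<le> m\<close> it makes
  \<open>m - r\<close> positive. The exponential has no scaling. For small times only the
  exponential modular controls it, as a power of \<open>s^(-d)\<close> with an exponent proportional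
  to \<open>e^p\<close>; so small data are needed inside the exponential as well as in the
  coefficient. The heat semigroup is not strongly continuous at \<open>t = 0\<close> on exp L^p.
  Hence the initial value is attained weakly*, through local L^1 convergence, while strong
  measurability in time rests on norm continuity at positive times.\<close>

lemma nn_integral_lborel_affine_unit:
  fixes f :: "'a::euclidean_space \<Rightarrow> ennreal"
  assumes [measurable]: "f \<in> borel_measurable borel" and c: "c = 1 \<or> c = -1"
  shows "(\<integral>\<^sup>+y. f (x + c *\<^sub>R y) \<partial>lborel) = (\<integral>\<^sup>+y. f y \<partial>lborel)"
proof -
  have "(\<integral>\<^sup>+y. f y \<partial>lborel) = (\<integral>\<^sup>+y. f y \<partial>(density (distr lborel borel (\<lambda>y. x + c *\<^sub>R y)) (\<lambda>_. \<bar>c\<bar>^DIM('a))))"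
    using lborel_affine[of c x] c by (auto simp del: lborel_affine)
  also have "\<dots> = (\<integral>\<^sup>+y. f (x + c *\<^sub>R y) \<partial>lborel)"
    using c by (auto simp: nn_integral_density nn_integral_distr)
  finally show ?thesis by simp
qed

lemma nn_integral_lborel_reflect:
  fixes f :: "'a::euclidean_space \<Rightarrow> ennreal"
  assumes "f \<in> borel_measurable borel"
  shows "(\<integral>\<^sup>+y. f (x - y) \<partial>lborel) = (\<integral>\<^sup>+y. f y \<partial>lborel)"
  using nn_integral_lborel_affine_unit[OF assms, of "-1" x] by simp

lemma nn_integral_lborel_translate:
  fixes f :: "'a::euclidean_space \<Rightarrow> ennreal"
  assumes "f \<in> borel_measurable borel"
  shows "(\<integral>\<^sup>+y. f (y - x) \<partial>lborel) = (\<integral>\<^sup>+y. f y \<partial>lborel)"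
  using nn_integral_lborel_affine_unit[OF assms, of 1 "-x"] by simp

lemma heat_kernel_measurable [measurable (raw)]:
  fixes g :: "'a \<Rightarrow> real^'n"
  assumes [measurable]: "f \<in> borel_measurable M" "g \<in> borel_measurable M"
  shows "(\<lambda>z. heat_kernel (f z) (g z)) \<in> borel_measurable M"
  unfolding heat_kernel_def by measurable

lemma heat_kernel_nonneg [simp]: "0 \<le> heat_kernel t x"
  by (simp add: heat_kernel_def)

text \<open>The kernel is the product over the coordinates of centred normal densities of variance
  \<open>2 * t\<close>, each of mass one.\<close>

lemma nn_integral_heat_kernel:
  assumes t: "t > 0"
  shows "(\<integral>\<^sup>+x. ennreal (heat_kernel t (x::real^'n)) \<partial>lborel) = 1"
proof -
  define g where "g = normal_density 0 (sqrt (2 * t))"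
  have 1: "heat_kernel t x = (\<Prod>b\<in>Basis. g (x \<bullet> b))" for x :: "real^'n"
  proof -
    have "(\<Prod>b\<in>Basis. g (x \<bullet> b)) = (\<Prod>b\<in>Basis. (4 * pi * t) powr (-1/2) * exp (- (x \<bullet> b)\<^sup>2 / (4 * t)))"
      using t by (intro prod.cong) (auto simp: g_def normal_density_def powr_minus_divide powr_half_sqrt algebra_simps)
    also have "\<dots> = ((4 * pi * t) powr (-1/2)) ^ CARD('n) * exp (\<Sum>b\<in>Basis. - (x \<bullet> b)\<^sup>2 / (4 * t))"
      by (simp add: prod.distrib exp_sum)
    also have "(\<Sum>b\<in>Basis. - (x \<bullet> b)\<^sup>2 / (4 * t)) = - (norm x)\<^sup>2 / (4 * t)"
      unfolding power2_norm_eq_inner euclidean_inner[of x x]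
      by (simp add: sum_negf sum_divide_distrib power2_eq_square)
    also have "((4 * pi * t) powr (-1/2)) ^ CARD('n) = (4 * pi * t) powr (- (real CARD('n) / 2))"
      using t by (subst powr_realpow[symmetric]) (auto simp: powr_powr)
    finally show ?thesis by (simp add: heat_kernel_def)
  qed
  have 2: "g y \<ge> 0" for y by (simp add: g_def)
  have 3: "(\<integral>\<^sup>+y. ennreal (g y) \<partial>lborel) = 1"
    using t by (subst nn_integral_eq_integral) (auto simp: g_def)
  have "(\<integral>\<^sup>+x. ennreal (heat_kernel t (x::real^'n)) \<partial>lborel)
      = (\<integral>\<^sup>+x. (\<Prod>b\<in>Basis. ennreal (g ((x::real^'n) \<bullet> b))) \<partial>lborel)"
    by (simp add: 1 prod_ennreal 2)
  also have "\<dots> = (\<Prod>b\<in>(Basis :: (real^'n) set). (\<integral>\<^sup>+y. ennreal (g y) \<partial>lborel))"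
    by (intro nn_integral_lborel_prod) (auto simp: g_def)
  finally show ?thesis by (simp add: 3)
qed

lemma nn_integral_heat_kernel_diff:
  assumes t: "t > 0"
  shows "(\<integral>\<^sup>+y. ennreal (heat_kernel t (x - y :: real^'n)) \<partial>lborel) = 1"
    and "(\<integral>\<^sup>+y. ennreal (heat_kernel t (y - x :: real^'n)) \<partial>lborel) = 1"
  using nn_integral_lborel_reflect[of "\<lambda>z::real^'n. ennreal (heat_kernel t z)" x]
    nn_integral_lborel_translate[of "\<lambda>z::real^'n. ennreal (heat_kernel t z)" x]
    nn_integral_heat_kernel[OF t, where 'n='n]
  by simp_all

text \<open>Completing the square: as a function of \<open>y\<close> the product of two kernels is a multiple of a
  third one.\<close>

lemma heat_kernel_mult:
  fixes x y :: "real^'n"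
  assumes a: "a > 0" and b: "b > 0"
  shows "heat_kernel a (x - y) * heat_kernel b y =
    heat_kernel (a + b) x * heat_kernel (a * b / (a + b)) (y - (b / (a + b)) *\<^sub>R x)"
proof -
  have ab: "a + b > 0" using a b by simp
  have e: "- (norm (x - y))\<^sup>2 / (4 * a) + - (norm y)\<^sup>2 / (4 * b) =
     - (norm x)\<^sup>2 / (4 * (a + b)) + - (norm (y - (b / (a + b)) *\<^sub>R x))\<^sup>2 / (4 * (a * b / (a + b)))"
  proof -
    have nx: "(norm (x - y))\<^sup>2 = x \<bullet> x - 2 * (x \<bullet> y) + y \<bullet> y"
      by (simp add: power2_norm_eq_inner inner_diff_left inner_diff_right inner_commute)
    have ny: "(norm (y - (b / (a + b)) *\<^sub>R x))\<^sup>2 = y \<bullet> y - 2 * (b / (a + b)) * (x \<bullet> y) + (b / (a + b))\<^sup>2 * (x \<bullet> x)"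
      unfolding power2_norm_eq_inner
      by (simp add: inner_diff_left inner_diff_right inner_commute power2_eq_square)
    obtain X Y Z where XYZ: "X = x \<bullet> x" "Y = x \<bullet> y" "Z = y \<bullet> y" by blast
    \<comment> \<open>With the inner products abstracted to reals and the sum \<open>a + b\<close>
      to one symbol, clearing denominators leaves a polynomial identity.\<close>
    define c where "c = a + b"
    have c: "c > 0" "a = c - b" using ab by (auto simp: c_def)
    have "- (X - 2 * Y + Z) / (4 * a) + - Z / (4 * b) =
      - X / (4 * c) + - (Z - 2 * (b / c) * Y + (b / c)\<^sup>2 * X) / (4 * (a * b / c))"
      using a b c(1) by (simp add: field_simps power2_eq_square) (simp add: c_def algebra_simps)
    then show ?thesis unfolding nx ny XYZ c_def power2_norm_eq_inner[of x] power2_norm_eq_inner[of y] by simp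
  qed
  define d where "d = - (real CARD('n) / 2)"
  have k: "(4 * pi * a) powr d * (4 * pi * b) powr d = (4 * pi * (a + b)) powr d * (4 * pi * (a * b / (a + b))) powr d"
  proof -
    have "(4 * pi * a) * (4 * pi * b) = (4 * pi * (a + b)) * (4 * pi * (a * b / (a + b)))"
      using ab by (simp add: field_simps)
    then have "((4 * pi * a) * (4 * pi * b)) powr d = ((4 * pi * (a + b)) * (4 * pi * (a * b / (a + b)))) powr d"
      by (rule arg_cong)
    then show ?thesis
      using powr_mult[of "4 * pi * a" "4 * pi * b" d] powr_mult[of "4 * pi * (a + b)" "4 * pi * (a * b / (a + b))" d]
        a b by (simp only:)
  qed
  have "heat_kernel a (x - y) * heat_kernel b y = ((4 * pi * a) powr d * (4 * pi * b) powr d) *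
     exp (- (norm (x - y))\<^sup>2 / (4 * a) + - (norm y)\<^sup>2 / (4 * b))"
    unfolding heat_kernel_def d_def exp_add by simp
  also have "\<dots> = heat_kernel (a + b) x * heat_kernel (a * b / (a + b)) (y - (b / (a + b)) *\<^sub>R x)"
    unfolding heat_kernel_def d_def[symmetric] e k exp_add by simp
  finally show ?thesis .
qed

text \<open>After a translation by \<open>z\<close>, \<open>heat_kernel_mult\<close> pulls out the
  factor in \<open>x - z\<close>; what remains is a translated kernel of mass one.\<close>

lemma heat_kernel_semigroup:
  fixes x z :: "real^'n"
  assumes a: "a > 0" and b: "b > 0"
  shows "(\<integral>\<^sup>+y. ennreal (heat_kernel a (x - y)) * ennreal (heat_kernel b (y - z)) \<partial>lborel) =
    ennreal (heat_kernel (a + b) (x - z))"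
proof -
  have c: "a * b / (a + b) > 0" using a b by simp
  let ?h = "\<lambda>y. ennreal (heat_kernel a (x - z - y)) * ennreal (heat_kernel b y)"
  have "(\<integral>\<^sup>+y. ennreal (heat_kernel a (x - y)) * ennreal (heat_kernel b (y - z)) \<partial>lborel) =
     (\<integral>\<^sup>+y. ?h (y - z) \<partial>lborel)" by simp
  also have "\<dots> = (\<integral>\<^sup>+y. ?h y \<partial>lborel)"
    by (rule nn_integral_lborel_translate) simp
  also have "\<dots> = (\<integral>\<^sup>+y. ennreal (heat_kernel (a + b) (x - z)) *
      ennreal (heat_kernel (a * b / (a + b)) (y - (b / (a + b)) *\<^sub>R (x - z))) \<partial>lborel)"
    by (simp add: ennreal_mult[symmetric] heat_kernel_mult[OF a b])
  also have "\<dots> = ennreal (heat_kernel (a + b) (x - z))"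
    by (subst nn_integral_cmult) (auto simp: nn_integral_heat_kernel_diff[OF c])
  finally show ?thesis .
qed

lemma heat_kernel_le:
  assumes "t > 0"
  shows "heat_kernel t (x::real^'n) \<le> t powr (- (real CARD('n) / 2))"
proof -
  have pi: "1 \<le> 4 * pi" using pi_gt3 by simp
  have "(4 * pi * t) powr (- (real CARD('n) / 2)) \<le> t powr (- (real CARD('n) / 2))"
    using assms pi by (intro powr_mono2') (auto intro: mult_right_le_one_le)
  moreover have "exp (- (norm x)\<^sup>2 / (4 * t)) \<le> 1" using assms by simp
  ultimately show ?thesis unfolding heat_kernel_def
    by (metis (no_types, opaque_lifting) exp_ge_zero mult.right_neutral mult_mono' powr_ge_zero)
qed

section \<open>Comparison of kernels at different times\<close>

lemma heat_kernel_time_mono: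
  assumes "0 < a" "a \<le> b"
  shows "heat_kernel a (x::real^'n) \<le> (b / a) powr (real CARD('n) / 2) * heat_kernel b x"
proof -
  have 1: "(4 * pi * a) powr (- (real CARD('n) / 2)) = (b / a) powr (real CARD('n) / 2) * (4 * pi * b) powr (- (real CARD('n) / 2))"
    using assms by (simp add: powr_minus powr_divide powr_mult field_simps)
  have 2: "exp (- (norm x)\<^sup>2 / (4 * a)) \<le> exp (- (norm x)\<^sup>2 / (4 * b))"
    using assms by (simp add: frac_le)
  show ?thesis unfolding heat_kernel_def 1 mult.assoc[symmetric] using 2
    by (intro mult_left_mono) auto
qed

text \<open>Half of the Gaussian exponent is spent on a kernel at time \<open>2 * t\<close>. The
  other half stays available to absorb tails and polynomial factors.\<close>

lemma heat_kernel_double: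
  assumes "t > 0"
  shows "heat_kernel t (x::real^'n) = 2 powr (real CARD('n) / 2) * heat_kernel (2 * t) x * exp (- (norm x)\<^sup>2 / (8 * t))"
proof -
  have 1: "(4 * pi * t) powr (- (real CARD('n) / 2)) = 2 powr (real CARD('n) / 2) * (4 * pi * (2 * t)) powr (- (real CARD('n) / 2))"
  proof -
    have "4 * pi * (2 * t) = 2 * (4 * pi * t)" by simp
    then have "(4 * pi * (2 * t)) powr (- (real CARD('n) / 2)) = 2 powr (- (real CARD('n) / 2)) * (4 * pi * t) powr (- (real CARD('n) / 2))"
      using assms by (metis powr_mult)
    then show ?thesis by (simp add: powr_minus)
  qed
  have 2: "exp (- (norm x)\<^sup>2 / (4 * t)) = exp (- (norm x)\<^sup>2 / (4 * (2 * t))) * exp (- (norm x)\<^sup>2 / (8 * t))"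
    using assms by (simp add: exp_add[symmetric])
  show ?thesis unfolding heat_kernel_def 1 2 by simp
qed

lemma heat_kernel_tail:
  assumes "t > 0" "0 \<le> \<delta>" "\<delta> \<le> norm x"
  shows "heat_kernel t (x::real^'n) \<le> 2 powr (real CARD('n) / 2) * exp (- \<delta>\<^sup>2 / (8 * t)) * heat_kernel (2 * t) x"
proof -
  have "exp (- (norm x)\<^sup>2 / (8 * t)) \<le> exp (- \<delta>\<^sup>2 / (8 * t))"
    using assms by (simp add: divide_right_mono power_mono)
  then show ?thesis
    unfolding heat_kernel_double[OF assms(1)]
    by (simp add: mult_left_mono mult.commute mult.left_commute)
qed

lemma heat_kernel_has_time_derivative:
  assumes "t > 0"
  shows "((\<lambda>t. heat_kernel t (x::real^'n)) has_real_derivative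
     ((norm x)\<^sup>2 / (4 * t) - real CARD('n) / 2) / t * heat_kernel t x) (at t)"
proof -
  obtain d where d: "d = real CARD('n) / 2" by blast
  have "4 * pi * t > 0" using assms by simp
  then have 1: "((\<lambda>t. (4 * pi * t) powr (- d)) has_real_derivative (- d / t) * (4 * pi * t) powr (- d)) (at t)"
    using assms by (auto intro!: derivative_eq_intros simp: powr_diff)
  have 2: "((\<lambda>t. exp (- (norm x)\<^sup>2 / (4 * t))) has_real_derivative
      ((norm x)\<^sup>2 / (4 * t) / t) * exp (- (norm x)\<^sup>2 / (4 * t))) (at t)"
    using assms by (auto intro!: derivative_eq_intros simp: power2_eq_square mult_ac)
  show ?thesis unfolding heat_kernel_def d[symmetric]
    by (rule DERIV_cong[OF DERIV_mult[OF 1 2]]) (use assms in \<open>simp add: field_simps\<close>)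
qed

text \<open>With \<open>y = |x|^2 / (8 t)\<close> the polynomial factor is \<open>2 y - N/2\<close>,
  and the spare factor \<open>exp (-y)\<close> absorbs it because
  \<open>y * exp (-y) \<le> 1\<close>.\<close>

lemma heat_kernel_time_derivative_bound:
  assumes "t > 0"
  shows "\<bar>((norm x)\<^sup>2 / (4 * t) - real CARD('n) / 2) / t * heat_kernel t (x::real^'n)\<bar>
    \<le> (2 + real CARD('n) / 2) * 2 powr (real CARD('n) / 2) / t * heat_kernel (2 * t) x"
proof -
  define y where "y = (norm x)\<^sup>2 / (8 * t)"
  have y: "y \<ge> 0" using assms by (simp add: y_def)
  have e: "exp (-y) \<le> 1" "y * exp (-y) \<le> 1"
  proof -
    have "y \<le> exp y" using exp_ge_add_one_self[of y] by linarith
    then show "y * exp (-y) \<le> 1" by (simp add: exp_minus field_simps)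
  qed (use y in simp)
  have "\<bar>2 * y - real CARD('n) / 2\<bar> * exp (- y) \<le> (2 * y + real CARD('n) / 2) * exp (-y)"
    using y by (intro mult_right_mono) auto
  also have "\<dots> = 2 * (y * exp (-y)) + real CARD('n) / 2 * exp (-y)" by (simp add: algebra_simps)
  also have "\<dots> \<le> 2 * 1 + real CARD('n) / 2 * 1"
    using e by (intro add_mono mult_left_mono) auto
  finally have k: "\<bar>2 * y - real CARD('n) / 2\<bar> * exp (- y) \<le> 2 + real CARD('n) / 2" by simp
  have "\<bar>((norm x)\<^sup>2 / (4 * t) - real CARD('n) / 2) / t * heat_kernel t x\<bar> =
     (\<bar>2 * y - real CARD('n) / 2\<bar> * exp (- y)) * (2 powr (real CARD('n) / 2) / t * heat_kernel (2 * t) x)"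
    unfolding heat_kernel_double[OF assms]
    using assms by (simp add: abs_mult y_def)
  also have "\<dots> \<le> (2 + real CARD('n) / 2) * (2 powr (real CARD('n) / 2) / t * heat_kernel (2 * t) x)"
    using assms by (intro mult_right_mono k) auto
  finally show ?thesis by simp
qed

text \<open>Mean value theorem in time. The kernel at the unknown intermediate time
  \<open>2 * z\<close> is moved to \<open>2 * b\<close> by \<open>heat_kernel_time_mono\<close>, so
  that the right-hand side is again a heat kernel and can act on data.\<close>

lemma heat_kernel_time_diff:
  assumes "0 < a" "a \<le> b"
  shows "\<bar>heat_kernel b x - heat_kernel a (x::real^'n)\<bar> \<le>
    (2 + real CARD('n) / 2) * 2 powr (real CARD('n) / 2) * ((b - a) / a) * (b / a) powr (real CARD('n) / 2)
      * heat_kernel (2 * b) x"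
proof (cases "a = b")
  case False
  with assms have "a < b" by simp
  let ?D = "\<lambda>t. ((norm x)\<^sup>2 / (4 * t) - real CARD('n) / 2) / t * heat_kernel t x"
  let ?C = "(2 + real CARD('n) / 2) * 2 powr (real CARD('n) / 2)"
  have "\<exists>z>a. z < b \<and> heat_kernel b x - heat_kernel a x = (b - a) * ?D z"
    using assms by (intro MVT2 \<open>a < b\<close> heat_kernel_has_time_derivative) auto
  then obtain z where z: "a < z" "z < b" "heat_kernel b x - heat_kernel a x = (b - a) * ?D z"
    by blast
  have z0: "z > 0" using z assms by simp
  have "\<bar>heat_kernel b x - heat_kernel a x\<bar> \<le> (b - a) * (?C / z * heat_kernel (2 * z) x)"
    unfolding z(3) abs_mult[of "b - a"] using heat_kernel_time_derivative_bound[OF z0, of x] \<open>a < b\<close>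
    by (intro mult_mono) auto
  also have "\<dots> \<le> (b - a) * (?C / z * ((2 * b / (2 * z)) powr (real CARD('n) / 2) * heat_kernel (2 * b) x))"
    using z z0 assms by (intro mult_left_mono heat_kernel_time_mono) auto
  also have "\<dots> \<le> (b - a) * (?C / a * ((b / a) powr (real CARD('n) / 2) * heat_kernel (2 * b) x))"
    using z z0 assms
    by (intro mult_left_mono mult_mono mult_right_mono powr_mono2 divide_left_mono)
       (auto simp: field_simps)
  finally show ?thesis by (simp add: mult_ac)
qed simp

section \<open>Majorised fixed points\<close>

text \<open>Picard iteration \<open>u\<^sub>k\<close> run in parallel with the monotone iteration \<open>w\<^sub>k\<close> of the majorant: the
  increments of \<open>u\<^sub>k\<close> are dominated by those of \<open>w\<^sub>k\<close>, which stays below the supersolution \<open>W\<close>.\<close>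

lemma majorant_fixed_point:
  fixes K :: "'a \<Rightarrow> 'a \<Rightarrow> real" and f F :: "real \<Rightarrow> real" and U W :: "'a \<Rightarrow> real"
  assumes "sigma_finite_measure M"
    and K_meas [measurable]: "(\<lambda>(z, y). K z y) \<in> borel_measurable (M \<Otimes>\<^sub>M M)"
    and f_meas [measurable]: "f \<in> borel_measurable borel" and F_meas [measurable]: "F \<in> borel_measurable borel"
    and U_meas [measurable]: "U \<in> borel_measurable M" and W_meas [measurable]: "W \<in> borel_measurable M"
    and spaceM: "space M = UNIV"
    and K_nonneg: "\<And>z y. 0 \<le> K z y"
    and f_cont: "\<And>x. isCont f x" and f0: "f 0 = 0" and F0: "F 0 = 0"
    and F_mono: "\<And>a b. 0 \<le> a \<Longrightarrow> a \<le> b \<Longrightarrow> F a \<le> F b"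
    and majorant: "\<And>x y a b. \<bar>y\<bar> \<le> a \<Longrightarrow> \<bar>x - y\<bar> \<le> b - a \<Longrightarrow> \<bar>f x - f y\<bar> \<le> F b - F a"
    and W_nonneg: "\<And>z. 0 \<le> W z"
    and int: "\<And>z. integrable M (\<lambda>y. K z y * F (W y))"
    and super: "\<And>z. \<bar>U z\<bar> + (\<integral>y. K z y * F (W y) \<partial>M) \<le> W z"
  obtains u where "u \<in> borel_measurable M" "\<And>z. \<bar>u z\<bar> \<le> W z"
    "\<And>z. integrable M (\<lambda>y. K z y * f (u y))"
    "\<And>z. u z = U z + (\<integral>y. K z y * f (u y) \<partial>M)"
proof -
  interpret sigma_finite_measure M by fact
  \<comment> \<open>Both iterations start at 0. Since \<open>f 0 = 0\<close> and
    \<open>F 0 = 0\<close>, the first increments are \<open>U z\<close> and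
    \<open>\<bar>U z\<bar>\<close>, which starts the domination.\<close>
  define u where "u = rec_nat (\<lambda>_. 0) (\<lambda>_ v z. U z + (\<integral>y. K z y * f (v y) \<partial>M))"
  define w where "w = rec_nat (\<lambda>_. 0) (\<lambda>_ v z. \<bar>U z\<bar> + (\<integral>y. K z y * F (v y) \<partial>M))"
  have u0: "u 0 = (\<lambda>_. 0)" and uS: "u (Suc k) = (\<lambda>z. U z + (\<integral>y. K z y * f (u k y) \<partial>M))" for k
    by (simp_all add: u_def)
  have w0: "w 0 = (\<lambda>_. 0)" and wS: "w (Suc k) = (\<lambda>z. \<bar>U z\<bar> + (\<integral>y. K z y * F (w k y) \<partial>M))" for k
    by (simp_all add: w_def)
  have um[measurable]: "u k \<in> borel_measurable M" for k by (induction k) (simp_all add: u0 uS)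
  have wm[measurable]: "w k \<in> borel_measurable M" for k by (induction k) (simp_all add: w0 wS)
  have Kz[measurable]: "K z \<in> borel_measurable M" for z
    using measurable_Pair2[OF K_meas, of z] spaceM by simp
  have fF: "\<bar>f x\<bar> \<le> F b" if "\<bar>x\<bar> \<le> b" for x b
    using majorant[of 0 0 x b] that f0 F0 by simp
  have intF: "integrable M (\<lambda>y. K z y * F (v y))"
    if [measurable]: "v \<in> borel_measurable M" and v: "\<And>y. 0 \<le> v y" "\<And>y. v y \<le> W y" for v z
  proof (rule Bochner_Integration.integrable_bound[OF int[of z]])
    show "AE y in M. norm (K z y * F (v y)) \<le> norm (K z y * F (W y))"
      using v F_mono[of 0] F_mono[OF v] K_nonneg F0 W_nonneg by (auto simp: abs_mult intro!: mult_left_mono)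
  qed simp
  have intf: "integrable M (\<lambda>y. K z y * f (v y))"
    if [measurable]: "v \<in> borel_measurable M" and v: "\<And>y. \<bar>v y\<bar> \<le> W y" for v z
  proof (rule Bochner_Integration.integrable_bound[OF int[of z]])
    show "AE y in M. norm (K z y * f (v y)) \<le> norm (K z y * F (W y))"
      using order_trans[OF fF[OF v] abs_ge_self] K_nonneg by (auto simp: abs_mult intro!: mult_left_mono)
  qed simp
  have w_step: "0 \<le> w k z \<and> w k z \<le> w (Suc k) z \<and> w k z \<le> W z" for k z
  proof (induction k arbitrary: z)
    case 0
    show ?case using K_nonneg F0 W_nonneg by (simp add: w0 wS)
  next
    case (Suc k)
    have S: "w (Suc k) z \<le> W z" for z
    proof -
      have "(\<integral>y. K z y * F (w k y) \<partial>M) \<le> (\<integral>y. K z y * F (W y) \<partial>M)"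
        using Suc by (intro integral_mono int intF mult_left_mono F_mono K_nonneg) auto
      then show ?thesis using super[of z] by (simp add: wS)
    qed
    have nn: "0 \<le> w (Suc k) y" for y using Suc[of y] by linarith
    have "(\<integral>y. K z y * F (w k y) \<partial>M) \<le> (\<integral>y. K z y * F (w (Suc k) y) \<partial>M)"
      using Suc S nn by (intro integral_mono intF mult_left_mono F_mono K_nonneg) auto
    then show ?case using S nn wS[of "Suc k"] wS[of k] by simp
  qed
  have u_step: "\<bar>u k z\<bar> \<le> w k z \<and> \<bar>u (Suc k) z - u k z\<bar> \<le> w (Suc k) z - w k z" for k z
  proof (induction k arbitrary: z)
    case 0
    show ?case by (simp add: w0 wS u0 uS f0 F0)
  next
    case (Suc k)
    have b: "\<bar>u (Suc k) z\<bar> \<le> w (Suc k) z" for z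
      using Suc[of z] by linarith
    have iu: "integrable M (\<lambda>y. K z y * f (u j y))" if "j \<le> Suc k" "j \<ge> k" for j
      using that b Suc w_step order_trans by (intro intf) (auto simp: le_Suc_eq, blast+)
    have iw: "integrable M (\<lambda>y. K z y * F (w j y))" for j
      using w_step by (intro intF) auto
    have "\<bar>u (Suc (Suc k)) z - u (Suc k) z\<bar> = \<bar>\<integral>y. K z y * f (u (Suc k) y) - K z y * f (u k y) \<partial>M\<bar>"
      using iu by (simp add: Bochner_Integration.integral_diff fun_cong[OF uS[of "Suc k"], of z] fun_cong[OF uS[of k], of z])
    also have "\<dots> \<le> (\<integral>y. K z y * F (w (Suc k) y) - K z y * F (w k y) \<partial>M)"
    proof (rule order_trans[OF integral_abs_bound], rule integral_mono)
      fix y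
      show "\<bar>K z y * f (u (Suc k) y) - K z y * f (u k y)\<bar> \<le> K z y * F (w (Suc k) y) - K z y * F (w k y)"
        unfolding right_diff_distrib[symmetric] abs_mult using Suc[of y] K_nonneg[of z y]
        by (simp add: mult_left_mono majorant)
    qed (use iu iw in auto)
    also have "\<dots> = w (Suc (Suc k)) z - w (Suc k) z"
      using iw by (simp add: Bochner_Integration.integral_diff fun_cong[OF wS[of "Suc k"], of z] fun_cong[OF wS[of k], of z])
    finally show ?case using b by simp
  qed
  have u_le: "\<bar>u k z\<bar> \<le> W z" for k z
    using u_step w_step order_trans by blast
  have conv: "convergent (\<lambda>k. u k z)" for z
  proof -
    have "convergent (\<lambda>k. w k z)"
      using w_step by (intro Bseq_monoseq_convergent BseqI'[of _ "W z"] incseq_imp_monoseq) (auto simp: incseq_Suc_iff)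
    then have "Cauchy (\<lambda>k. w k z)" by (simp add: convergent_Cauchy)
    have d: "\<bar>u (k + j) z - u k z\<bar> \<le> w (k + j) z - w k z" for k j
    proof (induction j)
      case (Suc j)
      have "\<bar>u (Suc (k + j)) z - u (k + j) z\<bar> \<le> w (Suc (k + j)) z - w (k + j) z" using u_step by blast
      with Suc show ?case unfolding add_Suc_right by linarith
    qed simp
    have "Cauchy (\<lambda>k. u k z)"
    proof (rule metric_CauchyI)
      fix e :: real assume "e > 0"
      then obtain N where N: "\<And>m n. m \<ge> N \<Longrightarrow> n \<ge> N \<Longrightarrow> dist (w m z) (w n z) < e / 2"
        using \<open>Cauchy (\<lambda>k. w k z)\<close> metric_CauchyD[of "\<lambda>k. w k z" "e / 2"] by auto
      have c: "dist (u m z) (u N z) < e / 2" if "m \<ge> N" for m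
        using d[of N "m - N"] N[of m N] that by (simp add: dist_real_def)
      show "\<exists>M. \<forall>m\<ge>M. \<forall>n\<ge>M. dist (u m z) (u n z) < e"
        using c dist_triangle_half_l by blast
    qed
    then show ?thesis by (simp add: Cauchy_convergent)
  qed
  define v where "v = (\<lambda>z. lim (\<lambda>k. u k z))"
  have lim: "(\<lambda>k. u k z) \<longlonglongrightarrow> v z" for z
    using conv[of z] by (simp add: v_def convergent_LIMSEQ_iff)
  have vm [measurable]: "v \<in> borel_measurable M"
    by (rule borel_measurable_LIMSEQ_real[OF lim]) auto
  have vW: "\<bar>v z\<bar> \<le> W z" for z
    using u_le[of _ z] by (intro LIMSEQ_le_const2[OF tendsto_rabs[OF lim]]) auto
  have "v z = U z + (\<integral>y. K z y * f (v y) \<partial>M)" for z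
  proof -
    have "(\<lambda>k. \<integral>y. K z y * f (u k y) \<partial>M) \<longlonglongrightarrow> (\<integral>y. K z y * f (v y) \<partial>M)"
    proof (rule integral_dominated_convergence[where w = "\<lambda>y. K z y * F (W y)"])
      show "AE y in M. (\<lambda>k. K z y * f (u k y)) \<longlonglongrightarrow> K z y * f (v y)"
        by (intro AE_I2 tendsto_intros isCont_tendsto_compose[OF f_cont] lim)
      show "AE y in M. norm (K z y * f (u k y)) \<le> K z y * F (W y)" for k
        using fF[OF u_le] K_nonneg by (auto simp: abs_mult intro!: mult_left_mono)
    qed (use int in auto)
    then have "(\<lambda>k. u (Suc k) z) \<longlonglongrightarrow> U z + (\<integral>y. K z y * f (v y) \<partial>M)"
      unfolding uS by (intro tendsto_intros)
    then show ?thesis using LIMSEQ_Suc[OF lim[of z]] LIMSEQ_unique by blast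
  qed
  then show ?thesis by (rule that[OF vm vW intf[OF vm vW]])
qed

section \<open>The heat semigroup on nonnegative functions\<close>

lemma heat_eq_lborel:
  fixes \<phi> :: "real^'n \<Rightarrow> real"
  assumes [measurable]: "\<phi> \<in> borel_measurable borel"
  shows "heat t \<phi> x = (\<integral>y. heat_kernel t (x - y) * \<phi> y \<partial>lborel)"
  unfolding heat_def by (rule integral_completion) simp

lemma heat_measurable [measurable (raw)]:
  fixes \<phi> :: "real^'n \<Rightarrow> real"
  assumes [measurable]: "\<phi> \<in> borel_measurable borel" "f \<in> borel_measurable M" "g \<in> borel_measurable M"
  shows "(\<lambda>z. heat (f z) \<phi> (g z)) \<in> borel_measurable M"
  unfolding heat_eq_lborel[OF assms(1)] by measurable

text \<open>With values in \<open>ennreal\<close>, Tonelli and monotonicity apply without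
  integrability conditions. The real-valued \<open>heat\<close> is 0 by default where the
  convolution diverges, so the two agree only where \<open>nn_heat\<close> is finite.\<close>

definition nn_heat :: "real \<Rightarrow> (real^'n \<Rightarrow> real) \<Rightarrow> real^'n \<Rightarrow> ennreal" where
  "nn_heat t \<psi> x = (\<integral>\<^sup>+y. ennreal (heat_kernel t (x - y)) * ennreal (\<psi> y) \<partial>lborel)"

context
  fixes \<psi> :: "real^'n \<Rightarrow> real"
  assumes psi_measurable [measurable]: "\<psi> \<in> borel_measurable borel"
    and psi_nonneg: "\<And>y. 0 \<le> \<psi> y"
begin

lemma nn_heat_finite_integrable:
  assumes "nn_heat t \<psi> x < \<infinity>"
  shows "integrable lborel (\<lambda>y. heat_kernel t (x - y) * \<psi> y)"
  using assms psi_nonneg unfolding nn_heat_def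
  by (intro integrableI_bounded) (simp_all add: ennreal_mult abs_mult)

lemma ennreal_heat:
  assumes "nn_heat t \<psi> x < \<infinity>"
  shows "ennreal (heat t \<psi> x) = nn_heat t \<psi> x"
  using nn_heat_finite_integrable[OF assms] psi_nonneg
  by (simp add: heat_eq_lborel nn_heat_def ennreal_mult[symmetric] nn_integral_eq_integral)

lemma heat_nonneg: "0 \<le> heat t \<psi> x"
  using psi_nonneg by (simp add: heat_eq_lborel)

lemma nn_heat_measurable [measurable]: "(\<lambda>z. nn_heat (f z) \<psi> (g z)) \<in> borel_measurable M"
  if [measurable]: "f \<in> borel_measurable M" "g \<in> borel_measurable M"
  unfolding nn_heat_def by measurable

lemma nn_integral_nn_heat:
  assumes "t > 0"
  shows "(\<integral>\<^sup>+x. nn_heat t \<psi> x \<partial>lborel) = (\<integral>\<^sup>+y. ennreal (\<psi> y) \<partial>lborel)"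
  unfolding nn_heat_def
  by (subst lborel_pair.Fubini') (simp_all add: nn_integral_multc nn_integral_heat_kernel_diff[OF assms])

text \<open>The smoothing estimate from L^1 to L^\<infinity>, the source of the decay of
  \<open>Q\<close> in time.\<close>

lemma nn_heat_le_mass:
  assumes "t > 0"
  shows "nn_heat t \<psi> x \<le> ennreal (t powr (- (real CARD('n) / 2))) * (\<integral>\<^sup>+y. ennreal (\<psi> y) \<partial>lborel)"
  unfolding nn_heat_def
  by (subst nn_integral_cmult[symmetric])
     (auto intro!: nn_integral_mono mult_right_mono heat_kernel_le[OF assms] ennreal_leI)

lemma nn_heat_semigroup:
  assumes "a > 0" "b > 0"
  shows "(\<integral>\<^sup>+y. ennreal (heat_kernel a (x - y)) * nn_heat b \<psi> y \<partial>lborel) = nn_heat (a + b) \<psi> x"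
proof -
  have "(\<integral>\<^sup>+y. ennreal (heat_kernel a (x - y)) * nn_heat b \<psi> y \<partial>lborel) =
     (\<integral>\<^sup>+y. \<integral>\<^sup>+z. ennreal (heat_kernel a (x - y)) * ennreal (heat_kernel b (y - z)) * ennreal (\<psi> z) \<partial>lborel \<partial>lborel)"
    unfolding nn_heat_def by (subst nn_integral_cmult[symmetric]) (auto simp: mult.assoc)
  also have "\<dots> = (\<integral>\<^sup>+z. \<integral>\<^sup>+y. ennreal (heat_kernel a (x - y)) * ennreal (heat_kernel b (y - z)) * ennreal (\<psi> z) \<partial>lborel \<partial>lborel)"
    by (subst lborel_pair.Fubini') auto
  also have "\<dots> = nn_heat (a + b) \<psi> x"
    unfolding nn_heat_def
    by (intro nn_integral_cong, subst nn_integral_multc) (simp_all add: heat_kernel_semigroup[OF assms])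
  finally show ?thesis .
qed

lemma nn_heat_time_mono:
  assumes "0 < a" "a \<le> b"
  shows "nn_heat a \<psi> x \<le> ennreal ((b / a) powr (real CARD('n) / 2)) * nn_heat b \<psi> x"
  unfolding nn_heat_def
  by (subst nn_integral_cmult[symmetric])
     (auto intro!: nn_integral_mono mult_right_mono ennreal_leI heat_kernel_time_mono[OF assms]
        simp: mult.assoc[symmetric] ennreal_mult[symmetric])

end

text \<open>Convexity and monotonicity on the half line in the form of supporting lines. The
  nonnegative slope lets Jensen's inequality be run in \<open>ennreal\<close>.\<close>

definition supported_below :: "(real \<Rightarrow> real) \<Rightarrow> bool" where
  "supported_below \<Phi> \<longleftrightarrow> (\<forall>a\<ge>0. \<exists>k\<ge>0. \<forall>y\<ge>0. \<Phi> a + k * (y - a) \<le> \<Phi> y)"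

text \<open>Bernoulli's inequality: the tangent at 1 of a convex power. Other points of tangency
  follow by homogeneity.\<close>

lemma powr_ge_tangent_one:
  fixes z b :: real
  assumes "z \<ge> 0" "b \<ge> 1"
  shows "1 + b * (z - 1) \<le> z powr b"
proof (cases "z = 0")
  case False
  have "((\<lambda>x. x powr b) has_field_derivative b) (at 1 within {0<..})"
    by (auto intro!: derivative_eq_intros)
  from convex_on_imp_above_tangent[OF powr_convex[OF assms(2)] _ _ _ this, of z] False assms
  show ?thesis by (simp add: interior_open)
qed (use assms in simp)

lemma supported_below_powr:
  assumes "b \<ge> 1"
  shows "supported_below (\<lambda>y. y powr b)"
  unfolding supported_below_def
proof (intro allI impI)
  fix a :: real assume "a \<ge> 0"
  show "\<exists>k\<ge>0. \<forall>y\<ge>0. a powr b + k * (y - a) \<le> y powr b"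
  proof (cases "a = 0")
    case False
    with \<open>a \<ge> 0\<close> have a: "a > 0" by simp
    show ?thesis
    \<comment> \<open>The slope is the derivative of \<open>y powr b\<close> at \<open>a\<close>,
      written as a multiple of \<open>a powr b\<close> to match the rescaled tangent at 1.\<close>
    proof (intro exI[of _ "a powr b * (b / a)"] conjI allI impI)
      fix y :: real assume y: "y \<ge> 0"
      have "a powr b * (1 + b * (y / a - 1)) \<le> a powr b * (y / a) powr b"
        using a y assms by (intro mult_left_mono powr_ge_tangent_one) auto
      also have "\<dots> = y powr b" using a y by (simp add: powr_divide)
      also have "a powr b * (1 + b * (y / a - 1)) = a powr b + a powr b * (b / a) * (y - a)"
        using a by (simp add: field_simps)
      finally show "a powr b + a powr b * (b / a) * (y - a) \<le> y powr b" .
    qed (use a assms in auto)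
  qed (auto intro: exI[of _ 0])
qed

text \<open>The tangent of \<open>exp\<close> at \<open>a powr b\<close> is composed with the
  supporting line of the power; the slope is the one given by the chain rule.\<close>

lemma supported_below_exp_young:
  assumes "b \<ge> 1"
  shows "supported_below (exp_young b)"
  unfolding supported_below_def
proof (intro allI impI)
  fix a :: real assume "a \<ge> 0"
  then obtain k where k: "k \<ge> 0" "\<And>y. y \<ge> 0 \<Longrightarrow> a powr b + k * (y - a) \<le> y powr b"
    using supported_below_powr[OF assms] unfolding supported_below_def by blast
  show "\<exists>k\<ge>0. \<forall>y\<ge>0. exp_young b a + k * (y - a) \<le> exp_young b y"
  proof (intro exI[of _ "exp (a powr b) * k"] conjI allI impI)
    fix y :: real assume y: "y \<ge> 0"
    have "exp (a powr b) * (1 + k * (y - a)) \<le> exp (a powr b) * (1 + (y powr b - a powr b))"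
      using k(2)[OF y] by simp
    also have "\<dots> \<le> exp (a powr b) * exp (y powr b - a powr b)"
      by (intro mult_left_mono exp_ge_add_one_self) auto
    also have "\<dots> = exp (y powr b)" by (simp add: exp_add[symmetric])
    finally show "exp_young b a + exp (a powr b) * k * (y - a) \<le> exp_young b y"
      by (simp add: exp_young_def algebra_simps)
  qed (use k in auto)
qed

text \<open>The kernel is a probability density, so the supporting line of \<open>\<Phi>\<close> at
  the mean \<open>heat t \<psi> x\<close> can be integrated against it. The negative term of the
  line is moved to the other side, and the finite quantity \<open>k * a\<close> is cancelled only at
  the end.\<close>

lemma heat_jensen:
  fixes \<psi> :: "real^'n \<Rightarrow> real"
  assumes t: "t > 0" and \<Phi>: "supported_below \<Phi>" "\<And>y. 0 \<le> y \<Longrightarrow> 0 \<le> \<Phi> y"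
    and [measurable]: "\<psi> \<in> borel_measurable borel" "\<Phi> \<in> borel_measurable borel"
    and nonneg: "\<And>y. 0 \<le> \<psi> y" and fin: "nn_heat t \<psi> x < \<infinity>"
  shows "ennreal (\<Phi> (heat t \<psi> x)) \<le> nn_heat t (\<lambda>y. \<Phi> (\<psi> y)) x"
proof -
  define a where "a = heat t \<psi> x"
  have a: "a \<ge> 0" unfolding a_def by (rule heat_nonneg) (use nonneg in auto)
  have a_eq: "ennreal a = nn_heat t \<psi> x" unfolding a_def by (rule ennreal_heat) (use nonneg fin in auto)
  obtain k where k: "k \<ge> 0" "\<And>y. y \<ge> 0 \<Longrightarrow> \<Phi> a + k * (y - a) \<le> \<Phi> y"
    using \<Phi>(1) a unfolding supported_below_def by blast
  let ?G = "\<lambda>y. ennreal (heat_kernel t (x - y))"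
  have "ennreal (\<Phi> a) + ennreal k * ennreal a = (\<integral>\<^sup>+y. ?G y * ennreal (\<Phi> a) + ennreal k * (?G y * ennreal (\<psi> y)) \<partial>lborel)"
    by (subst nn_integral_add) (simp_all add: nn_integral_multc nn_integral_cmult nn_integral_heat_kernel_diff[OF t] a_eq nn_heat_def)
  also have "\<dots> \<le> (\<integral>\<^sup>+y. ?G y * ennreal (\<Phi> (\<psi> y)) + ?G y * (ennreal k * ennreal a) \<partial>lborel)"
  proof (intro nn_integral_mono)
    fix y
    have "heat_kernel t (x - y) * (\<Phi> a + k * \<psi> y) \<le> heat_kernel t (x - y) * (\<Phi> (\<psi> y) + k * a)"
      using k(2)[OF nonneg[of y]] by (intro mult_left_mono) (auto simp: algebra_simps)
    then show "?G y * ennreal (\<Phi> a) + ennreal k * (?G y * ennreal (\<psi> y)) \<le> ?G y * ennreal (\<Phi> (\<psi> y)) + ?G y * (ennreal k * ennreal a)"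
      using k a nonneg \<Phi>(2) by (simp add: ennreal_mult[symmetric] ennreal_plus[symmetric] algebra_simps del: ennreal_plus)
  qed
  also have "\<dots> = nn_heat t (\<lambda>y. \<Phi> (\<psi> y)) x + ennreal k * ennreal a"
    by (subst nn_integral_add) (simp_all add: nn_integral_multc nn_integral_heat_kernel_diff[OF t] nn_heat_def)
  finally show ?thesis
    using k a by (simp add: a_def ennreal_mult[symmetric] add.commute[of _ "ennreal (k * heat t \<psi> x)"] ennreal_add_left_cancel_le)
qed

text \<open>Since \<open>y \<le> 1 + y powr b\<close>, the function is dominated by a constant plus
  an integrable function: the first contributes at most 1, the second is covered by
  \<open>nn_heat_le_mass\<close>.\<close>

lemma nn_heat_finite:
  fixes \<psi> :: "real^'n \<Rightarrow> real"
  assumes t: "t > 0" and [measurable]: "\<psi> \<in> borel_measurable borel" and nonneg: "\<And>y. 0 \<le> \<psi> y"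
    and b: "b \<ge> 1" and fin: "(\<integral>\<^sup>+y. ennreal (\<psi> y powr b) \<partial>lborel) < \<infinity>"
  shows "nn_heat t \<psi> x < \<infinity>"
proof -
  let ?G = "\<lambda>y. ennreal (heat_kernel t (x - y))"
  have le: "y \<le> 1 + y powr b" if "y \<ge> 0" for y :: real
  proof (cases "y \<le> 1")
    case False
    then have "1 * (y - 1) \<le> b * (y - 1)" using b by (intro mult_right_mono) auto
    then have "y \<le> 1 + b * (y - 1)" by simp
    also have "\<dots> \<le> y powr b" by (rule powr_ge_tangent_one[OF that b])
    finally show ?thesis by simp
  qed (simp add: add_increasing2)
  have "nn_heat t \<psi> x \<le> (\<integral>\<^sup>+y. ?G y + ?G y * ennreal (\<psi> y powr b) \<partial>lborel)"
    unfolding nn_heat_def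
  proof (intro nn_integral_mono)
    fix y
    have "heat_kernel t (x - y) * \<psi> y \<le> heat_kernel t (x - y) * (1 + \<psi> y powr b)"
      by (intro mult_left_mono le nonneg) simp
    then show "?G y * ennreal (\<psi> y) \<le> ?G y + ?G y * ennreal (\<psi> y powr b)"
      using nonneg by (simp add: ennreal_mult[symmetric] ennreal_plus[symmetric] algebra_simps del: ennreal_plus)
  qed
  also have "\<dots> = 1 + nn_heat t (\<lambda>y. \<psi> y powr b) x"
    by (subst nn_integral_add) (simp_all add: nn_integral_heat_kernel_diff[OF t] nn_heat_def)
  also have "\<dots> \<le> 1 + ennreal (t powr (- (real CARD('n) / 2))) * (\<integral>\<^sup>+y. ennreal (\<psi> y powr b) \<partial>lborel)"
    by (intro add_left_mono nn_heat_le_mass t) auto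
  also have "\<dots> < \<infinity>" using fin by (simp add: ennreal_mult_less_top)
  finally show ?thesis .
qed

section \<open>The nonlinearity along the supersolution\<close>

lemma powr_add_le:
  fixes a b k :: real
  assumes "a \<ge> 0" "b \<ge> 0" "k > 0"
  shows "(a + b) powr k \<le> 2 powr k * (a powr k + b powr k)"
proof -
  have "(a + b) powr k \<le> (2 * max a b) powr k" using assms by (intro powr_mono2) auto
  also have "\<dots> = 2 powr k * (max a b) powr k" using assms by (simp add: powr_mult)
  also have "\<dots> \<le> 2 powr k * (a powr k + b powr k)"
    by (intro mult_left_mono) (auto simp: max_def)
  finally show ?thesis .
qed

text \<open>After division by \<open>z\<close> the two summands lie in [0,1] and add up to 1, and a
  power \<open>k \<ge> 1\<close> only decreases numbers in that interval.\<close>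

lemma powr_superadd:
  fixes z k :: real
  assumes z: "z \<ge> 1" and k: "k \<ge> 1"
  shows "(z - 1) powr k \<le> z powr k - 1"
proof -
  have "((z - 1) / z) powr k \<le> (z - 1) / z" "(1 / z) powr k \<le> 1 / z"
    using z k powr_mono'[of 1 k "(z - 1) / z"] powr_mono'[of 1 k "1 / z"] by auto
  moreover have "(z - 1) / z + 1 / z = 1" using z by (simp add: field_simps)
  ultimately have "((z - 1) / z) powr k + (1 / z) powr k \<le> 1" by linarith
  then have "z powr k * (((z - 1) / z) powr k + (1 / z) powr k) \<le> z powr k * 1"
    using z by (intro mult_left_mono) auto
  moreover have "z powr k * (((z - 1) / z) powr k + (1 / z) powr k) = (z - 1) powr k + 1"
    using z by (simp add: powr_divide distrib_left)
  ultimately show ?thesis by simp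
qed

text \<open>Raise \<open>y / k \<le> exp (y / k) - 1\<close> to the power \<open>k\<close> and apply
  superadditivity with \<open>z = exp (y / k)\<close>. The vanishing at \<open>y = 0\<close> is
  kept, which is essential on a space of infinite measure.\<close>

lemma powr_le_exp_minus_one:
  fixes y k :: real
  assumes y: "y \<ge> 0" and k: "k \<ge> 1"
  shows "y powr k \<le> k powr k * (exp y - 1)"
proof -
  have "y / k \<le> exp (y / k) - 1" using exp_ge_add_one_self[of "y / k"] by linarith
  then have "(y / k) powr k \<le> (exp (y / k) - 1) powr k" using y k by (intro powr_mono2) auto
  also have "\<dots> \<le> exp (y / k) powr k - 1" using y k by (intro powr_superadd) auto
  also have "exp (y / k) powr k = exp y" using k by (simp add: powr_def)
  finally have "k powr k * (y / k) powr k \<le> k powr k * (exp y - 1)" by (intro mult_left_mono) auto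
  then show ?thesis using y k by (simp add: powr_divide)
qed

lemma exp_young_nonneg: "0 \<le> exp_young p s"
  by (simp add: exp_young_def)

lemma exp_young_zero [simp]: "exp_young p 0 = 0"
  by (simp add: exp_young_def)

lemma exp_young_measurable [measurable]: "exp_young p \<in> borel_measurable borel"
  unfolding exp_young_def by measurable

lemma exp_young_mono: "p > 0 \<Longrightarrow> 0 \<le> a \<Longrightarrow> a \<le> b \<Longrightarrow> exp_young p a \<le> exp_young p b"
  by (simp add: exp_young_def powr_mono2)

text \<open>The embedding of exp L^p into L^q for \<open>q \<ge> p\<close>, at the level of
  integrands.\<close>

lemma powr_le_exp_young:
  assumes "0 < p" "p \<le> q" "s \<ge> 0"
  shows "s powr q \<le> (q / p) powr (q / p) * exp_young p s"
  using powr_le_exp_minus_one[of "s powr p" "q / p"] assms by (simp add: exp_young_def powr_powr)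

lemma le_powr_inverse:
  fixes x y q :: real
  assumes "0 \<le> x" "q > 0" "x powr q \<le> y"
  shows "x \<le> y powr (1 / q)"
proof -
  have "x = (x powr q) powr (1 / q)" using assms by (simp add: powr_powr)
  also have "\<dots> \<le> y powr (1 / q)" using assms by (intro powr_mono2) auto
  finally show ?thesis .
qed

lemma powr_le_mult_powr:
  fixes x y k :: real
  assumes "0 \<le> x" "x \<le> c * y" "k \<ge> 0" "c \<ge> 0" "y \<ge> 0"
  shows "x powr k \<le> c powr k * y powr k"
  using powr_mono2[OF assms(3,1,2)] assms by (simp add: powr_mult)

text \<open>For \<open>s \<ge> 1\<close> the decay exponent \<open>q = d (m - 1)\<close> is used, for \<open>s \<le> 1\<close> a large \<open>q\<close>, the
  exponential factor being absorbed by a small negative power of \<open>s\<close>.\<close>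

lemma majorant_bound:
  fixes d m p r C0 lam :: real and B :: "real \<Rightarrow> real"
  assumes d: "d > 0" and r: "1 < r" "r < p" and pm: "p \<le> m" and qc: "d * (m - 1) \<ge> p"
    and C0: "C0 > 0" and lam: "lam > 0"
  defines "\<beta> \<equiv> (r - 1) / (m - 1)"
  shows "\<exists>e0>0. \<forall>e s Q. 0 < e \<longrightarrow> e \<le> e0 \<longrightarrow> 0 < s \<longrightarrow> 0 \<le> Q \<longrightarrow>
    (\<forall>q\<ge>p. Q \<le> B q * e powr r * s powr (- (d * r / q))) \<longrightarrow>
    exp_young (p / r) (Q / e powr r) \<le> s powr (- d) \<longrightarrow>
    2 * C0 * ((Q powr (1 / r) + s powr \<beta> * Q) powr m * exp (lam * (Q powr (1 / r) + s powr \<beta> * Q) powr p))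
      \<le> \<beta> * s powr (\<beta> - 1) * Q"
proof -
  have m1: "m - 1 > 0" and p1: "p > 1" and mr: "m - r > 0" using r pm by auto
  have \<beta>: "0 < \<beta>" "\<beta> < 1" using r pm by (auto simp: \<beta>_def field_simps)
  have \<beta>': "1 - \<beta> = (m - r) / (m - 1)" using m1 by (simp add: \<beta>_def field_simps)
  \<comment> \<open>For \<open>s \<le> 1\<close> the available singularity
    \<open>s powr (\<beta> - 1)\<close> is shared equally between the power factor and the
    exponential factor.\<close>
  define g where "g = (1 - \<beta>) / 2"
  have g: "g > 0" using \<beta> by (simp add: g_def)
  define q1 where "q1 = d * (m - 1)"
  \<comment> \<open>Large enough that the singularity of \<open>Q\<close> is absorbed by
    \<open>s powr \<beta>\<close>, and that of \<open>Q powr ((m - r) / r)\<close> stays within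
    \<open>s powr (- g)\<close>.\<close>
  define q2 where "q2 = Max {p, d * r / \<beta>, d * (m - r) / g}"
  have q2: "q2 \<ge> p" "q2 \<ge> d * r / \<beta>" "q2 \<ge> d * (m - r) / g" unfolding q2_def by (intro Max_ge; simp)+
  have q2': "d * r / q2 \<le> \<beta>" "d * (m - r) / q2 \<le> g"
    using q2 p1 \<beta> g by (auto simp: field_simps)
  define b where "b = Max {1, B q1, B q2}"
  have b: "b \<ge> 1" "b \<ge> B q1" "b \<ge> B q2" unfolding b_def by (intro Max_ge; simp)+
  \<comment> \<open>The two terms of \<open>W\<close> gain the powers \<open>m - r\<close> and
    \<open>r * (m - 1)\<close> of \<open>e\<close>; for \<open>e \<le> 1\<close> the smaller
    exponent serves both.\<close>
  define kp where "kp = min (m - r) (r * (m - 1))"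
  have kp: "kp > 0" "kp \<le> m - r" "kp \<le> r * (m - 1)" using mr m1 r by (auto simp: kp_def)
  \<comment> \<open>The 2 comes from \<open>1 + s powr (- d) \<le> 2 * s powr (- d)\<close> for
    \<open>s \<le> 1\<close>, raised to a power at most 1.\<close>
  define E where "E = 2 * exp (lam * 2 powr p * (b powr (p / r) + b powr p))"
  define Cc where "Cc = 2 * C0 * (2 powr m * (b powr ((m - r) / r) + b powr (m - 1)) * E)"
  have E: "E > 0" by (simp add: E_def)
  have Cc: "Cc > 0" using C0 E b by (simp add: Cc_def add_pos_pos)
  \<comment> \<open>Besides \<open>e \<le> 1\<close>, the second entry makes the coefficient
    \<open>Cc * e powr kp\<close> at most \<open>\<beta>\<close>, and the third makes the exponent
    \<open>\<delta>\<close> below satisfy \<open>\<delta> \<le> 1\<close> and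
    \<open>d * \<delta> \<le> g\<close>.\<close>
  define e0 where "e0 = Min {1, (\<beta> / Cc) powr (1 / kp), (min 1 (g / d) / (lam * 2 powr p)) powr (1 / p)}"
  have e0: "e0 > 0" "e0 \<le> 1" "e0 \<le> (\<beta> / Cc) powr (1 / kp)" "e0 \<le> (min 1 (g / d) / (lam * 2 powr p)) powr (1 / p)"
  proof -
    have "min 1 (g / d) > 0" using g d by simp
    then show "e0 > 0" unfolding e0_def using \<beta> Cc lam by (subst Min_gr_iff) auto
  qed (unfold e0_def, (intro Min_le; simp)+)
  show ?thesis
  proof (intro exI[of _ e0] conjI allI impI)
    fix e s Q :: real
    assume e: "0 < e" "e \<le> e0" and s: "0 < s" and Q: "0 \<le> Q"
      and QB: "\<forall>q\<ge>p. Q \<le> B q * e powr r * s powr (- (d * r / q))"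
      and Qexp: "exp_young (p / r) (Q / e powr r) \<le> s powr (- d)"
    have e1: "e \<le> 1" using e e0 by simp
    have ekp: "Cc * e powr kp \<le> \<beta>"
    proof -
      have "e powr kp \<le> ((\<beta> / Cc) powr (1 / kp)) powr kp" using e e0 kp by (intro powr_mono2) auto
      also have "\<dots> = \<beta> / Cc" using kp \<beta> Cc by (simp add: powr_powr)
      finally show ?thesis using Cc by (simp add: field_simps)
    qed
    have elam: "lam * 2 powr p * e powr p \<le> min 1 (g / d)"
    proof -
      have "e powr p \<le> ((min 1 (g / d) / (lam * 2 powr p)) powr (1 / p)) powr p" using e e0 p1 by (intro powr_mono2) auto
      also have "\<dots> = min 1 (g / d) / (lam * 2 powr p)" using p1 lam g d by (simp add: powr_powr)
      finally show ?thesis using lam by (simp add: field_simps)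
    qed
    have Qb: "Q \<le> b * e powr r * s powr (- (d * r / q))" if "q = q1 \<or> q = q2" for q
    proof -
      have "q \<ge> p" using that q2 qc q1_def by auto
      then have "Q \<le> B q * e powr r * s powr (- (d * r / q))" using QB by blast
      also have "\<dots> \<le> b * e powr r * s powr (- (d * r / q))" using that b by (intro mult_right_mono) auto
      finally show ?thesis .
    qed
    have er: "e powr r \<le> 1" using e e1 r by (simp add: powr_le1)
    define Z where "Z = s powr \<beta> * Q"
    have Z: "Z \<ge> 0" using Q by (simp add: Z_def)
    \<comment> \<open>The target is linear in \<open>Q\<close>, so one factor \<open>Q\<close> is
      split off from each power.\<close>
    have p1': "Q powr (m / r) = Q * Q powr ((m - r) / r)"
    proof (cases "Q = 0")
      case False
      have "m / r = 1 + (m - r) / r" using r by (simp add: field_simps)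
      then show ?thesis using Q False by (simp add: powr_add)
    qed (use mr in auto)
    have p2': "Z powr m = Q * (s powr \<beta> * Z powr (m - 1))"
    proof (cases "Q = 0")
      case False
      then have "Z > 0" using s Q by (simp add: Z_def)
      then have "Z powr m = Z * Z powr (m - 1)" by (simp add: powr_mult_base)
      then show ?thesis by (simp add: Z_def)
    qed (use m1 in \<open>simp add: Z_def\<close>)
    \<comment> \<open>Only the sum of the exponents of \<open>s\<close> matters. Large times use
      \<open>\<beta> - 1\<close> and 0, the exponential being bounded there; small times use
      \<open>- g\<close> twice.\<close>
    obtain h1 h2 where
      A1: "Q powr ((m - r) / r) \<le> b powr ((m - r) / r) * e powr kp * s powr h1" and
      A2: "s powr \<beta> * Z powr (m - 1) \<le> b powr (m - 1) * e powr kp * s powr h1" and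
      A3: "exp (lam * 2 powr p * (Q powr (p / r) + Z powr p)) \<le> E * s powr h2" and
      h: "h1 + h2 = \<beta> - 1"
    proof (cases "s \<ge> 1")
      case True
      \<comment> \<open>At this value of \<open>q\<close> both \<open>Q powr (1 / r)\<close> and
        \<open>Z\<close> are bounded by multiples of \<open>s powr (- (1 / (m - 1)))\<close>, the
        rate dictated by the scaling of the pure power equation.\<close>
      have ex: "d * r / q1 = r / (m - 1)" using d by (simp add: q1_def)
      have Q1: "Q \<le> b * (e powr r * s powr (- (r / (m - 1))))" using Qb[of q1] ex by (simp add: mult.assoc)
      have Zeq: "s powr \<beta> * s powr (- (r / (m - 1))) = s powr (- (1 / (m - 1)))"
        using m1 by (simp add: powr_add[symmetric] \<beta>_def diff_divide_distrib)
      have Z1: "Z \<le> b * (e powr r * s powr (- (1 / (m - 1))))"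
      proof -
        have "Z \<le> s powr \<beta> * (b * (e powr r * s powr (- (r / (m - 1)))))"
          unfolding Z_def by (intro mult_left_mono Q1) auto
        also have "\<dots> = b * (e powr r * (s powr \<beta> * s powr (- (r / (m - 1)))))" by (simp add: mult_ac)
        finally show ?thesis unfolding Zeq .
      qed
      have le1: "s powr (- c) \<le> 1" if "c \<ge> 0" for c using True that powr_mono[of "-c" 0 s] by simp
      show thesis
      proof (rule that[of "\<beta> - 1" 0])
        have "Q powr ((m - r) / r) \<le> b powr ((m - r) / r) * (e powr r * s powr (- (r / (m - 1)))) powr ((m - r) / r)"
          by (rule powr_le_mult_powr[OF Q Q1]) (use mr r b in auto)
        also have "(e powr r * s powr (- (r / (m - 1)))) powr ((m - r) / r) = e powr (m - r) * s powr (\<beta> - 1)"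
        proof -
          have "- ((m - r) / (m - 1)) = \<beta> - 1" using \<beta>' by linarith
          then show ?thesis using r by (simp add: powr_mult powr_powr)
        qed
        also have "b powr ((m - r) / r) * (e powr (m - r) * s powr (\<beta> - 1)) \<le> b powr ((m - r) / r) * (e powr kp * s powr (\<beta> - 1))"
          using e e1 kp by (intro mult_left_mono mult_right_mono powr_mono') auto
        finally show "Q powr ((m - r) / r) \<le> b powr ((m - r) / r) * e powr kp * s powr (\<beta> - 1)" by (simp add: mult.assoc)
        have "s powr \<beta> * Z powr (m - 1) \<le> s powr \<beta> * (b powr (m - 1) * (e powr r * s powr (- (1 / (m - 1)))) powr (m - 1))"
          by (intro mult_left_mono powr_le_mult_powr[OF Z Z1]) (use m1 b in auto)
        also have "(e powr r * s powr (- (1 / (m - 1)))) powr (m - 1) = e powr (r * (m - 1)) * s powr (- 1)"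
          using m1 by (simp add: powr_mult powr_powr)
        also have "s powr \<beta> * (b powr (m - 1) * (e powr (r * (m - 1)) * s powr (- 1)))
            = b powr (m - 1) * (e powr (r * (m - 1)) * s powr (\<beta> - 1))"
          by (simp add: powr_diff powr_minus_divide s)
        also have "\<dots> \<le> b powr (m - 1) * (e powr kp * s powr (\<beta> - 1))"
          using e e1 kp by (intro mult_left_mono mult_right_mono powr_mono') auto
        finally show "s powr \<beta> * Z powr (m - 1) \<le> b powr (m - 1) * e powr kp * s powr (\<beta> - 1)" by (simp add: mult.assoc)
        have "e powr r * s powr (- c) \<le> 1" if "c \<ge> 0" for c
          using mult_mono[OF er le1[OF that]] by simp
        then have "b * (e powr r * s powr (- c)) \<le> b" if "c \<ge> 0" for c
          using mult_left_mono[of _ 1 b] b that by fastforce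
        then have "Q \<le> b" "Z \<le> b"
          using m1 r by (auto intro: order_trans[OF Q1] order_trans[OF Z1])
        then have "Q powr (p / r) + Z powr p \<le> b powr (p / r) + b powr p"
          using Q Z p1 r by (intro add_mono powr_mono2) auto
        then have "exp (lam * 2 powr p * (Q powr (p / r) + Z powr p)) \<le> exp (lam * 2 powr p * (b powr (p / r) + b powr p))"
          using lam by simp
        also have "\<dots> \<le> E"
          using exp_gt_zero[of "lam * 2 powr p * (b powr (p / r) + b powr p)"] unfolding E_def by linarith
        finally show "exp (lam * 2 powr p * (Q powr (p / r) + Z powr p)) \<le> E * s powr 0"
          using s by simp
      qed simp
    next
      case False
      have s1: "s \<le> 1" using False by simp
      have Q2: "Q \<le> b * (e powr r * s powr (- (d * r / q2)))" using Qb[of q2] by (simp add: mult.assoc)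
      have Z2: "Z \<le> b * e powr r"
      proof -
        have "Z \<le> s powr \<beta> * (b * (e powr r * s powr (- (d * r / q2))))"
          unfolding Z_def by (intro mult_left_mono Q2) auto
        also have "\<dots> = b * e powr r * s powr (\<beta> - d * r / q2)"
          using s by (simp add: powr_diff powr_minus_divide)
        also have "\<dots> \<le> b * e powr r * 1"
          using q2' s s1 b by (intro mult_left_mono powr_le1) auto
        finally show ?thesis by simp
      qed
      have ge1: "1 \<le> s powr (- g)" using s s1 g powr_mono'[of "-g" 0 s] by simp
      show thesis
      proof (rule that[of "- g" "- g"])
        have "Q powr ((m - r) / r) \<le> b powr ((m - r) / r) * (e powr r * s powr (- (d * r / q2))) powr ((m - r) / r)"
          by (rule powr_le_mult_powr[OF Q Q2]) (use mr r b in auto)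
        also have "(e powr r * s powr (- (d * r / q2))) powr ((m - r) / r) = e powr (m - r) * s powr (- (d * (m - r) / q2))"
          using r by (simp add: powr_mult powr_powr)
        also have "b powr ((m - r) / r) * (e powr (m - r) * s powr (- (d * (m - r) / q2))) \<le> b powr ((m - r) / r) * (e powr kp * s powr (- g))"
          using e e1 kp q2' s s1 by (intro mult_left_mono mult_mono powr_mono') auto
        finally show "Q powr ((m - r) / r) \<le> b powr ((m - r) / r) * e powr kp * s powr (- g)" by (simp add: mult.assoc)
        have "s powr \<beta> * Z powr (m - 1) \<le> 1 * (b powr (m - 1) * (e powr r) powr (m - 1))"
          by (intro mult_mono powr_le_mult_powr[OF Z Z2] powr_le1) (use m1 b s s1 \<beta> in auto)
        also have "\<dots> = b powr (m - 1) * e powr (r * (m - 1)) * 1" by (simp add: powr_powr)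
        also have "\<dots> \<le> b powr (m - 1) * e powr kp * s powr (- g)"
          using e e1 kp ge1 by (intro mult_mono mult_left_mono powr_mono') auto
        finally show "s powr \<beta> * Z powr (m - 1) \<le> b powr (m - 1) * e powr kp * s powr (- g)" .
        have "Z \<le> b * 1" using er b by (intro order_trans[OF Z2] mult_left_mono) auto
        then have Zp: "Z powr p \<le> b powr p" using Z p1 by (intro powr_mono2) auto
        \<comment> \<open>The exponential to be bounded is the \<open>\<delta>\<close>-th power of
          \<open>exp ((Q / e powr r) powr (p / r))\<close>, so the crude bound
          \<open>2 * s powr (- d)\<close> improves to a multiple of
          \<open>s powr (- (d * \<delta>))\<close>.\<close>
        define \<delta> where "\<delta> = lam * 2 powr p * e powr p"
        have \<delta>: "\<delta> \<ge> 0" "\<delta> \<le> 1" "d * \<delta> \<le> g" using elam lam d by (auto simp: \<delta>_def field_simps)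
        have "exp ((Q / e powr r) powr (p / r)) \<le> 1 + s powr (- d)" using Qexp by (simp add: exp_young_def)
        also have "\<dots> \<le> 2 * s powr (- d)" using s s1 d powr_mono'[of "-d" 0 s] by simp
        finally have x1: "exp ((Q / e powr r) powr (p / r)) \<le> 2 * s powr (- d)" .
        have "lam * 2 powr p * Q powr (p / r) = \<delta> * (Q / e powr r) powr (p / r)"
          using Q e r by (simp add: \<delta>_def powr_divide powr_powr)
        then have "exp (lam * 2 powr p * Q powr (p / r)) = exp ((Q / e powr r) powr (p / r)) powr \<delta>"
          by (simp add: powr_def)
        also have "\<dots> \<le> (2 * s powr (- d)) powr \<delta>" using x1 \<delta> by (intro powr_mono2) auto
        also have "\<dots> = 2 powr \<delta> * s powr (- (d * \<delta>))" using s by (simp add: powr_mult powr_powr)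
        also have "\<dots> \<le> 2 powr 1 * s powr (- g)" using \<delta> s s1 by (intro mult_mono powr_mono powr_mono') auto
        finally have x2: "exp (lam * 2 powr p * Q powr (p / r)) \<le> 2 * s powr (- g)" by simp
        have x3: "exp (lam * 2 powr p * Z powr p) \<le> exp (lam * 2 powr p * (b powr (p / r) + b powr p))"
          using Zp lam by (simp add: add_increasing)
        have "exp (lam * 2 powr p * (Q powr (p / r) + Z powr p)) = exp (lam * 2 powr p * Q powr (p / r)) * exp (lam * 2 powr p * Z powr p)"
          by (simp add: exp_add distrib_left)
        also have "\<dots> \<le> 2 * s powr (- g) * exp (lam * 2 powr p * (b powr (p / r) + b powr p))"
          by (intro mult_mono x2 x3) auto
        also have "\<dots> = E * s powr (- g)" by (simp add: E_def)
        finally show "exp (lam * 2 powr p * (Q powr (p / r) + Z powr p)) \<le> E * s powr (- g)" .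
      qed (simp add: g_def)
    qed
    define w where "w = Q powr (1 / r) + Z"
    have wm: "w powr m \<le> 2 powr m * (Q * (b powr ((m - r) / r) + b powr (m - 1)) * (e powr kp * s powr h1))"
    proof -
      have "w powr m \<le> 2 powr m * ((Q powr (1 / r)) powr m + Z powr m)"
        unfolding w_def using Z pm p1 by (intro powr_add_le) auto
      also have "(Q powr (1 / r)) powr m = Q * Q powr ((m - r) / r)" using p1' by (simp add: powr_powr)
      also have "2 powr m * (Q * Q powr ((m - r) / r) + Z powr m) \<le>
          2 powr m * (Q * (b powr ((m - r) / r) * e powr kp * s powr h1) + Q * (b powr (m - 1) * e powr kp * s powr h1))"
        unfolding p2' by (intro mult_left_mono add_mono A1 A2 Q) auto
      finally show ?thesis by (simp add: algebra_simps)
    qed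
    have wp: "exp (lam * w powr p) \<le> E * s powr h2"
    proof -
      have "w powr p \<le> 2 powr p * ((Q powr (1 / r)) powr p + Z powr p)"
        unfolding w_def using Z p1 by (intro powr_add_le) auto
      then have "lam * w powr p \<le> lam * 2 powr p * (Q powr (p / r) + Z powr p)"
        using lam by (simp add: powr_powr)
      then show ?thesis using A3 by (meson exp_le_cancel_iff order_trans)
    qed
    have "2 * C0 * (w powr m * exp (lam * w powr p)) \<le>
        2 * C0 * (2 powr m * (Q * (b powr ((m - r) / r) + b powr (m - 1)) * (e powr kp * s powr h1)) * (E * s powr h2))"
      using C0 Q by (intro mult_left_mono mult_mono wm wp) (auto intro!: mult_nonneg_nonneg)
    also have "\<dots> = Cc * e powr kp * (s powr (h1 + h2)) * Q" by (simp add: Cc_def powr_add mult_ac)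
    also have "\<dots> \<le> \<beta> * s powr (\<beta> - 1) * Q" unfolding h by (intro mult_right_mono ekp Q) auto
    finally show "2 * C0 * ((Q powr (1 / r) + s powr \<beta> * Q) powr m * exp (lam * (Q powr (1 / r) + s powr \<beta> * Q) powr p))
      \<le> \<beta> * s powr (\<beta> - 1) * Q" unfolding w_def Z_def .
  qed (use e0 in simp)
qed

section \<open>Caloric bounds for small data\<close>

lemma supported_below_scale:
  assumes "supported_below \<Phi>" "c > 0"
  shows "supported_below (\<lambda>y. \<Phi> (y / c))"
  unfolding supported_below_def
proof (intro allI impI)
  fix a :: real assume "a \<ge> 0"
  then have "a / c \<ge> 0" using assms by simp
  then obtain k where k: "k \<ge> 0" "\<And>y. y \<ge> 0 \<Longrightarrow> \<Phi> (a / c) + k * (y - a / c) \<le> \<Phi> y"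
    using assms unfolding supported_below_def by blast
  show "\<exists>k\<ge>0. \<forall>y\<ge>0. \<Phi> (a / c) + k * (y - a) \<le> \<Phi> (y / c)"
  proof (intro exI[of _ "k / c"] conjI allI impI)
    fix y :: real assume "y \<ge> 0"
    then have "\<Phi> (a / c) + k * (y / c - a / c) \<le> \<Phi> (y / c)" using k(2)[of "y / c"] assms by simp
    then show "\<Phi> (a / c) + k / c * (y - a) \<le> \<Phi> (y / c)" by (simp add: diff_divide_distrib right_diff_distrib)
  qed (use k assms in auto)
qed

lemma exp_young_powr_scale:
  assumes "y \<ge> 0" "e > 0" "r > 0"
  shows "exp_young (p / r) (y / e powr r) = exp_young p (y powr (1 / r) / e)"
  using assms by (simp add: exp_young_def powr_divide powr_powr)

text \<open>The size of the datum is recorded as a modular inequality at level \<open>e\<close>, the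
  form that Jensen's inequality and conservation of mass carry over to later times.\<close>

locale small_datum =
  fixes m p r e :: real and \<phi> :: "real^'n \<Rightarrow> real"
  assumes r: "1 < r" "r < p" and pm: "p \<le> m" and qc: "p \<le> real CARD('n) / 2 * (m - 1)"
    and e: "e > 0"
    and phi_measurable [measurable]: "\<phi> \<in> borel_measurable borel" and phi_nonneg: "\<And>y. 0 \<le> \<phi> y"
    and modular: "(\<integral>\<^sup>+y. ennreal (exp_young p (\<phi> y / e)) \<partial>lborel) \<le> 1"
begin

definition d :: real where "d = real CARD('n) / 2"
definition Q :: "real \<Rightarrow> real^'n \<Rightarrow> real" where "Q t x = heat t (\<lambda>y. \<phi> y powr r) x"
definition A :: "real \<Rightarrow> real" where "A q = (q / p) powr (q / p)"

lemma d_pos: "d > 0"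
  by (simp add: d_def)

lemma moment:
  assumes "q \<ge> p"
  shows "(\<integral>\<^sup>+y. ennreal (\<phi> y powr q) \<partial>lborel) \<le> ennreal (A q * e powr q)"
proof -
  have "(\<integral>\<^sup>+y. ennreal (\<phi> y powr q) \<partial>lborel) \<le> (\<integral>\<^sup>+y. ennreal (A q * e powr q) * ennreal (exp_young p (\<phi> y / e)) \<partial>lborel)"
  proof (intro nn_integral_mono)
    fix y
    have "(\<phi> y / e) powr q \<le> A q * exp_young p (\<phi> y / e)"
      unfolding A_def using r assms e phi_nonneg by (intro powr_le_exp_young) auto
    then have "e powr q * (\<phi> y / e) powr q \<le> e powr q * (A q * exp_young p (\<phi> y / e))"
      by (intro mult_left_mono) auto
    then have "\<phi> y powr q \<le> (A q * e powr q) * exp_young p (\<phi> y / e)"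
      using e by (simp add: powr_divide mult_ac)
    then show "ennreal (\<phi> y powr q) \<le> ennreal (A q * e powr q) * ennreal (exp_young p (\<phi> y / e))"
      by (simp add: ennreal_mult[symmetric] exp_young_nonneg A_def ennreal_leI)
  qed
  also have "\<dots> = ennreal (A q * e powr q) * (\<integral>\<^sup>+y. ennreal (exp_young p (\<phi> y / e)) \<partial>lborel)"
    by (rule nn_integral_cmult) simp
  also have "\<dots> \<le> ennreal (A q * e powr q) * 1"
    by (intro mult_left_mono modular) simp
  finally show ?thesis by simp
qed

text \<open>The power \<open>p / r\<close> turns \<open>\<phi> y powr r\<close> into
  \<open>\<phi> y powr p\<close>, whose integral is bounded by \<open>moment\<close>.\<close>

lemma nn_heat_psi_finite: "t > 0 \<Longrightarrow> nn_heat t (\<lambda>y. \<phi> y powr r) x < \<infinity>"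
  using r order_le_less_trans[OF moment[of p]]
  by (intro nn_heat_finite[of t _ "p / r"]) (auto simp: powr_powr)

lemma ennreal_Q: "t > 0 \<Longrightarrow> ennreal (Q t x) = nn_heat t (\<lambda>y. \<phi> y powr r) x"
  unfolding Q_def using nn_heat_psi_finite by (intro ennreal_heat) auto

lemma Q_nonneg [simp]: "0 \<le> Q t x"
  unfolding Q_def by (rule heat_nonneg) auto

lemma Q_measurable [measurable (raw)]:
  "f \<in> borel_measurable M \<Longrightarrow> g \<in> borel_measurable M \<Longrightarrow> (\<lambda>z. Q (f z) (g z)) \<in> borel_measurable M"
  unfolding Q_def by measurable

lemma Q_jensen:
  assumes "t > 0" "b \<ge> 1"
  shows "ennreal (Q t x powr b) \<le> nn_heat t (\<lambda>y. \<phi> y powr (r * b)) x"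
  using heat_jensen[OF assms(1) supported_below_powr[OF assms(2)], of "\<lambda>y. \<phi> y powr r" x] nn_heat_psi_finite[OF assms(1)]
  by (simp add: Q_def powr_powr)

text \<open>As a function of \<open>\<phi> powr r\<close> the modular integrand is
  \<open>exp_young (p / r)\<close> up to scaling, which is still convex because
  \<open>r < p\<close>.\<close>

lemma Q_jensen_exp:
  assumes "t > 0"
  shows "ennreal (exp_young p (Q t x powr (1 / r) / e)) \<le> nn_heat t (\<lambda>y. exp_young p (\<phi> y / e)) x"
proof -
  have "ennreal (exp_young (p / r) (Q t x / e powr r)) \<le> nn_heat t (\<lambda>y. exp_young (p / r) (\<phi> y powr r / e powr r)) x"
    unfolding Q_def
    by (rule heat_jensen[OF assms supported_below_scale[OF supported_below_exp_young]])
       (use r e nn_heat_psi_finite[OF assms] in \<open>auto simp: exp_young_nonneg\<close>)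
  also have "(\<lambda>y. exp_young (p / r) (\<phi> y powr r / e powr r)) = (\<lambda>y. exp_young p (\<phi> y / e))"
    using r e phi_nonneg by (simp add: exp_young_powr_scale powr_powr)
  finally show ?thesis using r e by (simp add: exp_young_powr_scale)
qed

lemma Q_exp_bound:
  assumes "t > 0"
  shows "exp_young (p / r) (Q t x / e powr r) \<le> t powr (- d)"
proof -
  have "ennreal (exp_young p (Q t x powr (1 / r) / e)) \<le> ennreal (t powr (- d)) * (\<integral>\<^sup>+y. ennreal (exp_young p (\<phi> y / e)) \<partial>lborel)"
    unfolding d_def by (rule order_trans[OF Q_jensen_exp[OF assms] nn_heat_le_mass[OF _ _ assms]]) (auto simp: exp_young_nonneg)
  also have "\<dots> \<le> ennreal (t powr (- d)) * 1" by (intro mult_left_mono modular) auto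
  finally show ?thesis using r e by (simp add: exp_young_powr_scale)
qed

text \<open>By conservation of mass \<open>Q powr (1 / r)\<close> stays at the level
  \<open>e\<close> of the datum for all times, which bounds the first term of the supersolution in
  exp L^p.\<close>

lemma Q_modular:
  assumes "t > 0"
  shows "(\<integral>\<^sup>+x. ennreal (exp_young p (Q t x powr (1 / r) / e)) \<partial>lborel) \<le> 1"
proof -
  have "(\<integral>\<^sup>+x. ennreal (exp_young p (Q t x powr (1 / r) / e)) \<partial>lborel) \<le> (\<integral>\<^sup>+x. nn_heat t (\<lambda>y. exp_young p (\<phi> y / e)) x \<partial>lborel)"
    by (intro nn_integral_mono Q_jensen_exp assms)
  also have "\<dots> \<le> 1" using modular by (subst nn_integral_nn_heat[OF _ _ assms]) (auto simp: exp_young_nonneg)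
  finally show ?thesis .
qed

text \<open>Jensen with the power \<open>q / r\<close> replaces \<open>Q\<close> by the evolution of
  \<open>\<phi> powr q\<close>, an integrable function; smoothing and a root give the rate.\<close>

lemma Q_powr_bound:
  assumes "t > 0" "q \<ge> p"
  shows "Q t x \<le> A q powr (r / q) * e powr r * t powr (- (d * r / q))"
proof -
  have "ennreal (Q t x powr (q / r)) \<le> nn_heat t (\<lambda>y. \<phi> y powr (r * (q / r))) x"
    using r assms by (intro Q_jensen) auto
  also have "\<dots> \<le> ennreal (t powr (- d)) * (\<integral>\<^sup>+y. ennreal (\<phi> y powr (r * (q / r))) \<partial>lborel)"
    unfolding d_def by (rule nn_heat_le_mass[OF _ _ assms(1)]) auto
  also have "\<dots> \<le> ennreal (t powr (- d)) * ennreal (A q * e powr q)"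
    using r moment[OF assms(2)] by (intro mult_left_mono) auto
  finally have "Q t x powr (q / r) \<le> t powr (- d) * (A q * e powr q)"
    by (simp add: ennreal_mult[symmetric] A_def)
  then have "Q t x \<le> (t powr (- d) * (A q * e powr q)) powr (1 / (q / r))"
    using r assms by (intro le_powr_inverse) auto
  also have "\<dots> = A q powr (r / q) * e powr r * t powr (- (d * r / q))"
    using r assms by (simp add: powr_mult powr_powr)
  finally show ?thesis .
qed

lemma nn_integral_Q_powr:
  assumes "t > 0" "b \<ge> 1" "r * b \<ge> p"
  shows "(\<integral>\<^sup>+x. ennreal (Q t x powr b) \<partial>lborel) \<le> ennreal (A (r * b) * e powr (r * b))"
proof -
  have "(\<integral>\<^sup>+x. ennreal (Q t x powr b) \<partial>lborel) \<le> (\<integral>\<^sup>+x. nn_heat t (\<lambda>y. \<phi> y powr (r * b)) x \<partial>lborel)"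
    by (intro nn_integral_mono Q_jensen assms)
  also have "\<dots> \<le> ennreal (A (r * b) * e powr (r * b))"
    using moment[OF assms(3)] by (subst nn_integral_nn_heat[OF _ _ assms(1)]) auto
  finally show ?thesis .
qed

text \<open>Interpolation between the bounds on \<open>Q powr b\<close> in \<open>L\<^sup>1\<close> and on \<open>Q\<close> in \<open>L\<^sup>\<infinity>\<close>.\<close>

lemma nn_integral_Q_powr_decay:
  assumes t: "t > 0" and q: "q \<ge> p" and c: "c * r \<ge> q"
  shows "(\<integral>\<^sup>+x. ennreal (Q t x powr c) \<partial>lborel) \<le>
    ennreal ((A q powr (r / q) * e powr r) powr (c - q / r) * (A q * e powr q) * t powr (- (d * r * c / q - d)))"
proof -
  define M where "M = A q powr (r / q) * e powr r * t powr (- (d * r / q))"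
  have qr: "q / r \<ge> 1" "c - q / r \<ge> 0" using r q c by (auto simp: field_simps)
  have "(\<integral>\<^sup>+x. ennreal (Q t x powr c) \<partial>lborel) \<le> (\<integral>\<^sup>+x. ennreal (M powr (c - q / r)) * ennreal (Q t x powr (q / r)) \<partial>lborel)"
  proof (intro nn_integral_mono)
    fix x
    have "Q t x powr c = Q t x powr (c - q / r) * Q t x powr (q / r)"
      by (simp add: powr_add[symmetric])
    also have "\<dots> \<le> M powr (c - q / r) * Q t x powr (q / r)"
      unfolding M_def using qr by (intro mult_right_mono powr_mono2 Q_powr_bound t q) auto
    finally show "ennreal (Q t x powr c) \<le> ennreal (M powr (c - q / r)) * ennreal (Q t x powr (q / r))"
      by (simp add: ennreal_mult[symmetric] ennreal_leI)
  qed
  also have "\<dots> \<le> ennreal (M powr (c - q / r)) * ennreal (A q * e powr q)"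
    using nn_integral_Q_powr[OF t, of "q / r"] r q qr by (subst nn_integral_cmult) (auto intro!: mult_left_mono)
  also have "\<dots> = ennreal ((A q powr (r / q) * e powr r) powr (c - q / r) * (A q * e powr q) * t powr (- (d * r / q) * (c - q / r)))"
    by (simp add: M_def powr_mult powr_powr ennreal_mult[symmetric] A_def mult_ac)
  also have "- (d * r / q) * (c - q / r) = - (d * r * c / q - d)"
    using r q by (simp add: field_simps)
  finally show ?thesis .
qed

text \<open>Jensen with the power \<open>r\<close> gives \<open>(S(t) \<phi>)^r \<le> Q\<close>. The
  second bound keeps the absolute value inside the integral, since estimates of time differences
  need it in that form.\<close>

lemma heat_le_Q:
  fixes v :: "real^'n \<Rightarrow> real"
  assumes t: "t > 0" and [measurable]: "v \<in> borel_measurable borel" and v: "\<And>y. \<bar>v y\<bar> \<le> \<phi> y"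
  shows "integrable lborel (\<lambda>y. heat_kernel t (x - y) * v y)"
    and "(\<integral>y. \<bar>heat_kernel t (x - y) * v y\<bar> \<partial>lborel) \<le> Q t x powr (1 / r)"
proof -
  have fin: "nn_heat t \<phi> x < \<infinity>"
    using r order_le_less_trans[OF moment[of p]] phi_nonneg t by (intro nn_heat_finite[of t _ p]) auto
  have int: "integrable lborel (\<lambda>y. heat_kernel t (x - y) * \<phi> y)"
    using phi_nonneg fin by (intro nn_heat_finite_integrable) auto
  show i: "integrable lborel (\<lambda>y. heat_kernel t (x - y) * v y)"
    by (rule Bochner_Integration.integrable_bound[OF int])
       (use v phi_nonneg in \<open>auto simp: abs_mult intro!: mult_left_mono\<close>)
  have "ennreal (heat t \<phi> x powr r) \<le> nn_heat t (\<lambda>y. \<phi> y powr r) x"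
    by (rule heat_jensen[OF t supported_below_powr]) (use r phi_nonneg fin in auto)
  then have "heat t \<phi> x powr r \<le> Q t x" using ennreal_Q[OF t, of x] by (metis Q_nonneg ennreal_le_iff)
  then have "heat t \<phi> x \<le> Q t x powr (1 / r)"
    using r phi_nonneg by (intro le_powr_inverse heat_nonneg) auto
  moreover have "(\<integral>y. \<bar>heat_kernel t (x - y) * v y\<bar> \<partial>lborel) \<le> heat t \<phi> x"
    unfolding heat_eq_lborel[OF phi_measurable] using i int v
    by (intro integral_mono integrable_abs) (auto simp: abs_mult intro!: mult_left_mono)
  ultimately show "(\<integral>y. \<bar>heat_kernel t (x - y) * v y\<bar> \<partial>lborel) \<le> Q t x powr (1 / r)" by simp
qed

lemma Q_semigroup:
  assumes "a > 0" "b > 0"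
  shows "(\<integral>\<^sup>+y. ennreal (heat_kernel a (x - y)) * ennreal (Q b y) \<partial>lborel) = ennreal (Q (a + b) x)"
  using assms by (simp add: ennreal_Q nn_heat_semigroup)

lemma Q_time_mono:
  assumes "0 < a" "a \<le> b"
  shows "Q a x \<le> (b / a) powr d * Q b x"
proof -
  have "ennreal (Q a x) \<le> ennreal ((b / a) powr d) * ennreal (Q b x)"
    using assms unfolding d_def by (simp add: ennreal_Q nn_heat_time_mono)
  then show ?thesis by (simp add: ennreal_mult[symmetric])
qed

end

section \<open>Norms in exponential Orlicz spaces\<close>

abbreviation exp_modular :: "real \<Rightarrow> (real^'n \<Rightarrow> real) \<Rightarrow> ennreal" where
  "exp_modular p w \<equiv> (\<integral>\<^sup>+x. ennreal (exp_young p (w x)) \<partial>lebesgue)"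

lemma nn_integral_lebesgue_eq: "(\<integral>\<^sup>+x. f x \<partial>lebesgue) = (\<integral>\<^sup>+x. f x \<partial>lborel)"
  by (rule nn_integral_completion)

lemma exp_young_convex:
  assumes "p \<ge> 1" "0 \<le> a" "0 \<le> b"
  shows "exp_young p ((a + b) / 2) \<le> (exp_young p a + exp_young p b) / 2"
proof -
  obtain k where "\<And>y. y \<ge> 0 \<Longrightarrow> exp_young p ((a + b) / 2) + k * (y - (a + b) / 2) \<le> exp_young p y"
    using supported_below_exp_young[OF assms(1)] assms unfolding supported_below_def
    by (metis add_nonneg_nonneg divide_nonneg_nonneg zero_le_numeral)
  from this[OF assms(2)] this[OF assms(3)] show ?thesis by (simp add: field_simps)
qed

text \<open>A convex function vanishing at 0 lies below its chord from the origin; the supporting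
  line at \<open>s / k\<close> is evaluated at 0 and at \<open>s\<close>.\<close>

lemma exp_young_le_scale:
  assumes "p \<ge> 1" "0 \<le> s" "k \<ge> 1"
  shows "exp_young p (s / k) \<le> exp_young p s / k"
proof -
  obtain c where c: "\<And>y. y \<ge> 0 \<Longrightarrow> exp_young p (s / k) + c * (y - s / k) \<le> exp_young p y"
    using supported_below_exp_young[OF assms(1)] assms unfolding supported_below_def
    by (metis divide_nonneg_nonneg order_trans zero_le_one)
  from c[of 0] c[of s] assms have 1: "exp_young p (s / k) \<le> c * (s / k)"
    and 2: "exp_young p (s / k) + c * (s - s / k) \<le> exp_young p s" by auto
  have "(k - 1) * exp_young p (s / k) \<le> (k - 1) * (c * (s / k))" using 1 assms by (intro mult_left_mono) auto
  also have "\<dots> = c * (s - s / k)" using assms by (simp add: field_simps)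
  finally have "k * exp_young p (s / k) \<le> exp_young p s" using 2 by (simp add: algebra_simps)
  then show ?thesis using assms by (simp add: field_simps)
qed

lemma luxemburg_norm_le:
  assumes "l > 0" "(\<integral>\<^sup>+x. ennreal (\<Phi> (\<bar>v x\<bar> / l)) \<partial>lebesgue) \<le> 1"
  shows "luxemburg_norm \<Phi> v \<le> l" "0 \<le> luxemburg_norm \<Phi> v"
  unfolding luxemburg_norm_def using assms
  by (auto intro!: cInf_lower cInf_greatest bdd_belowI[of _ 0])

lemma L1_loc_exp_young:
  fixes v :: "real^'n \<Rightarrow> real"
  assumes "p \<ge> 1" "l > 0" and [measurable]: "v \<in> borel_measurable lebesgue"
    and fin: "exp_modular p (\<lambda>x. \<bar>v x\<bar> / l) < \<infinity>"
  shows "v \<in> L1_loc"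
  unfolding L1_loc_def
proof (intro CollectI allI impI)
  fix K :: "(real^'n) set" assume K: "compact K"
  then have Ks: "K \<in> sets lebesgue" and Kf: "emeasure lebesgue K < \<infinity>"
    using emeasure_compact_finite[OF K] by (auto dest: borel_compact)
  have i: "integrable lebesgue (\<lambda>x. exp_young p (\<bar>v x\<bar> / l))"
    using fin by (intro integrableI_nonneg) (auto simp: exp_young_nonneg)
  have "integrable lebesgue (\<lambda>x. indicator K x * l + l * exp_young p (\<bar>v x\<bar> / l))"
    using Ks Kf by (intro Bochner_Integration.integrable_add integrable_mult_right i integrable_mult_left) auto
  then show "v absolutely_integrable_on K"
    unfolding set_integrable_def
  proof (rule Bochner_Integration.integrable_bound)
    \<comment> \<open>On a compact set \<open>v\<close> is thereby dominated by a constant plus the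
      integrable modular density.\<close>
    have "s \<le> 1 + exp_young p s" if "s \<ge> 0" for s
    proof (cases "s \<le> 1")
      case False
      then have "s powr 1 \<le> s powr p" using assms by (intro powr_mono) auto
      moreover have "s powr p + 1 \<le> exp (s powr p)" using exp_ge_add_one_self[of "s powr p"] by linarith
      ultimately show ?thesis using that by (simp add: exp_young_def)
    qed (simp add: exp_young_nonneg add_increasing2)
    then have "\<bar>v x\<bar> / l \<le> 1 + exp_young p (\<bar>v x\<bar> / l)" for x using assms by simp
    then have "\<bar>v x\<bar> \<le> l + l * exp_young p (\<bar>v x\<bar> / l)" for x using assms(2) by (simp add: field_simps)
    then show "AE x in lebesgue. norm (indicator K x *\<^sub>R v x) \<le> norm (indicator K x * l + l * exp_young p (\<bar>v x\<bar> / l))"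
      using assms(2) by (intro AE_I2) (auto simp: indicator_def exp_young_nonneg)
  qed (use Ks in measurable)
qed

lemma expL_norm_le:
  fixes v :: "real^'n \<Rightarrow> real"
  assumes "p \<ge> 1" "l > 0" "v \<in> borel_measurable lebesgue"
    and "exp_modular p (\<lambda>x. \<bar>v x\<bar> / l) \<le> 1"
  shows "v \<in> expL p" "expL_norm p v \<le> l" "0 \<le> expL_norm p v"
proof -
  have "exp_modular p (\<lambda>x. \<bar>v x\<bar> / l) < \<infinity>"
    using assms(4) by (rule order_le_less_trans) simp
  then show "v \<in> expL p" using assms L1_loc_exp_young[of p l v] by (auto simp: orlicz_space_def)
  show "expL_norm p v \<le> l" "0 \<le> expL_norm p v" using assms by (auto intro!: luxemburg_norm_le)
qed

text \<open>Local integrability gives measurability on balls only; \<open>v\<close> is the pointwise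
  limit of its restrictions to growing balls.\<close>

lemma L1_loc_measurable:
  fixes v :: "real^'n \<Rightarrow> real"
  assumes "v \<in> L1_loc"
  shows "v \<in> borel_measurable lebesgue"
proof (rule borel_measurable_LIMSEQ_real)
  fix k :: nat
  show "(\<lambda>x. indicator (cball 0 (real k)) x *\<^sub>R v x) \<in> borel_measurable lebesgue"
    using assms compact_cball[of "0::real^'n" "real k"] unfolding L1_loc_def set_integrable_def by blast
next
  fix x :: "real^'n"
  obtain k where k: "norm x \<le> real k" using real_arch_simple by blast
  show "(\<lambda>k. indicator (cball 0 (real k)) x *\<^sub>R v x) \<longlonglongrightarrow> v x"
    by (rule tendsto_eventually, rule eventually_sequentiallyI[of k]) (use k in \<open>auto simp: indicator_def\<close>)
qed

lemma expL_measurable: "v \<in> orlicz_space \<Phi> \<Longrightarrow> v \<in> borel_measurable lebesgue"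
  by (simp add: orlicz_space_def L1_loc_measurable)

text \<open>Midpoint convexity: \<open>v / (2 l)\<close> is dominated by the mean of
  \<open>w1 / l\<close> and \<open>w2 / l\<close>. At the level of modulars this replaces the
  triangle inequality of the norm.\<close>

lemma exp_young_modular_add:
  fixes v w1 w2 :: "real^'n \<Rightarrow> real"
  assumes p: "p \<ge> 1" and l: "l > 0" and meas [measurable]: "w1 \<in> borel_measurable lebesgue" "w2 \<in> borel_measurable lebesgue"
    and nonneg: "\<And>x. 0 \<le> w1 x" "\<And>x. 0 \<le> w2 x" and le: "AE x in lebesgue. \<bar>v x\<bar> \<le> w1 x + w2 x"
    and m: "exp_modular p (\<lambda>x. w1 x / l) \<le> 1" "exp_modular p (\<lambda>x. w2 x / l) \<le> 1"
  shows "exp_modular p (\<lambda>x. \<bar>v x\<bar> / (2 * l)) \<le> 1"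
proof -
  define h :: real where "h = 1 / 2"
  have h: "h \<ge> 0" "h + h = 1" by (simp_all add: h_def)
  have "exp_modular p (\<lambda>x. \<bar>v x\<bar> / (2 * l)) \<le>
      (\<integral>\<^sup>+x. ennreal h * ennreal (exp_young p (w1 x / l)) + ennreal h * ennreal (exp_young p (w2 x / l)) \<partial>lebesgue)"
    using le
  proof (intro nn_integral_mono_AE, eventually_elim)
    case (elim x)
    have "exp_young p (\<bar>v x\<bar> / (2 * l)) \<le> exp_young p ((w1 x / l + w2 x / l) / 2)"
      using elim l p by (intro exp_young_mono) (auto simp: field_simps)
    also have "\<dots> \<le> (exp_young p (w1 x / l) + exp_young p (w2 x / l)) / 2"
      using p l nonneg by (intro exp_young_convex) auto
    also have "\<dots> = h * exp_young p (w1 x / l) + h * exp_young p (w2 x / l)" by (simp add: h_def)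
    finally show ?case using h
      by (simp add: ennreal_mult[symmetric] ennreal_plus[symmetric] exp_young_nonneg ennreal_leI del: ennreal_plus)
  qed
  also have "\<dots> = ennreal h * exp_modular p (\<lambda>x. w1 x / l) + ennreal h * exp_modular p (\<lambda>x. w2 x / l)"
    by (subst nn_integral_add) (auto simp: nn_integral_cmult)
  also have "\<dots> \<le> ennreal h * 1 + ennreal h * 1" by (intro add_mono mult_left_mono m) auto
  also have "\<dots> = 1" using h by (simp add: ennreal_plus[symmetric] del: ennreal_plus)
  finally show ?thesis .
qed

text \<open>On [0,1] one has \<open>exp y - 1 \<le> y * exp 1\<close>, so for a function bounded by
  \<open>l\<close> the modular is controlled by the L^p integral. All smallness of the Duhamel term
  in exp L^p is obtained from L^\<infinity> and L^p bounds in this way.\<close>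

lemma exp_young_modular_bounded:
  fixes w :: "real^'n \<Rightarrow> real"
  assumes p: "p > 0" and l: "l > 0" and [measurable]: "w \<in> borel_measurable lebesgue"
    and w: "\<And>x. 0 \<le> w x" "\<And>x. w x \<le> l"
    and int: "(\<integral>\<^sup>+x. ennreal (w x powr p) \<partial>lebesgue) \<le> ennreal (l powr p / exp 1)"
  shows "exp_modular p (\<lambda>x. w x / l) \<le> 1"
proof -
  have "exp_modular p (\<lambda>x. w x / l) \<le> (\<integral>\<^sup>+x. ennreal (exp 1 / l powr p) * ennreal (w x powr p) \<partial>lebesgue)"
  proof (intro nn_integral_mono)
    fix x
    define y where "y = (w x / l) powr p"
    have y: "0 \<le> y" "y \<le> 1" using w[of x] p l by (auto simp: y_def intro!: powr_le1)
    have "1 - y \<le> exp (- y)" using exp_ge_add_one_self[of "-y"] by simp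
    then have "exp y * (1 - y) \<le> exp y * exp (- y)" by (intro mult_left_mono) auto
    then have "exp y - 1 \<le> y * exp y" by (simp add: exp_add[symmetric] algebra_simps)
    also have "\<dots> \<le> y * exp 1" using y by (intro mult_left_mono) auto
    also have "\<dots> = exp 1 / l powr p * w x powr p" using w l by (simp add: y_def powr_divide)
    finally show "ennreal (exp_young p (w x / l)) \<le> ennreal (exp 1 / l powr p) * ennreal (w x powr p)"
      by (simp add: exp_young_def y_def ennreal_mult[symmetric] ennreal_leI)
  qed
  also have "\<dots> = ennreal (exp 1 / l powr p) * (\<integral>\<^sup>+x. ennreal (w x powr p) \<partial>lebesgue)"
    by (rule nn_integral_cmult) simp
  also have "\<dots> \<le> ennreal (exp 1 / l powr p) * ennreal (l powr p / exp 1)"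
    by (intro mult_left_mono int) auto
  also have "\<dots> = 1" using l by (simp add: ennreal_mult[symmetric])
  finally show ?thesis .
qed

text \<open>A norm strictly below \<open>l\<close> yields an admissible level below
  \<open>l\<close>, once the set in the infimum is known to be nonempty. A member arises from a
  level of finite modular, multiplied by a bound \<open>c \<ge> 1\<close> of that modular.\<close>

lemma exp_young_modular_le_one:
  assumes p: "p \<ge> 1" and v: "v \<in> expL p" and norm: "expL_norm p v < l"
  shows "exp_modular p (\<lambda>x. \<bar>v x\<bar> / l) \<le> 1"
proof -
  let ?M = "\<lambda>l. \<integral>\<^sup>+x. ennreal (exp_young p (\<bar>v x\<bar> / l)) \<partial>lebesgue"
  obtain k where k: "k > 0" "?M k < \<infinity>" using v by (auto simp: orlicz_space_def)
  have meas: "(\<lambda>x. ennreal (exp_young p (\<bar>v x\<bar> / l))) \<in> borel_measurable lebesgue" for l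
    using expL_measurable[OF v] by measurable
  define c where "c = max 1 (enn2real (?M k))"
  have c: "c \<ge> 1" "?M k \<le> ennreal c"
    using k by (auto simp: c_def less_top ennreal_enn2real intro: order_trans[OF _ ennreal_leI[of "enn2real (?M k)"]])
  have "?M (c * k) \<le> (\<integral>\<^sup>+x. ennreal (1 / c) * ennreal (exp_young p (\<bar>v x\<bar> / k)) \<partial>lebesgue)"
  proof (intro nn_integral_mono)
    fix x
    have "exp_young p (\<bar>v x\<bar> / k / c) \<le> exp_young p (\<bar>v x\<bar> / k) / c"
      using p c k by (intro exp_young_le_scale) auto
    then show "ennreal (exp_young p (\<bar>v x\<bar> / (c * k))) \<le> ennreal (1 / c) * ennreal (exp_young p (\<bar>v x\<bar> / k))"
      using c by (simp add: ennreal_mult[symmetric] exp_young_nonneg ennreal_leI mult.commute)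
  qed
  also have "\<dots> = ennreal (1 / c) * ?M k" by (rule nn_integral_cmult) (rule meas)
  also have "\<dots> \<le> ennreal (1 / c) * ennreal c" by (intro mult_left_mono c) auto
  also have "\<dots> = 1" using c by (simp add: ennreal_mult[symmetric])
  finally have ne: "{l. l > 0 \<and> ?M l \<le> 1} \<noteq> {}"
    using c k by (intro ex_in_conv[THEN iffD1] exI[of _ "c * k"]) auto
  obtain j where j: "j > 0" "?M j \<le> 1" "j < l"
    using norm cInf_lessD[OF ne] unfolding luxemburg_norm_def by auto
  have "?M l \<le> ?M j"
    using j p by (intro nn_integral_mono ennreal_leI exp_young_mono divide_left_mono) auto
  with j show ?thesis by simp
qed

section \<open>Strong continuity of the heat semigroup\<close>

lemma heat_kernel_integrable:
  fixes h :: "real^'n \<Rightarrow> real"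
  assumes t: "t > 0" and h: "integrable lborel h"
  shows "integrable lborel (\<lambda>y. heat_kernel t (x - y) * h y)"
proof (rule Bochner_Integration.integrable_bound)
  show "integrable lborel (\<lambda>y. t powr (- (real CARD('n) / 2)) * h y)" using h by simp
  show "(\<lambda>y. heat_kernel t (x - y) * h y) \<in> borel_measurable lborel" using h by measurable
qed (auto simp: abs_mult intro!: mult_right_mono heat_kernel_le[OF t])

lemma ennreal_abs_heat_le:
  fixes v :: "real^'n \<Rightarrow> real"
  assumes [measurable]: "v \<in> borel_measurable borel"
    and "integrable lborel (\<lambda>y. heat_kernel t (x - y) * v y)"
  shows "ennreal \<bar>heat t v x\<bar> \<le> nn_heat t (\<lambda>y. \<bar>v y\<bar>) x"
  using integral_norm_bound_ennreal[OF assms(2)] unfolding heat_eq_lborel[OF assms(1)] nn_heat_def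
  by (simp add: abs_mult ennreal_mult)

lemma nn_integral_abs_heat_le:
  fixes h :: "real^'n \<Rightarrow> real"
  assumes t: "t > 0" and h: "integrable lborel h"
  shows "(\<integral>\<^sup>+x. ennreal \<bar>heat t h x\<bar> \<partial>lborel) \<le> (\<integral>\<^sup>+x. ennreal \<bar>h x\<bar> \<partial>lborel)"
proof -
  have [measurable]: "h \<in> borel_measurable borel" using h by simp
  have "(\<integral>\<^sup>+x. ennreal \<bar>heat t h x\<bar> \<partial>lborel) \<le> (\<integral>\<^sup>+x. nn_heat t (\<lambda>y. \<bar>h y\<bar>) x \<partial>lborel)"
    by (intro nn_integral_mono ennreal_abs_heat_le heat_kernel_integrable t h) simp
  also have "\<dots> = (\<integral>\<^sup>+x. ennreal \<bar>h x\<bar> \<partial>lborel)"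
    by (rule nn_integral_nn_heat) (use t in auto)
  finally show ?thesis .
qed

lemma integrable_heat:
  fixes h :: "real^'n \<Rightarrow> real"
  assumes t: "t > 0" and h: "integrable lborel h"
  shows "integrable lborel (heat t h)" "(\<integral>x. \<bar>heat t h x\<bar> \<partial>lborel) \<le> (\<integral>x. \<bar>h x\<bar> \<partial>lborel)"
proof -
  have [measurable]: "h \<in> borel_measurable borel" using h by simp
  have "(\<integral>\<^sup>+x. ennreal \<bar>h x\<bar> \<partial>lborel) < \<infinity>" using h unfolding integrable_iff_bounded by simp
  then show i: "integrable lborel (heat t h)"
    using order_le_less_trans[OF nn_integral_abs_heat_le[OF t h]] by (intro integrableI_bounded) auto
  have "ennreal (\<integral>x. \<bar>heat t h x\<bar> \<partial>lborel) \<le> ennreal (\<integral>x. \<bar>h x\<bar> \<partial>lborel)"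
    using nn_integral_abs_heat_le[OF t h] i h by (simp add: nn_integral_eq_integral)
  then show "(\<integral>x. \<bar>heat t h x\<bar> \<partial>lborel) \<le> (\<integral>x. \<bar>h x\<bar> \<partial>lborel)"
    by (simp add: integral_nonneg_AE)
qed

lemma integral_heat_nonneg:
  fixes h :: "real^'n \<Rightarrow> real"
  assumes t: "t > 0" and h: "integrable lborel h" and nonneg: "\<And>x. 0 \<le> h x"
  shows "(\<integral>x. heat t h x \<partial>lborel) = (\<integral>x. h x \<partial>lborel)"
proof -
  have [measurable]: "h \<in> borel_measurable borel" using h by simp
  have e: "ennreal (heat t h x) = nn_heat t h x" for x
  proof (rule ennreal_heat)
    have "nn_heat t h x \<le> ennreal (t powr (- (real CARD('n) / 2))) * (\<integral>\<^sup>+y. ennreal (h y) \<partial>lborel)"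
      by (rule nn_heat_le_mass) (use nonneg t in auto)
    also have "\<dots> < \<infinity>" using h nonneg by (simp add: nn_integral_eq_integral ennreal_mult_less_top)
    finally show "nn_heat t h x < \<infinity>" .
  qed (use nonneg in auto)
  have hn: "heat t h x \<ge> 0" for x by (rule heat_nonneg) (use nonneg in auto)
  have "ennreal (\<integral>x. heat t h x \<partial>lborel) = ennreal (\<integral>x. h x \<partial>lborel)"
    using nn_integral_nn_heat[of h t] nonneg t h hn integrable_heat[OF t h]
    by (simp add: nn_integral_eq_integral[symmetric] e)
  then show ?thesis using nonneg hn by (simp add: integral_nonneg_AE)
qed

lemma heat_add:
  assumes "t > 0" "integrable lborel f" "integrable lborel g"
  shows "heat t (\<lambda>x. f x + g x) x = heat t f x + heat t g x"
  using assms heat_kernel_integrable[OF assms(1,2), of x] heat_kernel_integrable[OF assms(1,3), of x]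
  by (subst (1 2 3) heat_eq_lborel) (simp_all add: distrib_left)

text \<open>A ball around \<open>x\<close> lies in \<open>U\<close>, and by
  \<open>heat_kernel_tail\<close> the kernel mass outside that ball is at most \<open>c t\<close>,
  which vanishes with \<open>t\<close>.\<close>

lemma heat_indicator_tendsto_one:
  fixes U :: "(real^'n) set"
  assumes U: "open U" "x \<in> U" "emeasure lborel U < \<infinity>"
  shows "((\<lambda>t. heat t (indicator U) x) \<longlongrightarrow> 1) (at_right 0)"
proof -
  obtain \<delta> where \<delta>: "\<delta> > 0" "ball x \<delta> \<subseteq> U" using U by (auto simp: open_contains_ball)
  define c where "c t = 2 powr (real CARD('n) / 2) * exp (- \<delta>\<^sup>2 / (8 * t))" for t :: real
  have Um [measurable]: "U \<in> sets borel" using U by simp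
  have bounds: "1 - c t \<le> heat t (indicator U) x" "heat t (indicator U) x \<le> 1" if t: "t > 0" for t
  proof -
    have i: "integrable lborel (\<lambda>y. heat_kernel s (x - y))" if "s > 0" for s
      using nn_integral_heat_kernel_diff(1)[OF that, of x] by (intro integrableI_nonneg) auto
    have i1: "(\<integral>y. heat_kernel s (x - y) \<partial>lborel) = 1" if "s > 0" for s
      using nn_integral_heat_kernel_diff(1)[OF that, of x] i[OF that]
      by (simp add: nn_integral_eq_integral integral_nonneg_AE)
    have iU: "integrable lborel (\<lambda>y. heat_kernel t (x - y) * indicator U y)"
      using U t by (intro heat_kernel_integrable) auto
    have he: "heat t (indicator U) x = (\<integral>y. heat_kernel t (x - y) * indicator U y \<partial>lborel)"
      by (rule heat_eq_lborel) simp
    show "heat t (indicator U) x \<le> 1" unfolding he i1[OF t, symmetric]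
      by (intro integral_mono iU i t) (auto simp: indicator_def)
    have "(\<integral>y. heat_kernel t (x - y) \<partial>lborel) \<le>
        (\<integral>y. heat_kernel t (x - y) * indicator U y + c t * heat_kernel (2 * t) (x - y) \<partial>lborel)"
    proof (intro integral_mono)
      fix y
      show "heat_kernel t (x - y) \<le> heat_kernel t (x - y) * indicator U y + c t * heat_kernel (2 * t) (x - y)"
      proof (cases "y \<in> U")
        case False
        then have "\<delta> \<le> norm (x - y)" using \<delta> by (force simp: dist_norm)
        then show ?thesis using heat_kernel_tail[OF t, of \<delta> "x - y"] \<delta> False by (simp add: c_def)
      qed (simp add: c_def)
    qed (use i iU t in auto)
    also have "\<dots> = heat t (indicator U) x + c t"
      using i iU t i1[of "2 * t"] by (simp add: he)
    finally show "1 - c t \<le> heat t (indicator U) x" using i1[OF t] by simp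
  qed
  have "((\<lambda>t. exp (- \<delta>\<^sup>2 / (8 * t))) \<longlongrightarrow> 0) (at_right 0)"
    using \<delta> by real_asymp
  then have "(c \<longlongrightarrow> 0) (at_right 0)"
    unfolding c_def by (rule tendsto_mult_right_zero)
  then have c0: "((\<lambda>t. 1 - c t) \<longlongrightarrow> 1) (at_right 0)"
    using tendsto_diff[OF tendsto_const[of 1]] by fastforce
  have ev: "eventually (\<lambda>t::real. t > 0) (at_right 0)" by (simp add: eventually_at_right_less)
  show ?thesis
    by (rule tendsto_sandwich[OF _ _ c0 tendsto_const]) (use ev bounds in \<open>auto elim: eventually_mono\<close>)
qed

text \<open>The evolution of an indicator stays between 0 and 1 and keeps its mass, so the loss
  inside \<open>U\<close> equals the gain outside and the L^1 distance is twice the loss inside. The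
  indicator of \<open>U\<close> dominates that loss, and pointwise convergence on \<open>U\<close>
  finishes the argument.\<close>

lemma heat_indicator_L1:
  fixes U :: "(real^'n) set"
  assumes U: "open U" "emeasure lborel U < \<infinity>"
  shows "((\<lambda>t. \<integral>x. \<bar>heat t (indicator U) x - indicator U x\<bar> \<partial>lborel) \<longlongrightarrow> 0) (at_right 0)"
proof -
  have [measurable]: "U \<in> sets borel" using U by simp
  have iU: "integrable lborel (indicator U :: _ \<Rightarrow> real)" using U by simp
  have le1: "heat t (indicator U) x \<le> 1" and ge0: "0 \<le> heat t (indicator U) x" if t: "t > 0" for t x
  proof -
    have "ennreal \<bar>heat t (indicator U) x\<bar> \<le> nn_heat t (\<lambda>y. \<bar>indicator U y\<bar>) x"
      by (intro ennreal_abs_heat_le heat_kernel_integrable t iU) simp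
    also have "\<dots> \<le> (\<integral>\<^sup>+y. ennreal (heat_kernel t (x - y)) \<partial>lborel)"
      unfolding nn_heat_def by (intro nn_integral_mono) (auto simp: indicator_def)
    finally show "heat t (indicator U) x \<le> 1" using nn_integral_heat_kernel_diff(1)[OF t, of x] by simp
    show "0 \<le> heat t (indicator U) x" by (rule heat_nonneg) auto
  qed
  have eq: "(\<integral>x. \<bar>heat t (indicator U) x - indicator U x\<bar> \<partial>lborel) =
      2 * (\<integral>x. indicator U x * (1 - heat t (indicator U) x) \<partial>lborel)" if t: "t > 0" for t
  proof -
    have ih: "integrable lborel (heat t (indicator U))" using integrable_heat[OF t iU] by simp
    have ip: "integrable lborel (\<lambda>x. indicator U x * (1 - heat t (indicator U) x))"
      by (rule Bochner_Integration.integrable_bound[OF iU])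
         (use le1[OF t] ge0[OF t] in \<open>auto simp: indicator_def\<close>)
    have "(\<integral>x. \<bar>heat t (indicator U) x - indicator U x\<bar> \<partial>lborel) =
       (\<integral>x. (heat t (indicator U) x - indicator U x) + 2 * (indicator U x * (1 - heat t (indicator U) x)) \<partial>lborel)"
    proof (intro Bochner_Integration.integral_cong refl)
      fix x :: "real^'n"
      show "\<bar>heat t (indicator U) x - indicator U x\<bar> =
          (heat t (indicator U) x - indicator U x) + 2 * (indicator U x * (1 - heat t (indicator U) x))"
        using le1[OF t, of x] ge0[OF t, of x] by (cases "x \<in> U") auto
    qed
    also have "\<dots> = (\<integral>x. heat t (indicator U) x \<partial>lborel) - (\<integral>x. indicator U x \<partial>lborel) +
       2 * (\<integral>x. indicator U x * (1 - heat t (indicator U) x) \<partial>lborel)"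
      using ih iU ip by (subst Bochner_Integration.integral_add) (auto simp del: integral_indicator)
    also have "(\<integral>x. heat t (indicator U) x \<partial>lborel) = (\<integral>x. indicator U x \<partial>lborel)"
      by (rule integral_heat_nonneg[OF t iU]) simp
    finally show ?thesis by simp
  qed
  show ?thesis
  proof (rule tendsto_at_right_sequentially[of 0 1])
    fix S :: "nat \<Rightarrow> real" assume S: "\<And>n. 0 < S n" "S \<longlonglongrightarrow> 0"
    then have SR: "filterlim S (at_right 0) sequentially"
      by (simp add: filterlim_at less_imp_neq[OF S(1), symmetric])
    have "(\<lambda>n. \<integral>x. indicator U x * (1 - heat (S n) (indicator U) x) \<partial>lborel) \<longlonglongrightarrow> (\<integral>x. 0 \<partial>(lborel :: (real^'n) measure))"
    proof (rule integral_dominated_convergence[where w = "indicator U"])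
      show "AE x in lborel. (\<lambda>n. indicator U x * (1 - heat (S n) (indicator U) x)) \<longlonglongrightarrow> 0"
      proof (rule AE_I2)
        fix x :: "real^'n"
        show "(\<lambda>n. indicator U x * (1 - heat (S n) (indicator U) x)) \<longlonglongrightarrow> 0"
        proof (cases "x \<in> U")
          case True
          then have "(\<lambda>n. heat (S n) (indicator U) x) \<longlonglongrightarrow> 1"
            using filterlim_compose[OF heat_indicator_tendsto_one[OF U(1) True U(2)] SR] by simp
          then show ?thesis using True by (auto intro!: tendsto_eq_intros)
        qed simp
      qed
      show "AE x in lborel. norm (indicator U x * (1 - heat (S n) (indicator U) x)) \<le> indicator U x" for n
        using le1[OF S(1)] ge0[OF S(1)] by (auto simp: indicator_def)
    qed (use iU in auto)
    then show "(\<lambda>n. \<integral>x. \<bar>heat (S n) (indicator U) x - indicator U x\<bar> \<partial>lborel) \<longlonglongrightarrow> 0"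
      unfolding eq[OF S(1)] by (auto intro: tendsto_mult_right_zero)
  qed simp
qed

text \<open>The semigroup contracts L^1, so replacing \<open>f\<close> by \<open>g\<close> costs the
  distance of the two functions once under the semigroup and once without it.\<close>

lemma heat_L1_perturb:
  fixes f g :: "real^'n \<Rightarrow> real"
  assumes t: "t > 0" and f: "integrable lborel f" and g: "integrable lborel g"
  shows "(\<integral>x. \<bar>heat t f x - f x\<bar> \<partial>lborel) \<le> (\<integral>x. \<bar>heat t g x - g x\<bar> \<partial>lborel) + 2 * (\<integral>x. \<bar>f x - g x\<bar> \<partial>lborel)"
proof -
  have fg: "integrable lborel (\<lambda>x. f x - g x)" using f g by simp
  note ih = integrable_heat(1)[OF t f] integrable_heat(1)[OF t g] integrable_heat(1)[OF t fg]
  have e: "heat t f x = heat t g x + heat t (\<lambda>x. f x - g x) x" for x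
    using heat_add[OF t g fg, of x] by simp
  have "(\<integral>x. \<bar>heat t f x - f x\<bar> \<partial>lborel) \<le>
      (\<integral>x. \<bar>heat t g x - g x\<bar> + (\<bar>heat t (\<lambda>x. f x - g x) x\<bar> + \<bar>f x - g x\<bar>) \<partial>lborel)"
    using ih f g fg by (intro integral_mono) (auto simp: e)
  also have "\<dots> = (\<integral>x. \<bar>heat t g x - g x\<bar> \<partial>lborel) + ((\<integral>x. \<bar>heat t (\<lambda>x. f x - g x) x\<bar> \<partial>lborel) + (\<integral>x. \<bar>f x - g x\<bar> \<partial>lborel))"
    using ih g fg f by (subst Bochner_Integration.integral_add, simp, simp, subst Bochner_Integration.integral_add) auto
  finally show ?thesis using integrable_heat(2)[OF t fg] by simp
qed

lemma heat_L1_closed: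
  fixes f :: "real^'n \<Rightarrow> real"
  assumes f: "integrable lborel f"
    and approx: "\<And>\<epsilon>. \<epsilon> > 0 \<Longrightarrow> \<exists>g. integrable lborel g \<and> (\<integral>x. \<bar>f x - g x\<bar> \<partial>lborel) < \<epsilon> \<and>
      ((\<lambda>t. \<integral>x. \<bar>heat t g x - g x\<bar> \<partial>lborel) \<longlongrightarrow> 0) (at_right 0)"
  shows "((\<lambda>t. \<integral>x. \<bar>heat t f x - f x\<bar> \<partial>lborel) \<longlongrightarrow> 0) (at_right 0)"
proof (rule tendstoI)
  fix \<epsilon> :: real assume "\<epsilon> > 0"
  then obtain g where g: "integrable lborel g" "(\<integral>x. \<bar>f x - g x\<bar> \<partial>lborel) < \<epsilon> / 4"
    "((\<lambda>t. \<integral>x. \<bar>heat t g x - g x\<bar> \<partial>lborel) \<longlongrightarrow> 0) (at_right 0)" using approx[of "\<epsilon> / 4"] by auto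
  have "eventually (\<lambda>t. (\<integral>x. \<bar>heat t g x - g x\<bar> \<partial>lborel) < \<epsilon> / 2) (at_right 0)"
    using order_tendstoD(2)[OF g(3), of "\<epsilon> / 2"] \<open>\<epsilon> > 0\<close> by simp
  moreover have "eventually (\<lambda>t::real. t > 0) (at_right 0)" by (simp add: eventually_at_right_less)
  ultimately show "eventually (\<lambda>t. dist (\<integral>x. \<bar>heat t f x - f x\<bar> \<partial>lborel) 0 < \<epsilon>) (at_right 0)"
  proof eventually_elim
    case (elim t)
    then show ?case using heat_L1_perturb[OF elim(2) f g(1)] g(2) by (simp add: integral_nonneg_AE)
  qed
qed

text \<open>Outer regularity reduces indicators of arbitrary Borel sets to those of open sets.\<close>

lemma heat_tendsto_L1:
  fixes f :: "real^'n \<Rightarrow> real"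
  assumes "integrable lborel f"
  shows "((\<lambda>t. \<integral>x. \<bar>heat t f x - f x\<bar> \<partial>lborel) \<longlongrightarrow> 0) (at_right 0)"
  using assms
proof (induction f rule: integrable_induct)
  case (base A c)
  have A [measurable]: "A \<in> sets borel" using base by simp
  have cf: "heat t (\<lambda>x. indicator U x *\<^sub>R c) x = heat t (indicator U) x * c" if "U \<in> sets borel" for U :: "(real^'n) set" and t x
    using that by (subst (1 2) heat_eq_lborel) (auto simp flip: mult.assoc)
  have open_c: "((\<lambda>t. \<integral>x. \<bar>heat t (\<lambda>x. indicator U x *\<^sub>R c) x - indicator U x *\<^sub>R c\<bar> \<partial>lborel) \<longlongrightarrow> 0) (at_right 0)"
    if U: "open U" "emeasure lborel U < \<infinity>" for U :: "(real^'n) set"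
  proof -
    have "(\<lambda>t. \<integral>x. \<bar>heat t (\<lambda>x. indicator U x *\<^sub>R c) x - indicator U x *\<^sub>R c\<bar> \<partial>lborel) =
       (\<lambda>t. (\<integral>x. \<bar>heat t (indicator U) x - indicator U x\<bar> \<partial>lborel) * \<bar>c\<bar>)"
      using U by (simp add: cf[simplified] left_diff_distrib[symmetric] abs_mult)
    then show ?thesis using heat_indicator_L1[OF U] by (simp add: tendsto_mult_left_zero)
  qed
  show ?case
  proof (rule heat_L1_closed)
    fix \<epsilon> :: real assume \<epsilon>: "\<epsilon> > 0"
    \<comment> \<open>The added 1 covers \<open>c = 0\<close> and makes the later estimate
      strict.\<close>
    define \<eta> where "\<eta> = \<epsilon> / (\<bar>c\<bar> + 1)"
    have \<eta>: "\<eta> > 0" "\<eta> * \<bar>c\<bar> < \<epsilon>" using \<epsilon> by (auto simp: \<eta>_def field_simps)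
    obtain U where U: "open U" "A \<subseteq> U" "emeasure lborel (U - A) < ennreal \<eta>"
      using outer_regular_lborel[OF A \<eta>(1)] by blast
    have Um [measurable]: "U \<in> sets borel" using U by simp
    have "emeasure lborel U \<le> emeasure lborel A + emeasure lborel (U - A)"
      using emeasure_subadditive[of A lborel "U - A"] U(2) by (simp add: Un_absorb1)
    also have "\<dots> < \<infinity>" using base U(3) by (auto simp: less_top[symmetric])
    finally have Uf: "emeasure lborel U < \<infinity>" .
    have "(\<integral>x. \<bar>indicator A x *\<^sub>R c - indicator U x *\<^sub>R c\<bar> \<partial>lborel) = (\<integral>x. indicator (U - A) x * \<bar>c\<bar> \<partial>lborel)"
      using U(2) by (intro Bochner_Integration.integral_cong) (auto simp: indicator_def)
    also have "\<dots> = measure lborel (U - A) * \<bar>c\<bar>" by simp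
    also have "\<dots> \<le> \<eta> * \<bar>c\<bar>"
      using U(3) \<eta> by (intro mult_right_mono) (auto simp: measure_def intro: enn2real_leI)
    also have "\<dots> < \<epsilon>" by (rule \<eta>)
    finally show "\<exists>g. integrable lborel g \<and> (\<integral>x. \<bar>indicator A x *\<^sub>R c - g x\<bar> \<partial>lborel) < \<epsilon> \<and>
      ((\<lambda>t. \<integral>x. \<bar>heat t g x - g x\<bar> \<partial>lborel) \<longlongrightarrow> 0) (at_right 0)"
      using open_c[OF U(1) Uf] Uf by (intro exI[of _ "\<lambda>x. indicator U x *\<^sub>R c"]) auto
  qed (use base in auto)
next
  case (add f g)
  have ev: "eventually (\<lambda>t::real. t > 0) (at_right 0)" by (simp add: eventually_at_right_less)
  show ?case
  proof (rule tendsto_sandwich[OF _ _ tendsto_const tendsto_add_zero[OF add(3) add(4)]])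
    show "eventually (\<lambda>t. (\<integral>x. \<bar>heat t (\<lambda>x. f x + g x) x - (f x + g x)\<bar> \<partial>lborel) \<le>
        (\<integral>x. \<bar>heat t f x - f x\<bar> \<partial>lborel) + (\<integral>x. \<bar>heat t g x - g x\<bar> \<partial>lborel)) (at_right 0)"
      using ev
    proof eventually_elim
      case (elim t)
      note int = add(1,2) integrable_heat(1)[OF elim add(1)] integrable_heat(1)[OF elim add(2)]
      have e: "heat t (\<lambda>x. f x + g x) = (\<lambda>x. heat t f x + heat t g x)"
        using heat_add[OF elim add(1,2)] by (rule ext)
      have "(\<integral>x. \<bar>heat t (\<lambda>x. f x + g x) x - (f x + g x)\<bar> \<partial>lborel) \<le>
         (\<integral>x. \<bar>heat t f x - f x\<bar> + \<bar>heat t g x - g x\<bar> \<partial>lborel)"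
        unfolding e using int by (intro integral_mono) auto
      also have "\<dots> = (\<integral>x. \<bar>heat t f x - f x\<bar> \<partial>lborel) + (\<integral>x. \<bar>heat t g x - g x\<bar> \<partial>lborel)"
        using int by (intro Bochner_Integration.integral_add) auto
      finally show ?case .
    qed
  qed (simp add: integral_nonneg_AE)
next
  case (lim f s)
  show ?case
  proof (rule heat_L1_closed[OF lim(4)])
    fix \<epsilon> :: real assume \<epsilon>: "\<epsilon> > 0"
    have "(\<lambda>i. \<integral>x. \<bar>f x - s i x\<bar> \<partial>lborel) \<longlonglongrightarrow> (\<integral>x. 0 \<partial>(lborel :: (real^'n) measure))"
    \<comment> \<open>The approximants provided by the induction satisfy
      \<open>\<bar>s i x\<bar> \<le> 2 * \<bar>f x\<bar>\<close>.\<close>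
    proof (rule integral_dominated_convergence[where w = "\<lambda>x. 3 * \<bar>f x\<bar>"])
      show "AE x in lborel. (\<lambda>i. \<bar>f x - s i x\<bar>) \<longlonglongrightarrow> 0"
      proof (rule AE_I2)
        fix x :: "real^'n"
        show "(\<lambda>i. \<bar>f x - s i x\<bar>) \<longlonglongrightarrow> 0"
          using tendsto_rabs[OF tendsto_diff[OF tendsto_const[of "f x"] lim(2)[of x]]] by simp
      qed
      show "AE x in lborel. norm \<bar>f x - s i x\<bar> \<le> 3 * \<bar>f x\<bar>" for i
      proof (rule AE_I2)
        fix x :: "real^'n"
        have "\<bar>s i x\<bar> \<le> 2 * \<bar>f x\<bar>" using lim(3)[of x i] by simp
        then show "norm \<bar>f x - s i x\<bar> \<le> 3 * \<bar>f x\<bar>" by simp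
      qed
    qed (use lim in auto)
    then have "eventually (\<lambda>i. (\<integral>x. \<bar>f x - s i x\<bar> \<partial>lborel) < \<epsilon>) sequentially"
      using \<epsilon> by (intro order_tendstoD(2)[where a = \<epsilon>]) auto
    then obtain i where "(\<integral>x. \<bar>f x - s i x\<bar> \<partial>lborel) < \<epsilon>" by (auto simp: eventually_sequentially)
    then show "\<exists>g. integrable lborel g \<and> (\<integral>x. \<bar>f x - g x\<bar> \<partial>lborel) < \<epsilon> \<and>
      ((\<lambda>t. \<integral>x. \<bar>heat t g x - g x\<bar> \<partial>lborel) \<longlongrightarrow> 0) (at_right 0)"
      using lim(1,5) by blast
  qed
qed

section \<open>Weak* convergence\<close>

text \<open>Beyond \<open>\<eta>\<close> the ratio \<open>(y / \<eta>) powr (p - 1)\<close> is at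
  least 1. This trades a constant, harmless on a ball, for an L^p integral that can be made
  small.\<close>

lemma le_const_add_powr:
  fixes y \<eta> p :: real
  assumes "p \<ge> 1" "\<eta> > 0" "y \<ge> 0"
  shows "y \<le> \<eta> + \<eta> powr (1 - p) * y powr p"
proof (cases "y \<le> \<eta>")
  case False
  then have y: "y > 0" using assms by simp
  have "1 = \<eta> powr (1 - p) * \<eta> powr (p - 1)" using assms by (simp add: powr_add[symmetric])
  also have "\<dots> \<le> \<eta> powr (1 - p) * y powr (p - 1)"
    using False assms by (intro mult_left_mono powr_mono2) auto
  finally have "y * 1 \<le> y * (\<eta> powr (1 - p) * y powr (p - 1))" using y by (intro mult_left_mono) auto
  also have "\<dots> = \<eta> powr (1 - p) * y powr p" using y by (simp add: powr_diff)
  finally show ?thesis using assms by simp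
qed (use assms in \<open>simp add: add_increasing2\<close>)

text \<open>The datum lies in L^p but in general not in L^1. L^1 convergence is applied to a bounded
  truncation \<open>h\<close> of bounded support; the remainder \<open>w\<close> is small in L^p,
  and \<open>le_const_add_powr\<close> controls both \<open>w\<close> and its evolution on a
  ball.\<close>

lemma heat_tendsto_local_L1:
  fixes v :: "real^'n \<Rightarrow> real"
  assumes p: "p \<ge> 1" and [measurable]: "v \<in> borel_measurable borel"
    and vp: "(\<integral>\<^sup>+x. ennreal (\<bar>v x\<bar> powr p) \<partial>lborel) < \<infinity>" and \<epsilon>: "\<epsilon> > 0"
  shows "eventually (\<lambda>t. (\<integral>\<^sup>+x. indicator (cball 0 R) x * ennreal \<bar>heat t v x - v x\<bar> \<partial>lborel) \<le> ennreal \<epsilon>) (at_right 0)"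
proof -
  let ?B = "cball 0 R :: (real^'n) set"
  define b where "b = measure lborel ?B"
  have b: "b \<ge> 0" "emeasure lborel ?B = ennreal b"
    using emeasure_bounded_finite[of ?B] by (auto simp: b_def emeasure_eq_ennreal_measure less_top[symmetric])
  \<comment> \<open>The final error is \<open>\<epsilon> / 2\<close> from the truncation,
    \<open>2 * \<eta> * b\<close> from the constants on the ball and
    \<open>2 * \<eta> powr (1 - p) * \<gamma>\<close> from the remainder, the last two being at most
    \<open>\<epsilon> / 4\<close> each.\<close>
  define \<eta> where "\<eta> = \<epsilon> / (8 * (b + 1))"
  have \<eta>: "\<eta> > 0" "\<eta> * b \<le> \<epsilon> / 8" using \<epsilon> b by (auto simp: \<eta>_def field_simps)
  define \<gamma> where "\<gamma> = \<epsilon> / 8 / \<eta> powr (1 - p)"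
  have \<gamma>: "\<gamma> > 0" "\<eta> powr (1 - p) * \<gamma> = \<epsilon> / 8" using \<epsilon> \<eta> by (auto simp: \<gamma>_def)
  define S where "S k = {x :: real^'n. norm x \<le> real k \<and> \<bar>v x\<bar> \<le> real k}" for k
  have S [measurable]: "S k \<in> sets borel" for k unfolding S_def by measurable
  have "(\<lambda>k. \<integral>\<^sup>+x. ennreal (\<bar>v x - indicator (S k) x * v x\<bar> powr p) \<partial>lborel) \<longlonglongrightarrow> (\<integral>\<^sup>+x. 0 \<partial>(lborel :: (real^'n) measure))"
  proof (rule nn_integral_dominated_convergence[where w = "\<lambda>x. ennreal (\<bar>v x\<bar> powr p)"])
    show "AE x in lborel. (\<lambda>k. ennreal (\<bar>v x - indicator (S k) x * v x\<bar> powr p)) \<longlonglongrightarrow> 0"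
    proof (rule AE_I2)
      fix x :: "real^'n"
      obtain k where k: "max (norm x) \<bar>v x\<bar> \<le> real k" using real_arch_simple by blast
      show "(\<lambda>k. ennreal (\<bar>v x - indicator (S k) x * v x\<bar> powr p)) \<longlonglongrightarrow> 0"
        by (rule tendsto_eventually, rule eventually_sequentiallyI[of k])
           (use k p in \<open>auto simp: S_def indicator_def\<close>)
    qed
    show "AE x in lborel. ennreal (\<bar>v x - indicator (S k) x * v x\<bar> powr p) \<le> ennreal (\<bar>v x\<bar> powr p)" for k
      using p by (intro AE_I2 ennreal_leI powr_mono2) (auto simp: indicator_def)
  qed (use vp in auto)
  then have "eventually (\<lambda>k. (\<integral>\<^sup>+x. ennreal (\<bar>v x - indicator (S k) x * v x\<bar> powr p) \<partial>lborel) < ennreal \<gamma>) sequentially"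
    using \<gamma> by (intro order_tendstoD(2)) auto
  then obtain k where k: "(\<integral>\<^sup>+x. ennreal (\<bar>v x - indicator (S k) x * v x\<bar> powr p) \<partial>lborel) < ennreal \<gamma>"
    by (auto simp: eventually_sequentially)
  define h where "h x = indicator (S k) x * v x" for x
  define w where "w x = v x - h x" for x
  have [measurable]: "h \<in> borel_measurable borel" "w \<in> borel_measurable borel" unfolding h_def w_def by measurable
  have wle: "\<bar>w x\<bar> \<le> \<bar>v x\<bar>" for x by (auto simp: w_def h_def indicator_def)
  have wk: "(\<integral>\<^sup>+x. ennreal (\<bar>w x\<bar> powr p) \<partial>lborel) \<le> ennreal \<gamma>" using k unfolding w_def h_def by simp
  have ih: "integrable lborel h"
  proof (rule Bochner_Integration.integrable_bound)
    show "integrable lborel (\<lambda>x. real k * indicator (cball 0 (real k) :: (real^'n) set) x)"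
      using emeasure_bounded_finite[of "cball 0 (real k) :: (real^'n) set"] by simp
  qed (auto simp: h_def S_def indicator_def)
  have "eventually (\<lambda>t. (\<integral>x. \<bar>heat t h x - h x\<bar> \<partial>lborel) < \<epsilon> / 2) (at_right 0)"
    using heat_tendsto_L1[OF ih] \<epsilon> by (intro order_tendstoD(2)[of _ 0]) auto
  moreover have "eventually (\<lambda>t::real. t > 0) (at_right 0)" by (simp add: eventually_at_right_less)
  ultimately show ?thesis
  proof eventually_elim
    case (elim t)
    note t = \<open>t > 0\<close>
    have iv: "integrable lborel (\<lambda>y. heat_kernel t (x - y) * u y)"
      if [measurable]: "u \<in> borel_measurable borel" and u: "\<And>y. \<bar>u y\<bar> \<le> \<bar>v y\<bar>" for u x
    proof (rule Bochner_Integration.integrable_bound)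
      have "nn_heat t (\<lambda>y. \<bar>v y\<bar>) x < \<infinity>" by (rule nn_heat_finite[OF t _ _ p]) (use vp in auto)
      then show "integrable lborel (\<lambda>y. heat_kernel t (x - y) * \<bar>v y\<bar>)"
        by (intro nn_heat_finite_integrable) auto
    qed (use u in \<open>auto simp: abs_mult intro!: mult_left_mono\<close>)
    have hv: "heat t v x = heat t h x + heat t w x" for x
    proof -
      have "heat t v x = (\<integral>y. heat_kernel t (x - y) * h y + heat_kernel t (x - y) * w y \<partial>lborel)"
        by (subst heat_eq_lborel) (auto simp: w_def algebra_simps)
      also have "\<dots> = heat t h x + heat t w x"
        using iv[of w] wle heat_kernel_integrable[OF t ih]
        by (simp add: heat_eq_lborel)
      finally show ?thesis .
    qed
    have e2: "ennreal (2 * \<eta>) = ennreal \<eta> + ennreal \<eta>"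
      using \<eta> ennreal_plus[of \<eta> \<eta>] unfolding mult_2 by simp
    have wb: "ennreal \<bar>w x\<bar> \<le> ennreal \<eta> + ennreal (\<eta> powr (1 - p)) * ennreal (\<bar>w x\<bar> powr p)" for x
      using le_const_add_powr[OF p \<eta>(1), of "\<bar>w x\<bar>"] \<eta>
      by (simp add: ennreal_mult[symmetric] ennreal_plus[symmetric] ennreal_leI del: ennreal_plus)
    have hb: "ennreal \<bar>heat t w x\<bar> \<le> ennreal \<eta> + ennreal (\<eta> powr (1 - p)) * nn_heat t (\<lambda>y. \<bar>w y\<bar> powr p) x" for x
    proof -
      have "ennreal \<bar>heat t w x\<bar> \<le> nn_heat t (\<lambda>y. \<bar>w y\<bar>) x" by (intro ennreal_abs_heat_le iv wle) auto
      also have "\<dots> \<le> (\<integral>\<^sup>+y. ennreal (heat_kernel t (x - y)) * ennreal \<eta> +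
          ennreal (\<eta> powr (1 - p)) * (ennreal (heat_kernel t (x - y)) * ennreal (\<bar>w y\<bar> powr p)) \<partial>lborel)"
        unfolding nn_heat_def
      proof (intro nn_integral_mono)
        fix y
        show "ennreal (heat_kernel t (x - y)) * ennreal \<bar>w y\<bar> \<le> ennreal (heat_kernel t (x - y)) * ennreal \<eta> +
          ennreal (\<eta> powr (1 - p)) * (ennreal (heat_kernel t (x - y)) * ennreal (\<bar>w y\<bar> powr p))"
          using mult_left_mono[OF wb[of y], of "ennreal (heat_kernel t (x - y))"] by (simp add: distrib_left mult_ac)
      qed
      also have "\<dots> = ennreal \<eta> + ennreal (\<eta> powr (1 - p)) * nn_heat t (\<lambda>y. \<bar>w y\<bar> powr p) x"
        by (subst nn_integral_add) (auto simp: nn_integral_cmult nn_integral_multc nn_integral_heat_kernel_diff[OF t] nn_heat_def)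
      finally show ?thesis .
    qed
    let ?W = "\<lambda>x. ennreal (\<bar>w x\<bar> powr p)" and ?H = "\<lambda>x. nn_heat t (\<lambda>y. \<bar>w y\<bar> powr p) x"
    have [measurable]: "?H \<in> borel_measurable borel" by (rule nn_heat_measurable) auto
    have "(\<integral>\<^sup>+x. indicator ?B x * ennreal \<bar>heat t v x - v x\<bar> \<partial>lborel) \<le>
      (\<integral>\<^sup>+x. ennreal \<bar>heat t h x - h x\<bar> + (ennreal (2 * \<eta>) * indicator ?B x + ennreal (\<eta> powr (1 - p)) * (?H x + ?W x)) \<partial>lborel)"
    proof (intro nn_integral_mono)
      fix x
      have "\<bar>heat t v x - v x\<bar> \<le> \<bar>heat t h x - h x\<bar> + (\<bar>heat t w x\<bar> + \<bar>w x\<bar>)" by (simp add: hv w_def)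
      then have "ennreal \<bar>heat t v x - v x\<bar> \<le> ennreal (\<bar>heat t h x - h x\<bar> + (\<bar>heat t w x\<bar> + \<bar>w x\<bar>))"
        by (rule ennreal_leI)
      also have "\<dots> = ennreal \<bar>heat t h x - h x\<bar> + (ennreal \<bar>heat t w x\<bar> + ennreal \<bar>w x\<bar>)" by simp
      also have "\<dots> \<le> ennreal \<bar>heat t h x - h x\<bar> + ((ennreal \<eta> + ennreal (\<eta> powr (1 - p)) * ?H x) + (ennreal \<eta> + ennreal (\<eta> powr (1 - p)) * ?W x))"
        by (intro add_mono hb wb order_refl)
      finally show "indicator ?B x * ennreal \<bar>heat t v x - v x\<bar> \<le>
         ennreal \<bar>heat t h x - h x\<bar> + (ennreal (2 * \<eta>) * indicator ?B x + ennreal (\<eta> powr (1 - p)) * (?H x + ?W x))"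
        unfolding e2 by (cases "x \<in> ?B") (simp_all add: distrib_left add_ac)
    qed
    also have "\<dots> = (\<integral>\<^sup>+x. ennreal \<bar>heat t h x - h x\<bar> \<partial>lborel) +
        (ennreal (2 * \<eta>) * ennreal b + ennreal (\<eta> powr (1 - p)) * ((\<integral>\<^sup>+x. ?H x \<partial>lborel) + (\<integral>\<^sup>+x. ?W x \<partial>lborel)))"
    proof -
      have m1: "(\<lambda>x. ennreal \<bar>heat t h x - h x\<bar>) \<in> borel_measurable lborel" by measurable
      have [measurable]: "?B \<in> sets borel" by simp
      have m2: "(\<lambda>x. ennreal (2 * \<eta>) * indicator ?B x) \<in> borel_measurable lborel" by measurable
      have m3: "(\<lambda>x. ?H x + ?W x) \<in> borel_measurable lborel" by measurable
      have "(\<integral>\<^sup>+x. ?H x + ?W x \<partial>lborel) = (\<integral>\<^sup>+x. ?H x \<partial>lborel) + (\<integral>\<^sup>+x. ?W x \<partial>lborel)"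
        by (intro nn_integral_add) measurable
      moreover have "(\<integral>\<^sup>+x. ennreal (2 * \<eta>) * indicator ?B x \<partial>lborel) = ennreal (2 * \<eta>) * ennreal b"
        by (subst nn_integral_cmult_indicator) (auto simp: b)
      ultimately show ?thesis
        using m1 m2 m3 by (simp add: nn_integral_add nn_integral_cmult)
    qed
    also have "(\<integral>\<^sup>+x. ?H x \<partial>lborel) = (\<integral>\<^sup>+x. ?W x \<partial>lborel)" by (rule nn_integral_nn_heat) (use t in auto)
    also have "(\<integral>\<^sup>+x. ennreal \<bar>heat t h x - h x\<bar> \<partial>lborel) = ennreal (\<integral>x. \<bar>heat t h x - h x\<bar> \<partial>lborel)"
      using ih integrable_heat(1)[OF t ih] by (intro nn_integral_eq_integral) auto
    also have "ennreal (\<integral>x. \<bar>heat t h x - h x\<bar> \<partial>lborel) +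
        (ennreal (2 * \<eta>) * ennreal b + ennreal (\<eta> powr (1 - p)) * ((\<integral>\<^sup>+x. ?W x \<partial>lborel) + (\<integral>\<^sup>+x. ?W x \<partial>lborel))) \<le>
        ennreal (\<epsilon> / 2) + (ennreal (2 * \<eta>) * ennreal b + ennreal (\<eta> powr (1 - p)) * (ennreal \<gamma> + ennreal \<gamma>))"
      using elim(1) by (intro add_mono mult_left_mono wk ennreal_leI) auto
    also have "\<dots> = ennreal (\<epsilon> / 2 + (2 * \<eta> * b + \<eta> powr (1 - p) * (\<gamma> + \<gamma>)))"
      using \<eta> \<gamma> b \<epsilon> by (simp add: ennreal_mult[symmetric] ennreal_plus[symmetric] del: ennreal_plus)
    also have "\<dots> \<le> ennreal \<epsilon>"
      using \<eta>(2) \<gamma>(2) by (intro ennreal_leI) (simp add: distrib_left)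
    finally show ?case .
  qed
qed

section \<open>The complementary Young function and its pairing with exp L^p\<close>

context
  fixes p :: real and \<psi> :: "real \<Rightarrow> real"
  assumes p: "p > 1"
  defines "\<psi> \<equiv> complementary_fun (exp_young p)"
begin

lemma powr_le_exp_young_self: "s powr p \<le> exp_young p s"
  using exp_ge_add_one_self[of "s powr p"] unfolding exp_young_def by linarith

text \<open>A real supremum has its intended meaning only for a nonempty set bounded above. Once
  \<open>s powr (p - 1)\<close> exceeds \<open>\<bar>t\<bar>\<close>, the term
  \<open>s powr p\<close> outweighs \<open>s * \<bar>t\<bar>\<close>; below that point
  \<open>s\<close> itself is bounded.\<close>

lemma complementary_bdd: "bdd_above ((\<lambda>s. s * t - exp_young p s) ` {0..})"
proof (rule bdd_aboveI2)
  fix s :: real assume "s \<in> {0..}"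
  then have s: "s \<ge> 0" by simp
  have "s * t - exp_young p s \<le> s * \<bar>t\<bar> - s powr p"
    using s powr_le_exp_young_self[of s] by (intro diff_mono mult_left_mono) auto
  also have "\<dots> \<le> \<bar>t\<bar> * \<bar>t\<bar> powr (1 / (p - 1))"
  proof (cases "s powr (p - 1) \<le> \<bar>t\<bar>")
    case True
    then have "s \<le> \<bar>t\<bar> powr (1 / (p - 1))" using s p by (intro le_powr_inverse) auto
    then have "s * \<bar>t\<bar> \<le> \<bar>t\<bar> powr (1 / (p - 1)) * \<bar>t\<bar>" by (intro mult_right_mono) auto
    then show ?thesis using powr_ge_zero[of s p] by (simp add: mult.commute del: powr_ge_zero)
  next
    case False
    then have "s * \<bar>t\<bar> \<le> s * s powr (p - 1)" using s by (intro mult_left_mono) auto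
    also have "\<dots> = s powr p" using s by (cases "s = 0") (auto simp: powr_diff)
    finally have "s * \<bar>t\<bar> - s powr p \<le> 0" by simp
    also have "0 \<le> \<bar>t\<bar> * \<bar>t\<bar> powr (1 / (p - 1))" by simp
    finally show ?thesis .
  qed
  finally show "s * t - exp_young p s \<le> \<bar>t\<bar> * \<bar>t\<bar> powr (1 / (p - 1))" .
qed

lemma complementary_young: "s \<ge> 0 \<Longrightarrow> s * t \<le> exp_young p s + \<psi> t"
  using cSUP_upper[OF _ complementary_bdd, of s t] by (simp add: \<psi>_def complementary_fun_def)

lemma complementary_nonneg: "0 \<le> \<psi> t"
  using complementary_young[of 0 t] by simp

lemma complementary_zero: "\<psi> 0 = 0"
proof (rule antisym)
  show "\<psi> 0 \<le> 0" unfolding \<psi>_def complementary_fun_def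
    by (rule cSUP_least) (auto simp: exp_young_nonneg)
qed (rule complementary_nonneg)

lemma complementary_mono: "t \<le> t' \<Longrightarrow> \<psi> t \<le> \<psi> t'"
  unfolding \<psi>_def complementary_fun_def
  by (rule cSUP_mono) (auto intro!: complementary_bdd bexI mult_left_mono)

lemma complementary_measurable [measurable]: "\<psi> \<in> borel_measurable borel"
  by (intro borel_measurable_mono monoI complementary_mono)

text \<open>Convexity of \<open>x \<mapsto> exp x - 1\<close> in \<open>x = s powr p\<close> gives
  \<open>exp_young p (s / c) \<le> exp_young p s / c powr p\<close>; by duality
  \<open>\<psi>\<close> grows at most like the power \<open>p / (p - 1)\<close>.\<close>

lemma complementary_doubling:
  assumes c: "c \<ge> 1"
  shows "\<psi> (c powr (p - 1) * t) \<le> c powr p * \<psi> t"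
  unfolding \<psi>_def complementary_fun_def[of _ "c powr (p - 1) * t"]
proof (rule cSUP_least)
  fix s :: real assume "s \<in> {0..}"
  then have s: "s \<ge> 0" by simp
  have cp: "c powr p \<ge> 1" using c p by (simp add: ge_one_powr_ge_zero)
  have "exp_young 1 (s powr p / c powr p) \<le> exp_young 1 (s powr p) / c powr p"
    using cp by (intro exp_young_le_scale) auto
  then have e: "c powr p * exp_young p (s / c) \<le> exp_young p s"
    using s c cp by (simp add: exp_young_def powr_divide field_simps)
  have "s * (c powr (p - 1) * t) - exp_young p s \<le> c powr p * (s / c * t) - c powr p * exp_young p (s / c)"
    using e c by (simp add: powr_diff field_simps)
  also have "\<dots> = c powr p * (s / c * t - exp_young p (s / c))" by (simp add: right_diff_distrib)
  also have "\<dots> \<le> c powr p * \<psi> t"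
    using complementary_young[of "s / c" t] s c by (intro mult_left_mono) auto
  finally show "s * (c powr (p - 1) * t) - exp_young p s \<le> c powr p * complementary_fun (exp_young p) t"
    unfolding \<psi>_def .
qed simp

text \<open>Membership in the Orlicz space gives a finite modular at some level, and doubling
  extends this to every level. Thus \<open>g\<close> can be examined at the small level that weak*
  convergence requires.\<close>

lemma complementary_modular_finite:
  fixes g :: "real^'n \<Rightarrow> real"
  assumes g: "g \<in> orlicz_space \<psi>" and l: "l > 0"
  shows "(\<integral>\<^sup>+x. ennreal (\<psi> (\<bar>g x\<bar> / l)) \<partial>lebesgue) < \<infinity>"
proof -
  have [measurable]: "g \<in> borel_measurable lebesgue" using g by (rule expL_measurable)
  obtain k where k: "k > 0" "(\<integral>\<^sup>+x. ennreal (\<psi> (\<bar>g x\<bar> / k)) \<partial>lebesgue) < \<infinity>"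
    using g by (auto simp: orlicz_space_def)
  define c where "c = max 1 ((k / l) powr (1 / (p - 1)))"
  have c: "c \<ge> 1" by (simp add: c_def)
  have "((k / l) powr (1 / (p - 1))) powr (p - 1) \<le> c powr (p - 1)"
    using p by (intro powr_mono2) (auto simp: c_def)
  then have ck: "k / l \<le> c powr (p - 1)" using p k l by (simp add: powr_powr)
  have "(\<integral>\<^sup>+x. ennreal (\<psi> (\<bar>g x\<bar> / l)) \<partial>lebesgue) \<le> (\<integral>\<^sup>+x. ennreal (c powr p) * ennreal (\<psi> (\<bar>g x\<bar> / k)) \<partial>lebesgue)"
  proof (intro nn_integral_mono)
    fix x
    have "\<bar>g x\<bar> / l = k / l * (\<bar>g x\<bar> / k)" using k by simp
    also have "\<dots> \<le> c powr (p - 1) * (\<bar>g x\<bar> / k)" using k by (intro mult_right_mono ck) auto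
    finally have "\<psi> (\<bar>g x\<bar> / l) \<le> \<psi> (c powr (p - 1) * (\<bar>g x\<bar> / k))" by (rule complementary_mono)
    also have "\<dots> \<le> c powr p * \<psi> (\<bar>g x\<bar> / k)" by (rule complementary_doubling[OF c])
    finally show "ennreal (\<psi> (\<bar>g x\<bar> / l)) \<le> ennreal (c powr p) * ennreal (\<psi> (\<bar>g x\<bar> / k))"
      by (simp add: ennreal_mult[symmetric] complementary_nonneg ennreal_leI)
  qed
  also have "\<dots> < \<infinity>" using k by (subst nn_integral_cmult) (auto simp: ennreal_mult_less_top)
  finally show ?thesis .
qed

text \<open>Young's inequality for \<open>v / c\<close> and \<open>g / l\<close>. The factor
  \<open>c * l\<close> is the source of smallness: \<open>c\<close> is fixed by the bound on
  \<open>v\<close>, whereas \<open>l\<close> is free.\<close>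

lemma orlicz_pairing_le:
  fixes v g :: "real^'n \<Rightarrow> real"
  assumes [measurable]: "v \<in> borel_measurable lebesgue" "g \<in> borel_measurable lebesgue" and c: "c > 0" "l > 0"
  shows "(\<integral>\<^sup>+x. ennreal (\<bar>v x\<bar> * \<bar>g x\<bar>) \<partial>lebesgue) \<le> ennreal (c * l) *
    (exp_modular p (\<lambda>x. \<bar>v x\<bar> / c) + (\<integral>\<^sup>+x. ennreal (\<psi> (\<bar>g x\<bar> / l)) \<partial>lebesgue))"
proof -
  have "(\<integral>\<^sup>+x. ennreal (\<bar>v x\<bar> * \<bar>g x\<bar>) \<partial>lebesgue) \<le>
     (\<integral>\<^sup>+x. ennreal (c * l) * (ennreal (exp_young p (\<bar>v x\<bar> / c)) + ennreal (\<psi> (\<bar>g x\<bar> / l))) \<partial>lebesgue)"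
  proof (intro nn_integral_mono)
    fix x
    have "c * l * (\<bar>v x\<bar> / c * (\<bar>g x\<bar> / l)) \<le> c * l * (exp_young p (\<bar>v x\<bar> / c) + \<psi> (\<bar>g x\<bar> / l))"
      using c by (intro mult_left_mono complementary_young) auto
    then have "\<bar>v x\<bar> * \<bar>g x\<bar> \<le> c * l * (exp_young p (\<bar>v x\<bar> / c) + \<psi> (\<bar>g x\<bar> / l))" using c by simp
    then show "ennreal (\<bar>v x\<bar> * \<bar>g x\<bar>) \<le> ennreal (c * l) * (ennreal (exp_young p (\<bar>v x\<bar> / c)) + ennreal (\<psi> (\<bar>g x\<bar> / l)))"
      using c by (simp add: ennreal_mult[symmetric] ennreal_plus[symmetric] complementary_nonneg exp_young_nonneg ennreal_leI del: ennreal_plus)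
  qed
  also have "\<dots> = ennreal (c * l) * (exp_modular p (\<lambda>x. \<bar>v x\<bar> / c) + (\<integral>\<^sup>+x. ennreal (\<psi> (\<bar>g x\<bar> / l)) \<partial>lebesgue))"
    by (subst nn_integral_cmult) (auto simp: nn_integral_add)
  finally show ?thesis .
qed

lemma orlicz_pairing_integrable:
  fixes v g :: "real^'n \<Rightarrow> real"
  assumes v: "v \<in> expL p" and g: "g \<in> orlicz_space \<psi>"
  shows "integrable lebesgue (\<lambda>x. v x * g x)"
proof (rule integrableI_bounded)
  note vm = expL_measurable[OF v] and gm = expL_measurable[OF g]
  show "(\<lambda>x. v x * g x) \<in> borel_measurable lebesgue" using vm gm by measurable
  obtain c where c: "c > 0" "exp_modular p (\<lambda>x. \<bar>v x\<bar> / c) < \<infinity>"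
    using v by (auto simp: orlicz_space_def)
  have "(\<integral>\<^sup>+x. ennreal (\<bar>v x\<bar> * \<bar>g x\<bar>) \<partial>lebesgue) < \<infinity>"
    by (rule order_le_less_trans[OF orlicz_pairing_le[OF vm gm c(1), of 1]])
       (use c complementary_modular_finite[OF g, of 1] in \<open>auto simp: ennreal_mult_less_top\<close>)
  then show "(\<integral>\<^sup>+x. ennreal (norm (v x * g x)) \<partial>lebesgue) < \<infinity>" by (simp add: abs_mult)
qed

text \<open>Modularly bounded families which vanish locally in \<open>L\<^sup>1\<close> converge weakly*: the doubling
  property makes the pairing with the tail of \<open>g\<close> uniformly small.\<close>

lemma weak_star_null:
  fixes v :: "real \<Rightarrow> real^'n \<Rightarrow> real"
  assumes g: "g \<in> orlicz_space \<psi>" and c: "c > 0" and \<epsilon>: "\<epsilon> > 0"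
    and bounded: "eventually (\<lambda>t. v t \<in> borel_measurable lebesgue \<and>
       exp_modular p (\<lambda>x. \<bar>v t x\<bar> / c) \<le> 1) F"
    and loc: "\<And>R \<epsilon>. \<epsilon> > 0 \<Longrightarrow> eventually (\<lambda>t. (\<integral>\<^sup>+x. indicator (cball 0 R) x * ennreal \<bar>v t x\<bar> \<partial>lebesgue) \<le> ennreal \<epsilon>) F"
  shows "eventually (\<lambda>t. (\<integral>\<^sup>+x. ennreal (\<bar>v t x\<bar> * \<bar>g x\<bar>) \<partial>lebesgue) \<le> ennreal \<epsilon>) F"
proof -
  have [measurable]: "g \<in> borel_measurable lebesgue" using g by (rule expL_measurable)
  \<comment> \<open>On the tail of \<open>g\<close> both modulars are at most 1, so the pairing
    there costs at most \<open>2 * c * l = \<epsilon> / 2\<close>.\<close>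
  define l where "l = \<epsilon> / (4 * c)"
  have l: "l > 0" "c * l = \<epsilon> / 4" using \<epsilon> c by (auto simp: l_def)
  define S where "S k = {x :: real^'n. norm x \<le> real k \<and> \<bar>g x\<bar> \<le> real k}" for k
  have [measurable]: "S k \<in> sets lebesgue" for k
  proof -
    have "(norm :: real^'n \<Rightarrow> real) \<in> borel_measurable lebesgue" by (rule measurable_completion) simp
    then have "{x \<in> space lebesgue. norm x \<le> real k \<and> \<bar>g x\<bar> \<le> real k} \<in> sets (lebesgue :: (real^'n) measure)"
      by measurable
    then show ?thesis by (simp add: S_def)
  qed
  define g2 where "g2 k x = indicator (- S k) x * g x" for k x
  have g2m [measurable]: "g2 k \<in> borel_measurable lebesgue" for k unfolding g2_def by measurable
  have "(\<lambda>k. \<integral>\<^sup>+x. ennreal (\<psi> (\<bar>g2 k x\<bar> / l)) \<partial>lebesgue) \<longlonglongrightarrow> (\<integral>\<^sup>+x. 0 \<partial>(lebesgue :: (real^'n) measure))"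
  proof (rule nn_integral_dominated_convergence[where w = "\<lambda>x. ennreal (\<psi> (\<bar>g x\<bar> / l))"])
    show "AE x in lebesgue. (\<lambda>k. ennreal (\<psi> (\<bar>g2 k x\<bar> / l))) \<longlonglongrightarrow> 0"
    proof (rule AE_I2)
      fix x :: "real^'n"
      obtain k where k: "max (norm x) \<bar>g x\<bar> \<le> real k" using real_arch_simple by blast
      show "(\<lambda>k. ennreal (\<psi> (\<bar>g2 k x\<bar> / l))) \<longlonglongrightarrow> 0"
        by (rule tendsto_eventually, rule eventually_sequentiallyI[of k])
           (use k in \<open>auto simp: g2_def S_def indicator_def complementary_zero\<close>)
    qed
    show "AE x in lebesgue. ennreal (\<psi> (\<bar>g2 k x\<bar> / l)) \<le> ennreal (\<psi> (\<bar>g x\<bar> / l))" for k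
      using l by (intro AE_I2 ennreal_leI complementary_mono) (auto simp: g2_def indicator_def)
  qed (use complementary_modular_finite[OF g l(1)] in auto)
  then have "eventually (\<lambda>k. (\<integral>\<^sup>+x. ennreal (\<psi> (\<bar>g2 k x\<bar> / l)) \<partial>lebesgue) < 1) sequentially"
    by (intro order_tendstoD(2)) auto
  then obtain k where k: "(\<integral>\<^sup>+x. ennreal (\<psi> (\<bar>g2 k x\<bar> / l)) \<partial>lebesgue) < 1"
    by (auto simp: eventually_sequentially)
  \<comment> \<open>This accuracy, multiplied by the bound \<open>real k\<close> of \<open>g\<close>
    on \<open>S k\<close>, stays below \<open>\<epsilon> / 2\<close>; the added 1 covers
    \<open>k = 0\<close>.\<close>
  have "\<epsilon> / (2 * (real k + 1)) > 0" using \<epsilon> by simp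
  from bounded loc[OF this, of "real k"] show ?thesis
  proof eventually_elim
    case (elim t)
    have [measurable]: "v t \<in> borel_measurable lebesgue" using elim by simp
    have [measurable]: "cball 0 (real k) \<in> sets (lebesgue :: (real^'n) measure)" by simp
    have "(\<integral>\<^sup>+x. ennreal (\<bar>v t x\<bar> * \<bar>g x\<bar>) \<partial>lebesgue) \<le>
      (\<integral>\<^sup>+x. ennreal (real k) * (indicator (cball 0 (real k)) x * ennreal \<bar>v t x\<bar>) + ennreal (\<bar>v t x\<bar> * \<bar>g2 k x\<bar>) \<partial>lebesgue)"
    proof (intro nn_integral_mono)
      fix x
      show "ennreal (\<bar>v t x\<bar> * \<bar>g x\<bar>) \<le> ennreal (real k) * (indicator (cball 0 (real k)) x * ennreal \<bar>v t x\<bar>) + ennreal (\<bar>v t x\<bar> * \<bar>g2 k x\<bar>)"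
      proof (cases "x \<in> S k")
        case True
        then have "\<bar>v t x\<bar> * \<bar>g x\<bar> \<le> real k * \<bar>v t x\<bar>"
          by (subst mult.commute) (auto simp: S_def intro!: mult_right_mono)
        then have "ennreal (\<bar>v t x\<bar> * \<bar>g x\<bar>) \<le> ennreal (real k) * ennreal \<bar>v t x\<bar>"
          by (simp add: ennreal_mult[symmetric] ennreal_leI)
        then show ?thesis using True by (auto simp: S_def add_increasing2)
      qed (simp add: g2_def)
    qed
    also have "\<dots> = ennreal (real k) * (\<integral>\<^sup>+x. indicator (cball 0 (real k)) x * ennreal \<bar>v t x\<bar> \<partial>lebesgue) +
        (\<integral>\<^sup>+x. ennreal (\<bar>v t x\<bar> * \<bar>g2 k x\<bar>) \<partial>lebesgue)"
      by (subst nn_integral_add) (auto simp: nn_integral_cmult)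
    also have "\<dots> \<le> ennreal (real k) * ennreal (\<epsilon> / (2 * (real k + 1))) + ennreal (\<epsilon> / 4) * (1 + 1)"
    proof (intro add_mono mult_left_mono elim)
      have "(\<integral>\<^sup>+x. ennreal (\<bar>v t x\<bar> * \<bar>g2 k x\<bar>) \<partial>lebesgue) \<le> ennreal (c * l) *
          (exp_modular p (\<lambda>x. \<bar>v t x\<bar> / c) + (\<integral>\<^sup>+x. ennreal (\<psi> (\<bar>g2 k x\<bar> / l)) \<partial>lebesgue))"
        by (rule orlicz_pairing_le) (use c l in auto)
      also have "\<dots> \<le> ennreal (c * l) * (1 + 1)"
        using elim(1) k by (intro mult_left_mono add_mono) auto
      finally show "(\<integral>\<^sup>+x. ennreal (\<bar>v t x\<bar> * \<bar>g2 k x\<bar>) \<partial>lebesgue) \<le> ennreal (\<epsilon> / 4) * (1 + 1)" by (simp add: l)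
    qed auto
    also have "\<dots> = ennreal (real k * (\<epsilon> / (2 * (real k + 1))) + \<epsilon> / 4 * 2)"
    proof -
      have k1: "ennreal (real k) * ennreal (\<epsilon> / (2 * (real k + 1))) = ennreal (real k * (\<epsilon> / (2 * (real k + 1))))"
        using \<epsilon> by (intro ennreal_mult[symmetric]) auto
      have e4: "0 \<le> \<epsilon> / 4" using \<epsilon> by simp
      have "ennreal (\<epsilon> / 4) * (1 + 1) = ennreal (\<epsilon> / 4 + \<epsilon> / 4)"
        unfolding ennreal_plus[OF e4 e4] distrib_left mult_1_right ..
      with k1 show ?thesis using \<epsilon> by (subst ennreal_plus) auto
    qed
    also have "\<dots> \<le> ennreal \<epsilon>"
      using \<epsilon> by (intro ennreal_leI) (simp add: field_simps)
    finally show ?case .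
  qed
qed

end

section \<open>Existence of the solution\<close>

lemma nn_integral_powr_interval:
  assumes "\<beta> > 0" "t > 0"
  shows "(\<integral>\<^sup>+s. ennreal (indicator {0<..<t} s * (\<beta> * s powr (\<beta> - 1))) \<partial>lborel) = ennreal (t powr \<beta>)"
proof -
  have hi: "((\<lambda>s. \<beta> * s powr (\<beta> - 1)) has_integral (\<beta> * (t powr (\<beta> - 1 + 1) / (\<beta> - 1 + 1)))) {0..t}"
    using assms by (intro has_integral_mult_right has_integral_powr_from_0) auto
  have "(\<integral>\<^sup>+s. ennreal (indicator {0<..<t} s * (\<beta> * s powr (\<beta> - 1))) \<partial>lborel) =
     (\<integral>\<^sup>+s. ennreal (indicator {0..t} s * (\<beta> * s powr (\<beta> - 1))) \<partial>lborel)"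
  proof (rule nn_integral_cong_AE)
    have "AE s in lborel. s \<noteq> t" by (rule AE_lborel_singleton)
    then show "AE s in lborel. ennreal (indicator {0<..<t} s * (\<beta> * s powr (\<beta> - 1))) = ennreal (indicator {0..t} s * (\<beta> * s powr (\<beta> - 1)))"
      by eventually_elim (auto simp: indicator_def)
  qed
  also have "\<dots> = ennreal (\<beta> * (t powr (\<beta> - 1 + 1) / (\<beta> - 1 + 1)))"
    using assms by (intro nn_integral_has_integral_lebesgue hi) auto
  finally show ?thesis using assms by simp
qed

text \<open>The assumption \<open>small\<close> is the conclusion of \<open>majorant_bound\<close>;
  it is discharged when the locale is interpreted for a concrete datum.\<close>

locale heat_flow = small_datum m p r e \<phi> for m p r e :: real and \<phi> :: "real^'n \<Rightarrow> real" +
  fixes f :: "real \<Rightarrow> real" and C0 lam :: real and v0 :: "real^'n \<Rightarrow> real" and \<beta> :: real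
  assumes f0: "f 0 = 0" and C0: "C0 > 0" and lam: "lam > 0"
    and f_lipschitz: "\<And>u v. \<bar>f u - f v\<bar> \<le> C0 * \<bar>u - v\<bar> *
      (\<bar>u\<bar> powr (m - 1) * exp (lam * \<bar>u\<bar> powr p) + \<bar>v\<bar> powr (m - 1) * exp (lam * \<bar>v\<bar> powr p))"
    and v0_measurable [measurable]: "v0 \<in> borel_measurable borel" and phi_eq: "\<And>x. \<phi> x = \<bar>v0 x\<bar>"
    and beta_eq: "\<beta> = (r - 1) / (m - 1)"
    and small: "\<And>s x. s > 0 \<Longrightarrow> 2 * C0 * ((Q s x powr (1 / r) + s powr \<beta> * Q s x) powr m *
      exp (lam * (Q s x powr (1 / r) + s powr \<beta> * Q s x) powr p)) \<le> \<beta> * s powr (\<beta> - 1) * Q s x"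
begin

definition F :: "real \<Rightarrow> real" where "F w = 2 * C0 * (w powr m * exp (lam * w powr p))"
definition W :: "real \<Rightarrow> real^'n \<Rightarrow> real" where "W t x = Q t x powr (1 / r) + t powr \<beta> * Q t x"
text \<open>One kernel on space-time, with the cutoff \<open>0 < s < t\<close> built in, makes the
  Duhamel map a single integral operator to which \<open>majorant_fixed_point\<close>
  applies.\<close>

definition K :: "real \<times> (real^'n) \<Rightarrow> real \<times> (real^'n) \<Rightarrow> real" where
  "K z z' = (if 0 < fst z' \<and> fst z' < fst z then heat_kernel (fst z - fst z') (snd z - snd z') else 0)"

lemma m_gt_1: "m > 1" using r pm by simp

lemma beta: "0 < \<beta>" "\<beta> < 1"
  using r pm by (auto simp: beta_eq field_simps)

lemma W_nonneg: "0 \<le> W t x"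
  by (simp add: W_def)

lemma F_W: "s > 0 \<Longrightarrow> F (W s x) \<le> \<beta> * s powr (\<beta> - 1) * Q s x"
  using small by (simp add: F_def W_def)

lemma F_mono: "0 \<le> a \<Longrightarrow> a \<le> b \<Longrightarrow> F a \<le> F b"
  unfolding F_def using C0 lam m_gt_1 r by (intro mult_left_mono mult_mono powr_mono2) (auto intro: powr_mono2)

lemma F_nonneg: "0 \<le> F a"
  unfolding F_def using C0 by simp

text \<open>Here \<open>F w = w * l w\<close> with \<open>l\<close> nondecreasing, so
  \<open>F b - F a = (b - a) * l b + a * (l b - l a)\<close> is at least
  \<open>(b - a) * l b\<close>. The factor 2 in \<open>F\<close> accounts for the sum of two weights
  in the hypothesis on \<open>f\<close>.\<close>

lemma f_majorant:
  assumes "\<bar>y\<bar> \<le> a" "\<bar>x - y\<bar> \<le> b - a"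
  shows "\<bar>f x - f y\<bar> \<le> F b - F a"
proof -
  define l where "l w = 2 * C0 * (w powr (m - 1) * exp (lam * w powr p))" for w
  have l_mono: "l v \<le> l w" if "0 \<le> v" "v \<le> w" for v w
    unfolding l_def using C0 lam m_gt_1 r that by (intro mult_left_mono mult_mono powr_mono2) (auto intro: powr_mono2)
  have F_l: "F w = w * l w" if "w \<ge> 0" for w
    using that by (cases "w = 0") (auto simp: F_def l_def powr_diff)
  have ab: "0 \<le> a" "a \<le> b" "\<bar>x\<bar> \<le> b" using assms by auto
  have "\<bar>f x - f y\<bar> \<le> \<bar>x - y\<bar> * ((l \<bar>x\<bar> + l \<bar>y\<bar>) / 2)"
    using f_lipschitz[of x y] by (simp add: l_def algebra_simps)
  also have "\<dots> \<le> (b - a) * ((l b + l b) / 2)"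
    using assms ab C0 l_mono by (intro mult_mono divide_right_mono add_mono) (auto simp: l_def)
  also have "\<dots> \<le> (b - a) * l b + a * (l b - l a)" using ab l_mono[of a b] by simp
  also have "\<dots> = F b - F a" using ab by (simp add: F_l algebra_simps)
  finally show ?thesis .
qed

lemma f_le_F: "\<bar>x\<bar> \<le> b \<Longrightarrow> \<bar>f x\<bar> \<le> F b"
  using f_majorant[of 0 0 x b] f0 m_gt_1 by (simp add: F_def)

lemma f_cont: "isCont f x"
proof -
  define R where "R = \<bar>x\<bar> + 1"
  define L where "L = C0 * (2 * (R powr (m - 1) * exp (lam * R powr p)))"
  have "\<bar>f y - f x\<bar> \<le> L * \<bar>y - x\<bar>" if "\<bar>y - x\<bar> < 1" for y
  proof -
    have le: "\<bar>z\<bar> powr (m - 1) * exp (lam * \<bar>z\<bar> powr p) \<le> R powr (m - 1) * exp (lam * R powr p)" if "\<bar>z\<bar> \<le> R" for z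
      using that m_gt_1 lam r by (intro mult_mono powr_mono2) (auto intro: powr_mono2)
    have "\<bar>f y - f x\<bar> \<le> C0 * \<bar>y - x\<bar> * (2 * (R powr (m - 1) * exp (lam * R powr p)))"
    proof (intro order_trans[OF f_lipschitz] mult_left_mono)
      have "\<bar>y\<bar> \<le> R" "\<bar>x\<bar> \<le> R" using that by (auto simp: R_def)
      from le[OF this(1)] le[OF this(2)]
      show "\<bar>y\<bar> powr (m - 1) * exp (lam * \<bar>y\<bar> powr p) + \<bar>x\<bar> powr (m - 1) * exp (lam * \<bar>x\<bar> powr p) \<le>
        2 * (R powr (m - 1) * exp (lam * R powr p))" by linarith
    qed (use C0 in simp)
    then show ?thesis by (simp add: L_def mult_ac)
  qed
  then have "eventually (\<lambda>y. norm (f y - f x) \<le> L * \<bar>y - x\<bar>) (at x)"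
    unfolding eventually_at by (intro exI[of _ 1]) (auto simp: dist_real_def)
  moreover have "((\<lambda>y. L * \<bar>y - x\<bar>) \<longlongrightarrow> 0) (at x)"
    by (rule tendsto_eq_intros | simp)+
  ultimately have "((\<lambda>y. f y - f x) \<longlongrightarrow> 0) (at x)" by (rule Lim_null_comparison)
  then show ?thesis by (simp add: isCont_def LIM_zero_iff)
qed

lemma f_measurable [measurable]: "f \<in> borel_measurable borel"
  using f_cont by (intro borel_measurable_continuous_onI continuous_at_imp_continuous_on) auto

text \<open>The evolution of \<open>Q s\<close> over time \<open>t - s\<close> is
  \<open>Q t\<close>, whatever \<open>s\<close> is, so only the integral of
  \<open>\<beta> * s powr (\<beta> - 1)\<close> remains. A general \<open>g\<close> is allowed
  because the bound serves the majorant as well as the true forcing term.\<close>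

lemma kernel_bound:
  fixes g :: "real \<times> (real^'n) \<Rightarrow> real"
  assumes t: "t > 0" and [measurable]: "g \<in> borel_measurable borel"
    and g: "\<And>s y. s > 0 \<Longrightarrow> \<bar>g (s, y)\<bar> \<le> \<beta> * s powr (\<beta> - 1) * Q s y"
  shows "(\<integral>\<^sup>+z. ennreal \<bar>K (t, x) z * g z\<bar> \<partial>(lborel \<Otimes>\<^sub>M lborel)) \<le> ennreal (t powr \<beta> * Q t x)"
proof -
  have [measurable]: "g \<in> borel_measurable (borel \<Otimes>\<^sub>M borel)" by (simp add: borel_prod)
  have "(\<integral>\<^sup>+z. ennreal \<bar>K (t, x) z * g z\<bar> \<partial>(lborel \<Otimes>\<^sub>M lborel)) =
     (\<integral>\<^sup>+s. \<integral>\<^sup>+y. ennreal \<bar>K (t, x) (s, y) * g (s, y)\<bar> \<partial>lborel \<partial>lborel)"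
    unfolding K_def by (rule lborel.nn_integral_fst[symmetric]) measurable
  also have "\<dots> \<le> (\<integral>\<^sup>+s. ennreal (indicator {0<..<t} s * (\<beta> * s powr (\<beta> - 1))) * ennreal (Q t x) \<partial>lborel)"
  proof (rule nn_integral_mono)
    fix s :: real
    show "(\<integral>\<^sup>+y. ennreal \<bar>K (t, x) (s, y) * g (s, y)\<bar> \<partial>lborel) \<le>
        ennreal (indicator {0<..<t} s * (\<beta> * s powr (\<beta> - 1))) * ennreal (Q t x)"
    proof (cases "s \<in> {0<..<t}")
      case True
      then have s: "s > 0" "t - s > 0" by auto
      have "(\<integral>\<^sup>+y. ennreal \<bar>K (t, x) (s, y) * g (s, y)\<bar> \<partial>lborel) \<le>
          (\<integral>\<^sup>+y. ennreal (\<beta> * s powr (\<beta> - 1)) * (ennreal (heat_kernel (t - s) (x - y)) * ennreal (Q s y)) \<partial>lborel)"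
      proof (rule nn_integral_mono)
        fix y
        have "\<bar>K (t, x) (s, y) * g (s, y)\<bar> \<le> heat_kernel (t - s) (x - y) * (\<beta> * s powr (\<beta> - 1) * Q s y)"
          using s by (auto simp: K_def abs_mult intro!: mult_left_mono g)
        then have "ennreal \<bar>K (t, x) (s, y) * g (s, y)\<bar> \<le> ennreal (heat_kernel (t - s) (x - y) * (\<beta> * s powr (\<beta> - 1) * Q s y))"
          by (rule ennreal_leI)
        also have "\<dots> = ennreal (\<beta> * s powr (\<beta> - 1)) * (ennreal (heat_kernel (t - s) (x - y)) * ennreal (Q s y))"
          using beta by (simp add: ennreal_mult mult_ac)
        finally show "ennreal \<bar>K (t, x) (s, y) * g (s, y)\<bar> \<le> ennreal (\<beta> * s powr (\<beta> - 1)) * (ennreal (heat_kernel (t - s) (x - y)) * ennreal (Q s y))" .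
      qed
      also have "\<dots> = ennreal (\<beta> * s powr (\<beta> - 1)) * ennreal (Q t x)"
        using s by (subst nn_integral_cmult) (simp_all add: Q_semigroup)
      finally show ?thesis using True by simp
    next
      case False
      then have "K (t, x) (s, y) = 0" for y by (auto simp: K_def)
      then show ?thesis by simp
    qed
  qed
  also have "\<dots> = ennreal (t powr \<beta>) * ennreal (Q t x)"
    by (subst nn_integral_multc) (simp_all add: nn_integral_powr_interval[OF beta(1) t])
  finally show ?thesis by (simp add: ennreal_mult)
qed

lemma K_measurable [measurable (raw)]:
  assumes "g \<in> borel_measurable M" "h \<in> borel_measurable M"
  shows "(\<lambda>z. K (g z) (h z)) \<in> borel_measurable M"
proof -
  have [measurable]: "g \<in> M \<rightarrow>\<^sub>M borel \<Otimes>\<^sub>M borel" "h \<in> M \<rightarrow>\<^sub>M borel \<Otimes>\<^sub>M borel"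
    using assms by (simp_all add: borel_prod)
  show ?thesis unfolding K_def by measurable
qed

lemma solution_exists:
  obtains u where "(\<lambda>(t, x). u t x) \<in> borel_measurable (borel :: (real \<times> (real^'n)) measure)"
    "\<And>t x. t > 0 \<Longrightarrow> \<bar>u t x\<bar> \<le> W t x"
    "\<And>t x. t > 0 \<Longrightarrow> integrable (lborel \<Otimes>\<^sub>M lborel) (\<lambda>z. K (t, x) z * f (u (fst z) (snd z)))"
    "\<And>t x. t > 0 \<Longrightarrow> u t x = heat t v0 x + (\<integral>z. K (t, x) z * f (u (fst z) (snd z)) \<partial>(lborel \<Otimes>\<^sub>M lborel))"
proof -
  let ?M = "lborel :: (real \<times> (real^'n)) measure"
  \<comment> \<open>The fixed point lemma has its hypotheses at every point of space-time; for
    \<open>t \<le> 0\<close> the kernel vanishes, and extension by 0 makes them trivial.\<close>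
  define U where "U z = (if fst z > 0 then heat (fst z) v0 (snd z) else 0)" for z :: "real \<times> (real^'n)"
  define W' where "W' z = (if fst z > 0 then W (fst z) (snd z) else 0)" for z :: "real \<times> (real^'n)"
  have [measurable]: "U \<in> borel_measurable borel" "W' \<in> borel_measurable borel" "F \<in> borel_measurable borel"
    unfolding U_def W'_def W_def F_def borel_prod[symmetric] by measurable
  have F0: "F 0 = 0" by (simp add: F_def)
  have Kz: "K (t, x) = (\<lambda>_. 0)" if "t \<le> 0" for t x using that by (auto simp: K_def)
  have bd: "(\<integral>\<^sup>+z'. ennreal \<bar>K (t, x) z' * F (W' z')\<bar> \<partial>?M) \<le> ennreal (t powr \<beta> * Q t x)" if "t > 0" for t x
    unfolding lborel_prod[symmetric]
  proof (rule kernel_bound[OF that])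
    show "(\<lambda>z. F (W' z)) \<in> borel_measurable borel" by measurable
    show "\<bar>F (W' (s, y))\<bar> \<le> \<beta> * s powr (\<beta> - 1) * Q s y" if "s > 0" for s y
      using that F_W F_nonneg by (simp add: W'_def)
  qed
  have int: "integrable ?M (\<lambda>z'. K z z' * F (W' z'))" for z
  proof (cases z)
    case (Pair t x)
    show ?thesis
    proof (cases "t > 0")
      case True
      show ?thesis unfolding Pair
        by (rule integrableI_bounded) (use order_le_less_trans[OF bd[OF True, of x]] in auto)
    qed (simp add: Pair Kz)
  qed
  have super: "\<bar>U z\<bar> + (\<integral>z'. K z z' * F (W' z') \<partial>?M) \<le> W' z" for z
  proof (cases z)
    case (Pair t x)
    show ?thesis
    proof (cases "t > 0")
      case True
      have "\<bar>heat t v0 x\<bar> \<le> Q t x powr (1 / r)"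
        unfolding heat_eq_lborel[OF v0_measurable]
        by (rule order_trans[OF integral_abs_bound heat_le_Q(2)[OF True v0_measurable]]) (simp add: phi_eq)
      moreover have "(\<integral>z'. K z z' * F (W' z') \<partial>?M) \<le> t powr \<beta> * Q t x"
      proof -
        have nn: "0 \<le> K z z' * F (W' z')" for z' by (simp add: K_def F_nonneg)
        have "ennreal (\<integral>z'. K z z' * F (W' z') \<partial>?M) = (\<integral>\<^sup>+z'. ennreal \<bar>K z z' * F (W' z')\<bar> \<partial>?M)"
          using int nn by (subst nn_integral_eq_integral[symmetric]) auto
        also have "\<dots> \<le> ennreal (t powr \<beta> * Q t x)" unfolding Pair by (rule bd[OF True])
        finally show ?thesis by simp
      qed
      ultimately show ?thesis using True by (simp add: U_def W'_def W_def Pair)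
    qed (simp add: Pair Kz U_def W'_def)
  qed
  have sf: "sigma_finite_measure ?M" by (rule sigma_finite_lborel)
  have Km: "(\<lambda>(z, z'). K z z') \<in> borel_measurable (?M \<Otimes>\<^sub>M ?M)" by measurable
  have meas: "F \<in> borel_measurable borel" "U \<in> borel_measurable ?M" "W' \<in> borel_measurable ?M" "space ?M = UNIV"
    by simp_all
  have nonneg: "0 \<le> K z z'" "0 \<le> W' z" for z z' by (simp_all add: K_def W'_def W_nonneg)
  obtain u where u: "u \<in> borel_measurable ?M" "\<And>z. \<bar>u z\<bar> \<le> W' z"
    "\<And>z. integrable ?M (\<lambda>z'. K z z' * f (u z'))"
    "\<And>z. u z = U z + (\<integral>z'. K z z' * f (u z') \<partial>?M)"
  proof (rule majorant_fixed_point[OF sf Km f_measurable meas nonneg(1) f_cont f0 F0 F_mono f_majorant nonneg(2) int super])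
    fix u
    assume u: "u \<in> borel_measurable ?M" "\<And>z. \<bar>u z\<bar> \<le> W' z" "\<And>z. integrable ?M (\<lambda>z'. K z z' * f (u z'))"
      "\<And>z. u z = U z + (\<integral>z'. K z z' * f (u z') \<partial>?M)"
    show thesis by (rule that[OF u])
  qed assumption+
  show thesis
  proof (rule that[of "\<lambda>t x. u (t, x)"])
    show "(\<lambda>(t, x). u (t, x)) \<in> borel_measurable borel" using u(1) by simp
    show "\<bar>u (t, x)\<bar> \<le> W t x" if "t > 0" for t x using u(2)[of "(t, x)"] that by (simp add: W'_def)
    show "integrable (lborel \<Otimes>\<^sub>M lborel) (\<lambda>z. K (t, x) z * f (u (fst z, snd z)))" for t x
      unfolding lborel_prod using u(3)[of "(t, x)"] by simp
    show "u (t, x) = heat t v0 x + (\<integral>z. K (t, x) z * f (u (fst z, snd z)) \<partial>(lborel \<Otimes>\<^sub>M lborel))" if "t > 0" for t x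
      unfolding lborel_prod using u(4)[of "(t, x)"] that by (simp add: U_def)
  qed
qed

end

section \<open>Properties of the solution\<close>

locale heat_solution = heat_flow m p r e \<phi> f C0 lam v0 \<beta>
  for m p r e :: real and \<phi> :: "real^'n \<Rightarrow> real" and f C0 lam v0 \<beta> +
  fixes u :: "real \<Rightarrow> real^'n \<Rightarrow> real"
  assumes u_measurable: "(\<lambda>(t, x). u t x) \<in> borel_measurable borel"
    and u_le_W: "\<And>t x. t > 0 \<Longrightarrow> \<bar>u t x\<bar> \<le> W t x"
    and u_integrable: "\<And>t x. t > 0 \<Longrightarrow> integrable (lborel \<Otimes>\<^sub>M lborel) (\<lambda>z. K (t, x) z * f (u (fst z) (snd z)))"
    and u_eq: "\<And>t x. t > 0 \<Longrightarrow>
      u t x = heat t v0 x + (\<integral>z. K (t, x) z * f (u (fst z) (snd z)) \<partial>(lborel \<Otimes>\<^sub>M lborel))"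
begin

section \<open>The forcing term and the Duhamel equation\<close>

definition force :: "real \<Rightarrow> real^'n \<Rightarrow> real" where "force s y = f (u s y)"

lemma u_measurable' [measurable (raw)]:
  assumes [measurable]: "g \<in> borel_measurable M" "h \<in> borel_measurable M"
  shows "(\<lambda>z. u (g z) (h z)) \<in> borel_measurable M"
proof -
  have "(\<lambda>z. (g z, h z)) \<in> M \<rightarrow>\<^sub>M borel" by (subst borel_prod[symmetric]) measurable
  from measurable_compose[OF this u_measurable] show ?thesis by simp
qed

lemma force_measurable [measurable (raw)]:
  "g \<in> borel_measurable M \<Longrightarrow> h \<in> borel_measurable M \<Longrightarrow> (\<lambda>z. force (g z) (h z)) \<in> borel_measurable M"
  unfolding force_def by measurable

lemma force_le: "s > 0 \<Longrightarrow> \<bar>force s y\<bar> \<le> \<beta> * s powr (\<beta> - 1) * Q s y"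
  unfolding force_def using f_le_F[OF u_le_W] F_W order_trans by blast

lemma force_kernel:
  assumes s: "s > 0" and a: "a > 0"
  shows "integrable lborel (\<lambda>y. heat_kernel a (x - y) * force s y)"
    and "(\<integral>y. \<bar>heat_kernel a (x - y) * force s y\<bar> \<partial>lborel) \<le> \<beta> * s powr (\<beta> - 1) * Q (a + s) x"
    and "\<bar>heat a (force s) x\<bar> \<le> \<beta> * s powr (\<beta> - 1) * Q (a + s) x"
proof -
  have [measurable]: "force s \<in> borel_measurable borel" by measurable
  have "(\<integral>\<^sup>+y. ennreal \<bar>heat_kernel a (x - y) * force s y\<bar> \<partial>lborel) \<le>
    (\<integral>\<^sup>+y. ennreal (\<beta> * s powr (\<beta> - 1)) * (ennreal (heat_kernel a (x - y)) * ennreal (Q s y)) \<partial>lborel)"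
  proof (rule nn_integral_mono)
    fix y
    have "\<bar>heat_kernel a (x - y) * force s y\<bar> \<le> heat_kernel a (x - y) * (\<beta> * s powr (\<beta> - 1) * Q s y)"
      by (auto simp: abs_mult intro!: mult_left_mono force_le s)
    then have "ennreal \<bar>heat_kernel a (x - y) * force s y\<bar> \<le> ennreal (heat_kernel a (x - y) * (\<beta> * s powr (\<beta> - 1) * Q s y))"
      by (rule ennreal_leI)
    also have "\<dots> = ennreal (\<beta> * s powr (\<beta> - 1)) * (ennreal (heat_kernel a (x - y)) * ennreal (Q s y))"
      using beta by (simp add: ennreal_mult mult_ac)
    finally show "ennreal \<bar>heat_kernel a (x - y) * force s y\<bar> \<le> ennreal (\<beta> * s powr (\<beta> - 1)) * (ennreal (heat_kernel a (x - y)) * ennreal (Q s y))" .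
  qed
  also have "\<dots> = ennreal (\<beta> * s powr (\<beta> - 1) * Q (a + s) x)"
    using s a beta by (subst nn_integral_cmult) (simp_all add: Q_semigroup ennreal_mult)
  finally have b: "(\<integral>\<^sup>+y. ennreal \<bar>heat_kernel a (x - y) * force s y\<bar> \<partial>lborel) \<le> ennreal (\<beta> * s powr (\<beta> - 1) * Q (a + s) x)" .
  show i: "integrable lborel (\<lambda>y. heat_kernel a (x - y) * force s y)"
    by (rule integrableI_bounded) (use order_le_less_trans[OF b] in auto)
  have "ennreal (\<integral>y. \<bar>heat_kernel a (x - y) * force s y\<bar> \<partial>lborel) \<le> ennreal (\<beta> * s powr (\<beta> - 1) * Q (a + s) x)"
    using b i by (subst nn_integral_eq_integral[symmetric]) auto
  then show j: "(\<integral>y. \<bar>heat_kernel a (x - y) * force s y\<bar> \<partial>lborel) \<le> \<beta> * s powr (\<beta> - 1) * Q (a + s) x"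
    using beta by (subst (asm) ennreal_le_iff) auto
  show "\<bar>heat a (force s) x\<bar> \<le> \<beta> * s powr (\<beta> - 1) * Q (a + s) x"
    unfolding heat_eq_lborel[OF \<open>force s \<in> borel_measurable borel\<close>]
    by (rule order_trans[OF integral_abs_bound j])
qed

text \<open>Fubini turns the space-time integral of the fixed point equation into the iterated
  integral of Duhamel's formula, integrability of the outer integrand included.\<close>

lemma duhamel_lborel:
  assumes t: "t > 0"
  shows "integrable lborel (\<lambda>s. indicator {0<..<t} s * heat (t - s) (force s) x)"
    and "u t x = heat t v0 x + (\<integral>s. indicator {0<..<t} s * heat (t - s) (force s) x \<partial>lborel)"
proof -
  have e: "(\<integral>y. K (t, x) (s, y) * f (u (fst (s, y)) (snd (s, y))) \<partial>lborel) = indicator {0<..<t} s * heat (t - s) (force s) x" for s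
  proof (cases "s \<in> {0<..<t}")
    case True
    have "force s \<in> borel_measurable borel" by measurable
    then show ?thesis using True by (simp add: K_def heat_eq_lborel) (simp add: force_def)
  qed (auto simp: K_def)
  show "integrable lborel (\<lambda>s. indicator {0<..<t} s * heat (t - s) (force s) x)"
    using lborel_pair.integrable_fst'[OF u_integrable[OF t, of x]] unfolding e .
  show "u t x = heat t v0 x + (\<integral>s. indicator {0<..<t} s * heat (t - s) (force s) x \<partial>lborel)"
    using lborel_pair.integral_fst'[OF u_integrable[OF t, of x]] u_eq[OF t, of x] unfolding e by simp
qed

lemma heat_force_measurable [measurable (raw)]:
  assumes [measurable]: "g \<in> borel_measurable M" "h \<in> borel_measurable M"
  shows "(\<lambda>z. heat (g z) (force (h z)) x) \<in> borel_measurable M"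
proof -
  have fm: "force s \<in> borel_measurable borel" for s by measurable
  show ?thesis unfolding heat_eq_lborel[OF fm] by measurable
qed

lemma duhamel_eq:
  assumes t: "t > 0"
  shows "duhamel_eq f v0 u t"
  unfolding duhamel_eq_def
proof (intro AE_I2 conjI impI)
  fix x :: "real^'n"
  show "integrable lebesgue (\<lambda>y. heat_kernel (t - s) (x - y) * f (u s y))" if "s \<in> {0<..<t}" for s
    using force_kernel(1)[of s "t - s" x] that by (subst integrable_completion) (auto simp: force_def)
  have fe: "(\<lambda>y. f (u s y)) = force s" for s by (rule ext) (simp add: force_def)
  show "set_integrable lebesgue {0<..<t} (\<lambda>s. heat (t - s) (\<lambda>y. f (u s y)) x)"
    unfolding set_integrable_def fe using duhamel_lborel(1)[OF t, of x]
    by (subst integrable_completion) auto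
  show "u t x = heat t v0 x + set_lebesgue_integral lebesgue {0<..<t} (\<lambda>s. heat (t - s) (\<lambda>y. f (u s y)) x)"
    unfolding set_lebesgue_integral_def fe using duhamel_lborel(2)[OF t, of x]
    by (subst integral_completion) auto
qed

lemma u_diff_heat:
  assumes t: "t > 0"
  shows "\<bar>u t x - heat t v0 x\<bar> \<le> t powr \<beta> * Q t x"
proof -
  let ?g = "\<lambda>z. K (t, x) z * f (u (fst z) (snd z))"
  have [measurable]: "(\<lambda>z. f (u (fst z) (snd z))) \<in> borel_measurable borel"
    unfolding borel_prod[symmetric] by measurable
  have "ennreal \<bar>u t x - heat t v0 x\<bar> \<le> (\<integral>\<^sup>+z. ennreal \<bar>?g z\<bar> \<partial>(lborel \<Otimes>\<^sub>M lborel))"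
    using integral_norm_bound_ennreal[OF u_integrable[OF t, of x]] u_eq[OF t, of x] by simp
  also have "\<dots> \<le> ennreal (t powr \<beta> * Q t x)"
    using force_le by (intro kernel_bound t) (auto simp: force_def)
  finally show ?thesis by simp
qed

subsection \<open>Norm bounds\<close>

definition Qsup :: "real \<Rightarrow> real" where "Qsup q = A q powr (r / q) * e powr r"

lemma Qsup_nonneg: "0 \<le> Qsup q" by (simp add: Qsup_def)

lemma Q_le_Qsup: "t > 0 \<Longrightarrow> q \<ge> p \<Longrightarrow> Q t x \<le> Qsup q * t powr (- (d * r / q))"
  using Q_powr_bound by (simp add: Qsup_def)

text \<open>For small times a large exponent \<open>q\<close> makes \<open>t powr \<beta> * Q t x\<close> of order \<open>t powr (\<beta> / 2)\<close>.\<close>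

lemma increment_sup:
  "\<exists>B\<ge>0. (\<forall>t x. 0 < t \<longrightarrow> t \<le> 1 \<longrightarrow> t powr \<beta> * Q t x \<le> B * t powr (\<beta> / 2)) \<and>
    (\<forall>t x. 1 \<le> t \<longrightarrow> t powr \<beta> * Q t x \<le> B)"
proof -
  define q1 where "q1 = d * (m - 1)"
  define q2 where "q2 = max p (2 * d * r / \<beta>)"
  have q1: "q1 \<ge> p" using qc by (simp add: q1_def d_def)
  have q2: "q2 \<ge> p" "2 * d * r / \<beta> \<le> q2" by (auto simp: q2_def)
  then have q2': "d * r / q2 \<le> \<beta> / 2" using r beta by (simp add: field_simps)
  show ?thesis
  proof (intro exI[of _ "max (Qsup q1) (Qsup q2)"] conjI allI impI)
    fix t :: real and x :: "real^'n" assume t: "0 < t" "t \<le> 1"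
    have "t powr \<beta> * Q t x \<le> t powr \<beta> * (Qsup q2 * t powr (- (d * r / q2)))"
      by (intro mult_left_mono Q_le_Qsup t q2) auto
    also have "\<dots> = Qsup q2 * t powr (\<beta> - d * r / q2)" using t by (simp add: powr_diff powr_minus_divide)
    also have "\<dots> \<le> Qsup q2 * t powr (\<beta> / 2)" using t q2' by (intro mult_left_mono powr_mono' Qsup_nonneg) auto
    also have "\<dots> \<le> max (Qsup q1) (Qsup q2) * t powr (\<beta> / 2)" by (intro mult_right_mono) auto
    finally show "t powr \<beta> * Q t x \<le> max (Qsup q1) (Qsup q2) * t powr (\<beta> / 2)" .
  next
    fix t :: real and x :: "real^'n" assume t: "1 \<le> t"
    have ex: "d * r / q1 = r / (m - 1)" using d_pos by (simp add: q1_def)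
    have "t powr \<beta> * Q t x \<le> t powr \<beta> * (Qsup q1 * t powr (- (d * r / q1)))"
      using t by (intro mult_left_mono Q_le_Qsup q1) auto
    also have "\<dots> = Qsup q1 * t powr (\<beta> - d * r / q1)" using t by (simp add: powr_diff powr_minus_divide)
    also have "\<beta> - d * r / q1 = - (1 / (m - 1))" by (simp add: ex beta_eq diff_divide_distrib)
    also have "Qsup q1 * t powr (- (1 / (m - 1))) \<le> Qsup q1 * t powr 0"
      using t m_gt_1 by (intro mult_left_mono powr_mono Qsup_nonneg) auto
    also have "\<dots> \<le> max (Qsup q1) (Qsup q2)" using t by simp
    finally show "t powr \<beta> * Q t x \<le> max (Qsup q1) (Qsup q2)" .
  qed (use Qsup_nonneg in \<open>simp add: le_max_iff_disj\<close>)
qed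

text \<open>For small times the integral of \<open>Q powr p\<close> is bounded by a moment of the
  datum. For large times \<open>t powr (\<beta> * p)\<close> must be beaten by decay interpolated at
  \<open>q = p\<close>; the balance \<open>\<beta> * p \<le> d * (r - 1)\<close> is the condition
  \<open>p \<le> d * (m - 1)\<close>.\<close>

lemma increment_integral:
  "\<exists>B\<ge>0. (\<forall>t. 0 < t \<longrightarrow> t \<le> 1 \<longrightarrow> (\<integral>\<^sup>+x. ennreal ((t powr \<beta> * Q t x) powr p) \<partial>lborel) \<le> ennreal (B * t powr (\<beta> * p))) \<and>
    (\<forall>t. 1 \<le> t \<longrightarrow> (\<integral>\<^sup>+x. ennreal ((t powr \<beta> * Q t x) powr p) \<partial>lborel) \<le> ennreal B)"
proof -
  define B1 where "B1 = A (r * p) * e powr (r * p)"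
  define B2 where "B2 = (A p powr (r / p) * e powr r) powr (p - p / r) * (A p * e powr p)"
  have B: "B1 \<ge> 0" "B2 \<ge> 0" by (auto simp: B1_def B2_def A_def)
  have scale: "(\<integral>\<^sup>+x. ennreal ((t powr \<beta> * Q t x) powr p) \<partial>lborel) = ennreal (t powr (\<beta> * p)) * (\<integral>\<^sup>+x. ennreal (Q t x powr p) \<partial>lborel)" for t
    by (subst nn_integral_cmult[symmetric]) (auto simp: powr_mult powr_powr ennreal_mult)
  show ?thesis
  proof (intro exI[of _ "max B1 B2"] conjI allI impI)
    fix t :: real assume t: "0 < t" "t \<le> 1"
    have "(\<integral>\<^sup>+x. ennreal ((t powr \<beta> * Q t x) powr p) \<partial>lborel) \<le> ennreal (t powr (\<beta> * p)) * ennreal B1"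
      unfolding scale B1_def using t r by (intro mult_left_mono nn_integral_Q_powr) auto
    also have "\<dots> = ennreal (B1 * t powr (\<beta> * p))" using B by (simp add: ennreal_mult mult.commute)
    also have "\<dots> \<le> ennreal (max B1 B2 * t powr (\<beta> * p))" by (intro ennreal_leI mult_right_mono) auto
    finally show "(\<integral>\<^sup>+x. ennreal ((t powr \<beta> * Q t x) powr p) \<partial>lborel) \<le> ennreal (max B1 B2 * t powr (\<beta> * p))" .
  next
    fix t :: real assume t: "1 \<le> t"
    have pr: "p * r \<ge> p" using r by simp
    have "(\<integral>\<^sup>+x. ennreal ((t powr \<beta> * Q t x) powr p) \<partial>lborel) \<le>
       ennreal (t powr (\<beta> * p)) * ennreal (B2 * t powr (- (d * r * p / p - d)))"
      unfolding scale B2_def using t pr by (intro mult_left_mono nn_integral_Q_powr_decay) auto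
    also have "\<dots> = ennreal (B2 * t powr (\<beta> * p - d * (r - 1)))"
      using B r t by (simp add: ennreal_mult[symmetric] powr_add[symmetric] algebra_simps)
    also have "\<dots> \<le> ennreal (B2 * t powr 0)"
    proof (intro ennreal_leI mult_left_mono powr_mono B t)
      have "p * (r - 1) \<le> d * (m - 1) * (r - 1)" using qc r by (intro mult_right_mono) (auto simp: d_def)
      then have "\<beta> * p \<le> d * (r - 1)" using m_gt_1 by (simp add: beta_eq field_simps)
      then show "\<beta> * p - d * (r - 1) \<le> 0" by simp
    qed
    also have "\<dots> \<le> ennreal (max B1 B2)" using t by (intro ennreal_leI) simp
    finally show "(\<integral>\<^sup>+x. ennreal ((t powr \<beta> * Q t x) powr p) \<partial>lborel) \<le> ennreal (max B1 B2)" .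
  qed (use B in simp)
qed

text \<open>Both the uniform and the L^p bound tend to 0. The uniform bound is kept in the
  conclusion for the local L^1 estimate at the initial time.\<close>

lemma increment_small:
  assumes l: "l > 0"
  shows "eventually (\<lambda>t. (\<forall>x. t powr \<beta> * Q t x \<le> l) \<and> exp_modular p (\<lambda>x. t powr \<beta> * Q t x / l) \<le> 1) (at_right 0)"
proof -
  obtain B1 where B1: "\<forall>t x. 0 < t \<longrightarrow> t \<le> 1 \<longrightarrow> t powr \<beta> * Q t x \<le> B1 * t powr (\<beta> / 2)"
    using increment_sup by (elim exE conjE)
  obtain B2 where B2: "\<forall>t. 0 < t \<longrightarrow> t \<le> 1 \<longrightarrow> (\<integral>\<^sup>+x. ennreal ((t powr \<beta> * Q t x) powr p) \<partial>lborel) \<le> ennreal (B2 * t powr (\<beta> * p))"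
    using increment_integral by (elim exE conjE)
  note B1 = B1[rule_format] and B2 = B2[rule_format]
  have lim: "((\<lambda>t. B * t powr c) \<longlongrightarrow> 0) (at_right 0)" if "c > 0" for B c :: real
    using that by (intro tendsto_mult_right_zero) real_asymp
  have "eventually (\<lambda>t. B1 * t powr (\<beta> / 2) < l) (at_right 0)"
    using lim[of "\<beta> / 2" B1] beta l by (intro order_tendstoD(2)) auto
  moreover have "eventually (\<lambda>t. B2 * t powr (\<beta> * p) < l powr p / exp 1) (at_right 0)"
    using lim[of "\<beta> * p" B2] beta r l by (intro order_tendstoD(2)) auto
  moreover have "eventually (\<lambda>t::real. t \<in> {0<..<1}) (at_right 0)"
    by (rule eventually_at_right_real) simp
  ultimately show ?thesis
  proof eventually_elim
    case (elim t)
    then have t: "0 < t" "t \<le> 1" by auto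
    have le: "t powr \<beta> * Q t x \<le> l" for x using B1[OF t, of x] elim(1) by simp
    have "(\<integral>\<^sup>+x. ennreal ((t powr \<beta> * Q t x) powr p) \<partial>lebesgue) \<le> ennreal (l powr p / exp 1)"
      unfolding nn_integral_lebesgue_eq using elim(2) by (intro order_trans[OF B2[OF t]] ennreal_leI) auto
    then have "exp_modular p (\<lambda>x. t powr \<beta> * Q t x / l) \<le> 1"
      using le r l by (intro exp_young_modular_bounded measurable_completion) auto
    with le show ?case by simp
  qed
qed

lemma increment_bounded:
  "\<exists>l\<ge>e. \<forall>t>0. exp_modular p (\<lambda>x. t powr \<beta> * Q t x / l) \<le> 1"
proof -
  obtain B1 where B1: "B1 \<ge> 0" "\<forall>t x. 0 < t \<longrightarrow> t \<le> 1 \<longrightarrow> t powr \<beta> * Q t x \<le> B1 * t powr (\<beta> / 2)"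
    "\<forall>t x. 1 \<le> t \<longrightarrow> t powr \<beta> * Q t x \<le> B1" using increment_sup by (elim exE conjE)
  obtain B2 where B2: "B2 \<ge> 0" "\<forall>t. 0 < t \<longrightarrow> t \<le> 1 \<longrightarrow> (\<integral>\<^sup>+x. ennreal ((t powr \<beta> * Q t x) powr p) \<partial>lborel) \<le> ennreal (B2 * t powr (\<beta> * p))"
    "\<forall>t. 1 \<le> t \<longrightarrow> (\<integral>\<^sup>+x. ennreal ((t powr \<beta> * Q t x) powr p) \<partial>lborel) \<le> ennreal B2" using increment_integral by (elim exE conjE)
  note B1 = B1[rule_format] and B2 = B2[rule_format]
  \<comment> \<open>The three entries provide room for \<open>Q powr (1 / r)\<close> at the same
    level, for the uniform bound, and for the L^p bound in
    \<open>exp_young_modular_bounded\<close>.\<close>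
  define l where "l = Max {e, B1, (exp 1 * B2) powr (1 / p)}"
  have l: "l \<ge> e" "l \<ge> B1" "l \<ge> (exp 1 * B2) powr (1 / p)" unfolding l_def by (intro Max_ge; simp)+
  have "((exp 1 * B2) powr (1 / p)) powr p \<le> l powr p" using l r by (intro powr_mono2) auto
  then have lB: "B2 \<le> l powr p / exp 1" using r B2(1) by (simp add: powr_powr field_simps)
  show ?thesis
  proof (intro exI[of _ l] conjI allI impI l(1))
    fix t :: real assume t: "0 < t"
    have pw: "t powr c \<le> 1" if "t \<le> 1" "c \<ge> 0" for c using t that by (simp add: powr_le1)
    have s: "t powr \<beta> * Q t x \<le> l" for x
    proof (cases "t \<le> 1")
      case True
      then have "B1 * t powr (\<beta> / 2) \<le> B1 * 1" using B1 beta by (intro mult_left_mono pw) auto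
      then show ?thesis using B1(2)[OF t True, of x] l by simp
    next
      case False
      then show ?thesis using B1(3)[of t x] l by simp
    qed
    have "(\<integral>\<^sup>+x. ennreal ((t powr \<beta> * Q t x) powr p) \<partial>lborel) \<le> ennreal B2"
    proof (cases "t \<le> 1")
      case True
      then have "B2 * t powr (\<beta> * p) \<le> B2 * 1" using B2 beta r by (intro mult_left_mono pw) auto
      then have "ennreal (B2 * t powr (\<beta> * p)) \<le> ennreal B2" by (intro ennreal_leI) simp
      then show ?thesis by (rule order_trans[OF B2(2)[OF t True]])
    qed (use B2(3)[of t] in simp)
    also have "\<dots> \<le> ennreal (l powr p / exp 1)" by (intro ennreal_leI lB)
    finally show "exp_modular p (\<lambda>x. t powr \<beta> * Q t x / l) \<le> 1"
      using s r l e by (intro exp_young_modular_bounded measurable_completion) (auto simp: nn_integral_lebesgue_eq)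
  qed
qed

lemma Q_root_modular:
  assumes "t > 0" "l \<ge> c * e" "l > 0" "c \<ge> 0"
  shows "exp_modular p (\<lambda>x. c * Q t x powr (1 / r) / l) \<le> 1"
proof -
  have "exp_modular p (\<lambda>x. c * Q t x powr (1 / r) / l) \<le>
     exp_modular p (\<lambda>x. Q t x powr (1 / r) / e)"
  proof (intro nn_integral_mono ennreal_leI exp_young_mono)
    fix x
    have "c * e * Q t x powr (1 / r) \<le> l * Q t x powr (1 / r)" using assms by (intro mult_right_mono) auto
    then show "c * Q t x powr (1 / r) / l \<le> Q t x powr (1 / r) / e" using assms e by (simp add: field_simps)
  qed (use r assms in auto)
  also have "\<dots> \<le> 1" unfolding nn_integral_lebesgue_eq by (rule Q_modular[OF assms(1)])
  finally show ?thesis .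
qed

lemma u_lebesgue_measurable: "u t \<in> borel_measurable lebesgue"
  by (rule measurable_completion) simp

lemma u_modular:
  "\<exists>l\<ge>e. \<forall>t>0. exp_modular p (\<lambda>x. \<bar>u t x\<bar> / (2 * l)) \<le> 1"
proof -
  obtain l where l: "l \<ge> e" "\<forall>t>0. exp_modular p (\<lambda>x. t powr \<beta> * Q t x / l) \<le> 1"
    using increment_bounded by (elim exE conjE)
  show ?thesis
  proof (intro exI[of _ l] conjI allI impI l(1))
    fix t :: real assume t: "t > 0"
    show "exp_modular p (\<lambda>x. \<bar>u t x\<bar> / (2 * l)) \<le> 1"
    proof (rule exp_young_modular_add[where ?w1.0 = "\<lambda>x. Q t x powr (1 / r)" and ?w2.0 = "\<lambda>x. t powr \<beta> * Q t x"])
      show "exp_modular p (\<lambda>x. Q t x powr (1 / r) / l) \<le> 1"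
        using Q_root_modular[OF t, of 1 l] l e by simp
      show "AE x in lebesgue. \<bar>u t x\<bar> \<le> Q t x powr (1 / r) + t powr \<beta> * Q t x"
        using u_le_W[OF t] by (simp add: W_def)
      show "exp_modular p (\<lambda>x. t powr \<beta> * Q t x / l) \<le> 1"
        using l(2) t by simp
      show "(\<lambda>x. Q t x powr (1 / r)) \<in> borel_measurable lebesgue" "(\<lambda>x. t powr \<beta> * Q t x) \<in> borel_measurable lebesgue"
        by (rule measurable_completion, simp)+
    qed (use r l(1) e in auto)
  qed
qed

lemma u_minus_heat_tendsto:
  "((\<lambda>t. expL_norm p (\<lambda>x. u t x - heat t v0 x)) \<longlongrightarrow> 0) (at_right 0)"
proof (rule tendstoI)
  fix \<epsilon> :: real assume \<epsilon>: "\<epsilon> > 0"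
  have "eventually (\<lambda>t::real. t > 0) (at_right 0)" by (simp add: eventually_at_right_less)
  with increment_small[of "\<epsilon> / 2"] \<epsilon> have "eventually (\<lambda>t. t > 0 \<and> exp_modular p (\<lambda>x. t powr \<beta> * Q t x / (\<epsilon> / 2)) \<le> 1) (at_right 0)"
    by (simp add: eventually_conj_iff)
  then show "eventually (\<lambda>t. dist (expL_norm p (\<lambda>x. u t x - heat t v0 x)) 0 < \<epsilon>) (at_right 0)"
  proof eventually_elim
    case (elim t)
    have m: "(\<lambda>x. u t x - heat t v0 x) \<in> borel_measurable lebesgue" by (rule measurable_completion) simp
    have "exp_modular p (\<lambda>x. \<bar>u t x - heat t v0 x\<bar> / (\<epsilon> / 2)) \<le>
       exp_modular p (\<lambda>x. t powr \<beta> * Q t x / (\<epsilon> / 2))"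
      using elim r \<epsilon> by (intro nn_integral_mono ennreal_leI exp_young_mono divide_right_mono u_diff_heat) auto
    also have "\<dots> \<le> 1" using elim by simp
    finally have "exp_modular p (\<lambda>x. \<bar>u t x - heat t v0 x\<bar> / (\<epsilon> / 2)) \<le> 1" .
    from expL_norm_le[OF _ _ m this] show ?case using r \<epsilon> by simp
  qed
qed

text \<open>Interpolation at \<open>q = d * (m - 1)\<close> gives the a-th powers of both terms of
  \<open>W\<close> the same rate \<open>t powr (d - a / (m - 1))\<close>, because
  \<open>\<beta> - r / (m - 1) = - 1 / (m - 1)\<close>.\<close>

lemma u_decay:
  assumes a: "a > d * (m - 1)"
  shows "\<exists>C>0. \<forall>t>0. u t \<in> Lp_space a \<and> Lp_norm a (u t) \<le> C * t powr (- (1 / (m - 1) - d / a))"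
proof -
  define q where "q = d * (m - 1)"
  have q: "q \<ge> p" "q > 0" "a > q" using qc a r d_pos by (auto simp: q_def d_def)
  have ar: "a * r \<ge> q"
  proof -
    have "a * 1 \<le> a * r" using q r by (intro mult_left_mono) auto
    then have "a \<le> a * r" by (simp only: mult_1_right)
    then show ?thesis using q by linarith
  qed
  have dq: "d / q = 1 / (m - 1)" using d_pos by (simp add: q_def)
  define B where "B c = (A q powr (r / q) * e powr r) powr (c - q / r) * (A q * e powr q)" for c
  have B: "B c \<ge> 0" for c by (simp add: B_def A_def)
  define D where "D = 2 powr a * (B (a / r) + B a) + 1"
  have D: "D > 0" using B by (simp add: D_def add_nonneg_pos)
  have bound: "(\<integral>\<^sup>+x. ennreal (\<bar>u t x\<bar> powr a) \<partial>lborel) \<le> ennreal (D * t powr (d - a / (m - 1)))" if t: "t > 0" for t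
  proof -
    have "(\<integral>\<^sup>+x. ennreal (\<bar>u t x\<bar> powr a) \<partial>lborel) \<le>
      (\<integral>\<^sup>+x. ennreal (2 powr a) * (ennreal (Q t x powr (a / r)) + ennreal (t powr (\<beta> * a)) * ennreal (Q t x powr a)) \<partial>lborel)"
    proof (rule nn_integral_mono)
      fix x
      have "\<bar>u t x\<bar> powr a \<le> W t x powr a" using u_le_W[OF t] q by (intro powr_mono2) auto
      also have "\<dots> \<le> 2 powr a * ((Q t x powr (1 / r)) powr a + (t powr \<beta> * Q t x) powr a)"
        unfolding W_def using q by (intro powr_add_le) auto
      also have "\<dots> = 2 powr a * (Q t x powr (a / r) + t powr (\<beta> * a) * Q t x powr a)"
        by (simp add: powr_powr powr_mult)
      finally have "ennreal (\<bar>u t x\<bar> powr a) \<le> ennreal (2 powr a * (Q t x powr (a / r) + t powr (\<beta> * a) * Q t x powr a))"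
        by (rule ennreal_leI)
      then show "ennreal (\<bar>u t x\<bar> powr a) \<le> ennreal (2 powr a) * (ennreal (Q t x powr (a / r)) + ennreal (t powr (\<beta> * a)) * ennreal (Q t x powr a))"
        by (simp add: ennreal_mult)
    qed
    also have "\<dots> = ennreal (2 powr a) * ((\<integral>\<^sup>+x. ennreal (Q t x powr (a / r)) \<partial>lborel) + ennreal (t powr (\<beta> * a)) * (\<integral>\<^sup>+x. ennreal (Q t x powr a) \<partial>lborel))"
      by (simp add: nn_integral_cmult nn_integral_add)
    also have "\<dots> \<le> ennreal (2 powr a) * (ennreal (B (a / r) * t powr (- (d * r * (a / r) / q - d))) +
        ennreal (t powr (\<beta> * a)) * ennreal (B a * t powr (- (d * r * a / q - d))))"
      unfolding B_def using q r ar by (intro mult_left_mono add_mono nn_integral_Q_powr_decay t) auto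
    also have "\<dots> = ennreal (2 powr a * (B (a / r) * t powr (- (d * r * (a / r) / q - d)) + t powr (\<beta> * a) * (B a * t powr (- (d * r * a / q - d)))))"
      using B by (simp add: ennreal_mult)
    also have "- (d * r * (a / r) / q - d) = d - a / (m - 1)"
    proof -
      have "d * r * (a / r) / q = d / q * a" using r by simp
      then show ?thesis unfolding dq by simp
    qed
    also have "t powr (\<beta> * a) * (B a * t powr (- (d * r * a / q - d))) = B a * t powr (d - a / (m - 1))"
    proof -
      have "d * r * a / q = d / q * (r * a)" by simp
      also have "\<dots> = r * a / (m - 1)" unfolding dq by simp
      finally have ex: "\<beta> * a + (- (d * r * a / q - d)) = d - a / (m - 1)"
        using m_gt_1 by (simp add: beta_eq field_simps)
      have "t powr (\<beta> * a) * (B a * t powr (- (d * r * a / q - d))) = B a * t powr (\<beta> * a + (- (d * r * a / q - d)))"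
        by (simp only: powr_add mult_ac)
      then show ?thesis unfolding ex .
    qed
    also have "ennreal (2 powr a * (B (a / r) * t powr (d - a / (m - 1)) + B a * t powr (d - a / (m - 1)))) \<le> ennreal (D * t powr (d - a / (m - 1)))"
      by (intro ennreal_leI) (simp add: D_def distrib_right distrib_left mult.assoc)
    finally show ?thesis .
  qed
  show ?thesis
  proof (intro exI[of _ "D powr (1 / a)"] conjI allI impI)
    fix t :: real assume t: "t > 0"
    have i: "integrable lborel (\<lambda>x. \<bar>u t x\<bar> powr a)"
      by (rule integrableI_bounded) (use order_le_less_trans[OF bound[OF t]] in auto)
    then show "u t \<in> Lp_space a"
      unfolding Lp_space_def using u_lebesgue_measurable by (auto simp: integrable_completion)
    have "ennreal (\<integral>x. \<bar>u t x\<bar> powr a \<partial>lborel) \<le> ennreal (D * t powr (d - a / (m - 1)))"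
      using bound[OF t] i by (subst nn_integral_eq_integral[symmetric]) auto
    then have "(\<integral>x. \<bar>u t x\<bar> powr a \<partial>lborel) \<le> D * t powr (d - a / (m - 1))"
      using D by (subst (asm) ennreal_le_iff) auto
    then have "(\<integral>x. \<bar>u t x\<bar> powr a \<partial>lborel) powr (1 / a) \<le> (D * t powr (d - a / (m - 1))) powr (1 / a)"
      using q by (intro powr_mono2) (auto simp: integral_nonneg_AE)
    also have "\<dots> = D powr (1 / a) * t powr (- (1 / (m - 1) - d / a))"
    proof -
      have "(d - a / (m - 1)) * (1 / a) = - (1 / (m - 1) - d / a)" using q by (simp add: field_simps)
      then show ?thesis using powr_powr[of t "d - a / (m - 1)" "1 / a"] by (simp add: powr_mult)
    qed
    finally show "Lp_norm a (u t) \<le> D powr (1 / a) * t powr (- (1 / (m - 1) - d / a))"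
      unfolding Lp_norm_def by (subst integral_completion) auto
  qed (use D in simp)
qed

end

context heat_solution
begin

lemma u_in_expL:
  assumes "t > 0"
  shows "u t \<in> expL p"
proof -
  obtain l where l: "l \<ge> e" "\<forall>t>0. exp_modular p (\<lambda>x. \<bar>u t x\<bar> / (2 * l)) \<le> 1"
    using u_modular by (elim exE conjE)
  show ?thesis
    by (rule expL_norm_le(1)[where l = "2 * l"]) (use l e r assms u_lebesgue_measurable in auto)
qed

lemma u_norm_bounded: "\<exists>M. \<forall>t>0. expL_norm p (u t) \<le> M"
proof -
  obtain l where l: "l \<ge> e" "\<forall>t>0. exp_modular p (\<lambda>x. \<bar>u t x\<bar> / (2 * l)) \<le> 1"
    using u_modular by (elim exE conjE)
  have "expL_norm p (u t) \<le> 2 * l" if "t > 0" for t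
    by (rule expL_norm_le(2)) (use l e r that u_lebesgue_measurable in auto)
  then show ?thesis by blast
qed

subsection \<open>Initial value\<close>

text \<open>Split \<open>u - v0\<close> into the Duhamel part, uniformly small by
  \<open>increment_small\<close>, and \<open>heat t v0 - v0\<close>, which tends to 0 in L^1 on
  balls. With the modular bound for \<open>u\<close> and \<open>v0\<close> this is the situation of
  \<open>weak_star_null\<close>.\<close>

lemma u_weak_star:
  assumes g: "g \<in> orlicz_space (complementary_fun (exp_young p))"
  shows "((\<lambda>t. \<integral>x. u t x * g x \<partial>lebesgue) \<longlongrightarrow> (\<integral>x. v0 x * g x \<partial>lebesgue)) (at_right 0)"
proof (rule tendstoI)
  fix \<epsilon> :: real assume \<epsilon>: "\<epsilon> > 0"
  have p1: "p > 1" using r by simp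
  obtain l where l: "l \<ge> e" "\<forall>t>0. exp_modular p (\<lambda>x. \<bar>u t x\<bar> / (2 * l)) \<le> 1"
    using u_modular by (elim exE conjE)
  have l0: "l > 0" using l e by simp
  have v0_leb: "v0 \<in> borel_measurable lebesgue" by (rule measurable_completion) simp
  have v0_mod_e: "exp_modular p (\<lambda>x. \<bar>v0 x\<bar> / e) \<le> 1"
    using modular by (simp add: nn_integral_lebesgue_eq phi_eq)
  have v0_mod: "exp_modular p (\<lambda>x. \<bar>v0 x\<bar> / (2 * l)) \<le> 1"
    by (rule order_trans[OF nn_integral_mono v0_mod_e])
       (use l e r in \<open>auto intro!: ennreal_leI exp_young_mono divide_left_mono\<close>)
  have v0_in: "v0 \<in> expL p" by (rule expL_norm_le(1)[OF _ _ v0_leb v0_mod_e]) (use r e in auto)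
  let ?v = "\<lambda>t x. u t x - v0 x"
  have ev: "eventually (\<lambda>t::real. t > 0) (at_right 0)" by (simp add: eventually_at_right_less)
  have bounded: "eventually (\<lambda>t. ?v t \<in> borel_measurable lebesgue \<and>
       exp_modular p (\<lambda>x. \<bar>?v t x\<bar> / (2 * (2 * l))) \<le> 1) (at_right 0)"
    using ev
  proof eventually_elim
    case (elim t)
    have [measurable]: "u t \<in> borel_measurable lebesgue" "v0 \<in> borel_measurable lebesgue"
      using u_lebesgue_measurable v0_leb by auto
    have "exp_modular p (\<lambda>x. \<bar>?v t x\<bar> / (2 * (2 * l))) \<le> 1"
    proof (rule exp_young_modular_add[where ?w1.0 = "\<lambda>x. \<bar>u t x\<bar>" and ?w2.0 = "\<lambda>x. \<bar>v0 x\<bar>"])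
      show "exp_modular p (\<lambda>x. \<bar>u t x\<bar> / (2 * l)) \<le> 1" using l(2) elim by simp
    qed (use v0_mod l0 r in auto)
    then show ?case by simp
  qed
  have loc: "eventually (\<lambda>t. (\<integral>\<^sup>+x. indicator (cball 0 R) x * ennreal \<bar>?v t x\<bar> \<partial>lebesgue) \<le> ennreal \<eta>) (at_right 0)"
    if \<eta>: "\<eta> > 0" for R \<eta>
  proof -
    let ?B = "cball 0 R :: (real^'n) set"
    define b where "b = measure lborel ?B"
    have b: "b \<ge> 0" "emeasure lborel ?B = ennreal b"
      using emeasure_bounded_finite[of ?B] by (auto simp: b_def emeasure_eq_ennreal_measure less_top[symmetric])
    define k where "k = \<eta> / (2 * (b + 1))"
    have k: "k > 0" "k * b \<le> \<eta> / 2" using \<eta> b by (auto simp: k_def field_simps)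
    have [measurable]: "?B \<in> sets borel" by simp
    have "eventually (\<lambda>t. (\<integral>\<^sup>+x. indicator ?B x * ennreal \<bar>heat t v0 x - v0 x\<bar> \<partial>lborel) \<le> ennreal (\<eta> / 2)) (at_right 0)"
      using order_le_less_trans[OF moment[of p]] r \<eta>
      by (intro heat_tendsto_local_L1[where p = p]) (auto simp: phi_eq)
    with increment_small[OF k(1)] ev show ?thesis
    proof eventually_elim
      case (elim t)
      have "(\<integral>\<^sup>+x. indicator ?B x * ennreal \<bar>?v t x\<bar> \<partial>lborel) \<le>
        (\<integral>\<^sup>+x. ennreal k * indicator ?B x + indicator ?B x * ennreal \<bar>heat t v0 x - v0 x\<bar> \<partial>lborel)"
      proof (rule nn_integral_mono)
        fix x
        have "\<bar>?v t x\<bar> \<le> k + \<bar>heat t v0 x - v0 x\<bar>"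
          using u_diff_heat[OF \<open>t > 0\<close>, of x] elim(1) by (smt (verit))
        then have "ennreal \<bar>?v t x\<bar> \<le> ennreal k + ennreal \<bar>heat t v0 x - v0 x\<bar>"
          using k by (simp add: ennreal_plus[symmetric] ennreal_leI del: ennreal_plus)
        then show "indicator ?B x * ennreal \<bar>?v t x\<bar> \<le> ennreal k * indicator ?B x + indicator ?B x * ennreal \<bar>heat t v0 x - v0 x\<bar>"
          by (cases "x \<in> ?B") auto
      qed
      also have "\<dots> = ennreal k * ennreal b + (\<integral>\<^sup>+x. indicator ?B x * ennreal \<bar>heat t v0 x - v0 x\<bar> \<partial>lborel)"
        by (subst nn_integral_add) (auto simp: nn_integral_cmult_indicator b)
      also have "\<dots> \<le> ennreal (\<eta> / 2) + ennreal (\<eta> / 2)"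
        using k b by (intro add_mono elim(3)) (simp add: ennreal_mult[symmetric] ennreal_leI)
      also have "\<dots> = ennreal \<eta>" using \<eta> by (simp add: ennreal_plus[symmetric] del: ennreal_plus)
      finally show ?case unfolding nn_integral_lebesgue_eq .
    qed
  qed
  have "eventually (\<lambda>t. (\<integral>\<^sup>+x. ennreal (\<bar>?v t x\<bar> * \<bar>g x\<bar>) \<partial>lebesgue) \<le> ennreal (\<epsilon> / 2)) (at_right 0)"
    by (rule weak_star_null[OF p1 g _ _ bounded loc]) (use \<epsilon> l0 in auto)
  with ev show "eventually (\<lambda>t. dist (\<integral>x. u t x * g x \<partial>lebesgue) (\<integral>x. v0 x * g x \<partial>lebesgue) < \<epsilon>) (at_right 0)"
  proof eventually_elim
    case (elim t)
    have i1: "integrable lebesgue (\<lambda>x. u t x * g x)" and i2: "integrable lebesgue (\<lambda>x. v0 x * g x)"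
      using orlicz_pairing_integrable[OF p1] u_in_expL[OF elim(1)] v0_in g by auto
    have "ennreal (norm (\<integral>x. u t x * g x - v0 x * g x \<partial>lebesgue)) \<le> (\<integral>\<^sup>+x. ennreal (norm (u t x * g x - v0 x * g x)) \<partial>lebesgue)"
      by (rule integral_norm_bound_ennreal) (use i1 i2 in simp)
    also have "\<dots> = (\<integral>\<^sup>+x. ennreal (\<bar>?v t x\<bar> * \<bar>g x\<bar>) \<partial>lebesgue)"
      by (simp add: left_diff_distrib[symmetric] abs_mult)
    also have "\<dots> \<le> ennreal (\<epsilon> / 2)" by (rule elim)
    finally have "\<bar>(\<integral>x. u t x * g x \<partial>lebesgue) - (\<integral>x. v0 x * g x \<partial>lebesgue)\<bar> \<le> \<epsilon> / 2"
      using i1 i2 \<epsilon> by (simp add: Bochner_Integration.integral_diff)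
    then show ?case using \<epsilon> by (simp add: dist_real_def)
  qed
qed

subsection \<open>Continuity in time\<close>

text \<open>The constant of \<open>heat_kernel_time_diff\<close>.\<close>

definition kappa :: real where "kappa = (2 + d) * 2 powr d"

lemma kappa_nonneg: "0 \<le> kappa" using d_pos by (simp add: kappa_def)

lemma heat_time_diff:
  fixes h :: "real^'n \<Rightarrow> real"
  assumes ab: "0 < a" "a \<le> b" and [measurable]: "h \<in> borel_measurable borel"
    and int: "\<And>s. s > 0 \<Longrightarrow> integrable lborel (\<lambda>y. heat_kernel s (x - y) * h y)"
  shows "\<bar>heat b h x - heat a h x\<bar> \<le> kappa * ((b - a) / a) * (b / a) powr d *
    (\<integral>y. \<bar>heat_kernel (2 * b) (x - y) * h y\<bar> \<partial>lborel)"
proof -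
  let ?c = "kappa * ((b - a) / a) * (b / a) powr d"
  have "\<bar>heat b h x - heat a h x\<bar> = \<bar>\<integral>y. heat_kernel b (x - y) * h y - heat_kernel a (x - y) * h y \<partial>lborel\<bar>"
    using int[of a] int[of b] ab by (simp add: heat_eq_lborel Bochner_Integration.integral_diff)
  also have "\<dots> \<le> (\<integral>y. ?c * \<bar>heat_kernel (2 * b) (x - y) * h y\<bar> \<partial>lborel)"
  proof (rule order_trans[OF integral_abs_bound], rule integral_mono)
    fix y
    have "\<bar>heat_kernel b (x - y) - heat_kernel a (x - y)\<bar> * \<bar>h y\<bar> \<le> ?c * heat_kernel (2 * b) (x - y) * \<bar>h y\<bar>"
      using heat_kernel_time_diff[OF ab, of "x - y"] unfolding kappa_def d_def by (intro mult_right_mono) auto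
    then show "\<bar>heat_kernel b (x - y) * h y - heat_kernel a (x - y) * h y\<bar> \<le> ?c * \<bar>heat_kernel (2 * b) (x - y) * h y\<bar>"
      by (simp add: left_diff_distrib[symmetric] abs_mult mult.assoc)
  qed (use int[of a] int[of b] int[of "2 * b"] ab in auto)
  finally show ?thesis by simp
qed

lemma free_part_continuity:
  assumes "0 < a" "a \<le> b"
  shows "\<bar>heat b v0 x - heat a v0 x\<bar> \<le> kappa * ((b - a) / a) * (b / a) powr d * Q (2 * b) x powr (1 / r)"
proof -
  have le: "\<bar>v0 y\<bar> \<le> \<phi> y" for y by (simp add: phi_eq)
  have "\<bar>heat b v0 x - heat a v0 x\<bar> \<le> kappa * ((b - a) / a) * (b / a) powr d *
     (\<integral>y. \<bar>heat_kernel (2 * b) (x - y) * v0 y\<bar> \<partial>lborel)"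
    using assms le by (intro heat_time_diff heat_le_Q(1)) auto
  also have "\<dots> \<le> kappa * ((b - a) / a) * (b / a) powr d * Q (2 * b) x powr (1 / r)"
    using assms le kappa_nonneg by (intro mult_left_mono heat_le_Q(2)) auto
  finally show ?thesis .
qed

text \<open>Weight controlling the integrand of \<open>Duhamel(T) - Duhamel(\<tau>)\<close> at time \<open>s\<close>: close to
  \<open>\<tau>\<close> only the trivial bound is available.\<close>

definition weight :: "real \<Rightarrow> real \<Rightarrow> real \<Rightarrow> real" where
  "weight T \<tau> s = (if s < \<tau>
     then min (2 powr d + 4 powr d) (kappa * ((T - \<tau>) / (\<tau> - s)) * ((T - s) / (\<tau> - s)) powr d * 2 powr d)
     else 2 powr d + 4 powr d)"

lemma weight_bounds: "\<tau> \<le> T \<Longrightarrow> 0 \<le> weight T \<tau> s" "weight T \<tau> s \<le> 2 powr d + 4 powr d"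
  using kappa_nonneg by (auto simp: weight_def)

text \<open>The times \<open>T\<close>, \<open>\<tau>\<close> and \<open>2 T - s\<close> lie between
  \<open>T / 2\<close> and \<open>2 T\<close>. So \<open>Q_time_mono\<close> moves every bound to
  the single profile \<open>Q (2 * T)\<close>, which depends neither on \<open>s\<close> nor on
  \<open>\<tau>\<close>, and the time integral decouples from space.\<close>

lemma duhamel_integrand_diff:
  assumes \<tau>: "T / 2 \<le> \<tau>" "\<tau> \<le> T" and s: "0 < s" "s < T"
  shows "\<bar>heat (T - s) (force s) x - indicator {0<..<\<tau>} s * heat (\<tau> - s) (force s) x\<bar>
    \<le> weight T \<tau> s * (\<beta> * s powr (\<beta> - 1)) * Q (2 * T) x"
proof -
  have T: "T > 0" using s by simp
  have \<tau>0: "\<tau> > 0" using \<tau> T by simp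
  define k where "k = \<beta> * s powr (\<beta> - 1)"
  have k: "k \<ge> 0" using beta by (simp add: k_def)
  have QT: "Q T x \<le> 2 powr d * Q (2 * T) x" using Q_time_mono[of T "2 * T" x] T by simp
  have Q\<tau>: "Q \<tau> x \<le> 4 powr d * Q (2 * T) x"
  proof -
    have "Q \<tau> x \<le> (2 * T / \<tau>) powr d * Q (2 * T) x" using \<tau> \<tau>0 by (intro Q_time_mono) auto
    also have "\<dots> \<le> 4 powr d * Q (2 * T) x"
      using \<tau> \<tau>0 d_pos by (intro mult_right_mono powr_mono2) (auto simp: field_simps)
    finally show ?thesis .
  qed
  have hT: "\<bar>heat (T - s) (force s) x\<bar> \<le> k * (2 powr d * Q (2 * T) x)"
    using force_kernel(3)[OF s(1), of "T - s" x] mult_left_mono[OF QT k] s by (simp add: k_def)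
  have h\<tau>: "\<bar>indicator {0<..<\<tau>} s * heat (\<tau> - s) (force s) x\<bar> \<le> k * (4 powr d * Q (2 * T) x)"
  proof (cases "s < \<tau>")
    case True
    then show ?thesis using force_kernel(3)[OF s(1), of "\<tau> - s" x] mult_left_mono[OF Q\<tau> k] s by (simp add: k_def)
  qed (use k in simp)
  have triv: "\<bar>heat (T - s) (force s) x - indicator {0<..<\<tau>} s * heat (\<tau> - s) (force s) x\<bar>
    \<le> (2 powr d + 4 powr d) * k * Q (2 * T) x"
    using hT h\<tau> by (simp add: algebra_simps)
  show ?thesis
  proof (cases "s < \<tau>")
    case True
    let ?c = "kappa * ((T - \<tau>) / (\<tau> - s)) * ((T - s) / (\<tau> - s)) powr d"
    have c: "?c \<ge> 0" using True \<tau> kappa_nonneg by simp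
    have "\<bar>heat (T - s) (force s) x - heat (\<tau> - s) (force s) x\<bar> \<le>
      kappa * ((T - s - (\<tau> - s)) / (\<tau> - s)) * ((T - s) / (\<tau> - s)) powr d *
        (\<integral>y. \<bar>heat_kernel (2 * (T - s)) (x - y) * force s y\<bar> \<partial>lborel)"
      using True \<tau> s by (intro heat_time_diff force_kernel(1)) auto
    also have "T - s - (\<tau> - s) = T - \<tau>" by simp
    also have "?c * (\<integral>y. \<bar>heat_kernel (2 * (T - s)) (x - y) * force s y\<bar> \<partial>lborel) \<le> ?c * (k * Q (2 * (T - s) + s) x)"
      using force_kernel(2)[OF s(1), of "2 * (T - s)" x] s c by (intro mult_left_mono) (auto simp: k_def)
    also have "\<dots> \<le> ?c * (k * (2 powr d * Q (2 * T) x))"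
    proof (intro mult_left_mono c k)
      have "Q (2 * (T - s) + s) x \<le> (2 * T / (2 * (T - s) + s)) powr d * Q (2 * T) x"
        using s by (intro Q_time_mono) auto
      also have "\<dots> \<le> 2 powr d * Q (2 * T) x"
        using s d_pos by (intro mult_right_mono powr_mono2) (auto simp: field_simps)
      finally show "Q (2 * (T - s) + s) x \<le> 2 powr d * Q (2 * T) x" .
    qed
    finally have diff: "\<bar>heat (T - s) (force s) x - heat (\<tau> - s) (force s) x\<bar> \<le> (?c * 2 powr d) * k * Q (2 * T) x"
      by (simp add: mult_ac)
    then show ?thesis using triv True s by (simp add: weight_def k_def min_def)
  next
    case False
    then show ?thesis using triv by (simp add: weight_def k_def)
  qed
qed

lemma duhamel_continuity:
  assumes \<tau>: "T / 2 \<le> \<tau>" "\<tau> \<le> T" and T: "T > 0"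
  shows "\<bar>u T x - u \<tau> x\<bar> \<le> kappa * ((T - \<tau>) / \<tau>) * (T / \<tau>) powr d * Q (2 * T) x powr (1 / r) +
    (\<integral>s. indicator {0<..<T} s * (weight T \<tau> s * (\<beta> * s powr (\<beta> - 1))) \<partial>lborel) * Q (2 * T) x"
proof -
  have \<tau>0: "\<tau> > 0" using \<tau> T by simp
  let ?V = "\<lambda>t s. indicator {0<..<t} s * heat (t - s) (force s) x"
  let ?w = "\<lambda>s. indicator {0<..<T} s * (weight T \<tau> s * (\<beta> * s powr (\<beta> - 1)))"
  have iw: "integrable lborel ?w"
  proof (rule Bochner_Integration.integrable_bound)
    show "integrable lborel (\<lambda>s. (2 powr d + 4 powr d) * (indicator {0<..<T} s * (\<beta> * s powr (\<beta> - 1))))"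
      using nn_integral_powr_interval[OF beta(1) T] beta
      by (intro integrable_mult_right integrableI_nonneg) auto
    show "AE s in lborel. norm (?w s) \<le> norm ((2 powr d + 4 powr d) * (indicator {0<..<T} s * (\<beta> * s powr (\<beta> - 1))))"
      using weight_bounds(1)[OF \<tau>(2)] weight_bounds(2) beta
      by (intro AE_I2) (auto simp: abs_mult indicator_def intro!: mult_right_mono)
  qed (unfold weight_def, measurable)
  have "u T x - u \<tau> x = (heat T v0 x - heat \<tau> v0 x) + ((\<integral>s. ?V T s \<partial>lborel) - (\<integral>s. ?V \<tau> s \<partial>lborel))"
    using duhamel_lborel(2)[OF T, of x] duhamel_lborel(2)[OF \<tau>0, of x] by simp
  moreover have "(\<integral>s. ?V T s \<partial>lborel) - (\<integral>s. ?V \<tau> s \<partial>lborel) = (\<integral>s. ?V T s - ?V \<tau> s \<partial>lborel)"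
    by (rule Bochner_Integration.integral_diff[symmetric]) (rule duhamel_lborel(1)[OF T] duhamel_lborel(1)[OF \<tau>0])+
  moreover have "\<bar>\<integral>s. ?V T s - ?V \<tau> s \<partial>lborel\<bar> \<le> (\<integral>s. ?w s * Q (2 * T) x \<partial>lborel)"
  proof (rule order_trans[OF integral_abs_bound], rule integral_mono)
    show "integrable lborel (\<lambda>s. \<bar>?V T s - ?V \<tau> s\<bar>)"
      using duhamel_lborel(1)[OF T, of x] duhamel_lborel(1)[OF \<tau>0, of x] by (intro integrable_abs Bochner_Integration.integrable_diff)
    show "integrable lborel (\<lambda>s. ?w s * Q (2 * T) x)" by (rule integrable_mult_left[OF iw])
    show "\<bar>?V T s - ?V \<tau> s\<bar> \<le> ?w s * Q (2 * T) x" for s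
    proof (cases "s \<in> {0<..<T}")
      case True
      then show ?thesis using duhamel_integrand_diff[OF \<tau>, of s x] by simp
    next
      case False
      then have "s \<notin> {0<..<\<tau>}" using \<tau> by auto
      with False show ?thesis by simp
    qed
  qed
  moreover have "(\<integral>s. ?w s * Q (2 * T) x \<partial>lborel) = (\<integral>s. ?w s \<partial>lborel) * Q (2 * T) x" by simp
  ultimately show ?thesis using free_part_continuity[OF \<tau>0 \<tau>(2), of x] by linarith
qed

text \<open>For fixed \<open>s < T\<close> the times \<open>\<tau> n\<close> eventually pass
  \<open>s\<close>, and the second entry of the minimum tends to 0. The constant cap supplies the
  integrable dominating function.\<close>

lemma weight_integral_tendsto:
  assumes T: "T > 0" and \<tau>: "\<tau> \<longlonglongrightarrow> T" "\<And>n. \<tau> n \<le> T"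
  shows "(\<lambda>n. \<integral>s. indicator {0<..<T} s * (weight T (\<tau> n) s * (\<beta> * s powr (\<beta> - 1))) \<partial>lborel) \<longlonglongrightarrow> 0"
proof -
  have "(\<lambda>n. \<integral>s. indicator {0<..<T} s * (weight T (\<tau> n) s * (\<beta> * s powr (\<beta> - 1))) \<partial>lborel) \<longlonglongrightarrow> (\<integral>s. 0 \<partial>(lborel :: real measure))"
  proof (rule integral_dominated_convergence[where w = "\<lambda>s. (2 powr d + 4 powr d) * (indicator {0<..<T} s * (\<beta> * s powr (\<beta> - 1)))"])
    show "integrable lborel (\<lambda>s. (2 powr d + 4 powr d) * (indicator {0<..<T} s * (\<beta> * s powr (\<beta> - 1))))"
      using nn_integral_powr_interval[OF beta(1) T] beta
      by (intro integrable_mult_right integrableI_nonneg) auto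
    show "AE s in lborel. norm (indicator {0<..<T} s * (weight T (\<tau> n) s * (\<beta> * s powr (\<beta> - 1)))) \<le>
        (2 powr d + 4 powr d) * (indicator {0<..<T} s * (\<beta> * s powr (\<beta> - 1)))" for n
      using weight_bounds(1)[OF \<tau>(2)] weight_bounds(2) beta
      by (intro AE_I2) (auto simp: abs_mult indicator_def intro!: mult_right_mono)
    show "AE s in lborel. (\<lambda>n. indicator {0<..<T} s * (weight T (\<tau> n) s * (\<beta> * s powr (\<beta> - 1)))) \<longlonglongrightarrow> 0"
    proof (rule AE_I2)
      fix s :: real
      show "(\<lambda>n. indicator {0<..<T} s * (weight T (\<tau> n) s * (\<beta> * s powr (\<beta> - 1)))) \<longlonglongrightarrow> 0"
      proof (cases "s \<in> {0<..<T}")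
        case True
        then have s: "s < T" by simp
        have "(\<lambda>n. kappa * ((T - \<tau> n) / (\<tau> n - s)) * ((T - s) / (\<tau> n - s)) powr d * 2 powr d)
            \<longlonglongrightarrow> kappa * ((T - T) / (T - s)) * ((T - s) / (T - s)) powr d * 2 powr d"
          using s by (intro tendsto_intros \<tau>) auto
        then have lim: "(\<lambda>n. kappa * ((T - \<tau> n) / (\<tau> n - s)) * ((T - s) / (\<tau> n - s)) powr d * 2 powr d) \<longlonglongrightarrow> 0" by simp
        have ev: "eventually (\<lambda>n. s < \<tau> n) sequentially" using order_tendstoD(1)[OF \<tau>(1) s] .
        have "(\<lambda>n. weight T (\<tau> n) s) \<longlonglongrightarrow> 0"
        proof (rule tendsto_sandwich[OF _ _ tendsto_const lim])
          show "eventually (\<lambda>n. 0 \<le> weight T (\<tau> n) s) sequentially" using weight_bounds(1)[OF \<tau>(2)] by simp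
          show "eventually (\<lambda>n. weight T (\<tau> n) s \<le> kappa * ((T - \<tau> n) / (\<tau> n - s)) * ((T - s) / (\<tau> n - s)) powr d * 2 powr d) sequentially"
            using ev by eventually_elim (simp add: weight_def)
        qed
        then show ?thesis using True by (auto intro!: tendsto_eq_intros)
      qed simp
    qed
  qed (unfold weight_def, measurable)
  then show ?thesis by simp
qed

lemma Q_modular_small:
  assumes t: "t > 0" and c: "c \<longlonglongrightarrow> 0" "\<And>n. 0 \<le> c n" and l: "l > 0"
  shows "eventually (\<lambda>n. exp_modular p (\<lambda>x. c n * Q t x / l) \<le> 1) sequentially"
proof -
  define M1 where "M1 = Qsup p * t powr (- (d * r / p))"
  define M2 where "M2 = A (r * p) * e powr (r * p)"
  have M: "M1 \<ge> 0" "M2 \<ge> 0" by (auto simp: M1_def M2_def Qsup_nonneg A_def)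
  have "(\<lambda>n. c n * M1) \<longlonglongrightarrow> 0" using c(1) by (rule tendsto_mult_left_zero)
  then have "eventually (\<lambda>n. c n * M1 < l) sequentially" using l by (intro order_tendstoD(2)) auto
  moreover have "(\<lambda>n. c n powr p * M2) \<longlonglongrightarrow> 0 powr p * M2"
    using c r by (intro tendsto_intros tendsto_powr') auto
  then have "eventually (\<lambda>n. c n powr p * M2 < l powr p / exp 1) sequentially" using l r by (intro order_tendstoD(2)) auto
  ultimately show ?thesis
  proof eventually_elim
    case (elim n)
    show ?case
    proof (rule exp_young_modular_bounded)
      show "(\<lambda>x. c n * Q t x) \<in> borel_measurable lebesgue" by (rule measurable_completion) simp
      show "c n * Q t x \<le> l" for x
        using mult_left_mono[OF Q_le_Qsup[OF t order_refl, of x] c(2)[of n]] elim(1) by (simp add: M1_def)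
      have "(\<integral>\<^sup>+x. ennreal ((c n * Q t x) powr p) \<partial>lebesgue) = ennreal (c n powr p) * (\<integral>\<^sup>+x. ennreal (Q t x powr p) \<partial>lborel)"
        unfolding nn_integral_lebesgue_eq using c(2)
        by (subst nn_integral_cmult[symmetric]) (auto simp: powr_mult ennreal_mult)
      also have "\<dots> \<le> ennreal (c n powr p) * ennreal M2"
        unfolding M2_def using r t by (intro mult_left_mono nn_integral_Q_powr) auto
      also have "\<dots> \<le> ennreal (l powr p / exp 1)" using elim(2) M by (simp add: ennreal_mult[symmetric] ennreal_leI)
      finally show "(\<integral>\<^sup>+x. ennreal ((c n * Q t x) powr p) \<partial>lebesgue) \<le> ennreal (l powr p / exp 1)" .
    qed (use r l c in auto)
  qed
qed

lemma u_continuous: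
  assumes T: "T > 0" and \<tau>: "\<tau> \<longlonglongrightarrow> T" "\<And>n. \<tau> n \<le> T"
  shows "(\<lambda>n. expL_norm p (\<lambda>x. u (\<tau> n) x - u T x)) \<longlonglongrightarrow> 0"
proof (rule tendstoI)
  fix \<epsilon> :: real assume \<epsilon>: "\<epsilon> > 0"
  \<comment> \<open>Adding the two parts doubles the level, and
    \<open>2 * l = \<epsilon> / 2\<close> leaves room for the strict inequality.\<close>
  define l where "l = \<epsilon> / 4"
  have l: "l > 0" using \<epsilon> by (simp add: l_def)
  define c1 where "c1 n = kappa * ((T - \<tau> n) / \<tau> n) * (T / \<tau> n) powr d" for n
  define c2 where "c2 n = (\<integral>s. indicator {0<..<T} s * (weight T (\<tau> n) s * (\<beta> * s powr (\<beta> - 1))) \<partial>lborel)" for n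
  have "(\<lambda>n. c1 n * e) \<longlonglongrightarrow> kappa * ((T - T) / T) * (T / T) powr d * e"
    unfolding c1_def using T by (intro tendsto_intros \<tau>) auto
  then have c1: "(\<lambda>n. c1 n * e) \<longlonglongrightarrow> 0" by simp
  have c2: "c2 \<longlonglongrightarrow> 0" unfolding c2_def by (rule weight_integral_tendsto[OF T \<tau>])
  have c2n: "0 \<le> c2 n" for n
    unfolding c2_def using weight_bounds(1)[OF \<tau>(2)] beta by (intro integral_nonneg_AE AE_I2) auto
  have "eventually (\<lambda>n. c1 n * e < l) sequentially" using l by (intro order_tendstoD(2)[OF c1])
  moreover have "eventually (\<lambda>n. T / 2 < \<tau> n) sequentially" using T by (intro order_tendstoD(1)[OF \<tau>(1)]) simp
  moreover have "eventually (\<lambda>n. exp_modular p (\<lambda>x. c2 n * Q (2 * T) x / l) \<le> 1) sequentially"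
    using T by (intro Q_modular_small c2 c2n l) simp
  ultimately show "eventually (\<lambda>n. dist (expL_norm p (\<lambda>x. u (\<tau> n) x - u T x)) 0 < \<epsilon>) sequentially"
  proof eventually_elim
    case (elim n)
    have c1n: "0 \<le> c1 n" unfolding c1_def using kappa_nonneg elim(2) T \<tau>(2)[of n] by simp
    have "exp_modular p (\<lambda>x. \<bar>u (\<tau> n) x - u T x\<bar> / (2 * l)) \<le> 1"
    proof (rule exp_young_modular_add[where ?w1.0 = "\<lambda>x. c1 n * Q (2 * T) x powr (1 / r)" and ?w2.0 = "\<lambda>x. c2 n * Q (2 * T) x"])
      show "exp_modular p (\<lambda>x. c1 n * Q (2 * T) x powr (1 / r) / l) \<le> 1"
        using elim(1) l T c1n by (intro Q_root_modular) auto
      show "AE x in lebesgue. \<bar>u (\<tau> n) x - u T x\<bar> \<le> c1 n * Q (2 * T) x powr (1 / r) + c2 n * Q (2 * T) x"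
        using duhamel_continuity[OF less_imp_le[OF elim(2)] \<tau>(2) T] unfolding c1_def c2_def
        by (intro AE_I2) (simp add: abs_minus_commute)
      show "(\<lambda>x. c1 n * Q (2 * T) x powr (1 / r)) \<in> borel_measurable lebesgue" "(\<lambda>x. c2 n * Q (2 * T) x) \<in> borel_measurable lebesgue"
        by (rule measurable_completion, simp)+
    qed (use r l c1n c2n elim(3) in auto)
    from expL_norm_le(2,3)[OF _ _ _ this] show ?case
      using r l \<epsilon> u_lebesgue_measurable[of "\<tau> n"] u_lebesgue_measurable[of T] by (simp add: l_def)
  qed
qed

text \<open>Sampling the solution at the grid points \<open>\<lfloor>t n\<rfloor> / n\<close> to the left of \<open>t\<close>.\<close>

lemma u_strongly_measurable: "strongly_measurable_expL p (time_interval \<infinity>) u"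
proof -
  \<comment> \<open>The bound \<open>n * n\<close> stops the sampling at time \<open>n\<close>,
    which makes the range finite; any fixed \<open>t\<close> is below \<open>n\<close> eventually.
    The lower bound keeps the sampled times positive.\<close>
  define h where "h n k = (if 0 < k \<and> k < int n * int n then u (real_of_int k / real n) else (\<lambda>_. 0))" for n :: nat and k :: int
  define S where "S n t = h n \<lfloor>t * real n\<rfloor>" for n :: nat and t :: real
  have zero: "(\<lambda>_. 0) \<in> expL p"
    by (rule expL_norm_le(1)[of p 1]) (use r in auto)
  have fin: "finite (range (h n))" for n
  proof (rule finite_subset)
    show "range (h n) \<subseteq> insert (\<lambda>_. 0) (h n ` {0<..<int n * int n})" by (auto simp: h_def)
  qed simp
  have h_in: "h n k \<in> expL p" for n k
  proof (cases "0 < k \<and> k < int n * int n")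
    case True
    then have "n > 0" by (cases "n = 0") auto
    with True show ?thesis by (auto simp: h_def intro!: u_in_expL divide_pos_pos)
  qed (use zero in \<open>auto simp: h_def\<close>)
  have meas: "{t \<in> time_interval \<infinity>. S n t = v} \<in> sets lebesgue" for n v
  proof -
    have "{t \<in> time_interval \<infinity>. S n t = v} = {0<..} \<inter> (\<lambda>t. \<lfloor>t * real n\<rfloor>) -` {k. h n k = v}"
      by (auto simp: time_interval_def S_def)
    also have "(\<lambda>t. \<lfloor>t * real n\<rfloor>) \<in> borel \<rightarrow>\<^sub>M count_space UNIV" by measurable
    from measurable_sets[OF this, of "{k. h n k = v}"]
    have "(\<lambda>t. \<lfloor>t * real n\<rfloor>) -` {k. h n k = v} \<in> sets borel" by simp
    then have "{0<..} \<inter> (\<lambda>t. \<lfloor>t * real n\<rfloor>) -` {k. h n k = v} \<in> sets lebesgue" by simp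
    finally show ?thesis .
  qed
  have lim: "(\<lambda>n. expL_norm p (\<lambda>x. S n t x - u t x)) \<longlonglongrightarrow> 0" if t: "t > 0" for t
  proof -
    \<comment> \<open>The value at \<open>n = 0\<close> only serves to keep
      \<open>\<tau> n \<le> t\<close> for every \<open>n\<close>, as \<open>u_continuous\<close>
      demands.\<close>
    define \<tau> where "\<tau> n = (if n = 0 then t else real_of_int \<lfloor>t * real n\<rfloor> / real n)" for n :: nat
    have \<tau>_le: "\<tau> n \<le> t" for n
      unfolding \<tau>_def using of_int_floor_le[of "t * real n"] by (auto simp: field_simps)
    have \<tau>_ge: "t - 1 / real n \<le> \<tau> n" if "n > 0" for n
    proof -
      have "(t * real n - 1) / real n \<le> real_of_int \<lfloor>t * real n\<rfloor> / real n"
        using real_of_int_floor_gt_diff_one[of "t * real n"] by (intro divide_right_mono) auto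
      then show ?thesis using that by (simp add: \<tau>_def diff_divide_distrib)
    qed
    have "(\<lambda>n. t - 1 / real n) \<longlonglongrightarrow> t - 0" by (intro tendsto_intros lim_1_over_n)
    then have \<tau>_lim: "\<tau> \<longlonglongrightarrow> t"
      by (intro tendsto_sandwich[of "\<lambda>n. t - 1 / real n" \<tau> sequentially "\<lambda>_. t"])
         (use \<tau>_le \<tau>_ge in \<open>auto intro: eventually_sequentiallyI[of 1]\<close>)
    have ev: "eventually (\<lambda>n. S n t = u (\<tau> n)) sequentially"
    proof -
      have "eventually (\<lambda>n. 0 < \<tau> n) sequentially" using t by (rule order_tendstoD(1)[OF \<tau>_lim])
      moreover have "eventually (\<lambda>n. n > nat \<lceil>t\<rceil>) sequentially" by (rule eventually_gt_at_top)
      ultimately show ?thesis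
      proof eventually_elim
        case (elim n)
        then have n: "n > 0" "t < real n" using t by linarith+
        have k0: "0 < \<lfloor>t * real n\<rfloor>" using elim(1) n by (simp add: \<tau>_def zero_less_divide_iff)
        have "t * real n < real n * real n" using n by simp
        then have "\<lfloor>t * real n\<rfloor> < int n * int n" by (simp add: floor_less_iff)
        then show ?case using k0 n by (simp add: S_def h_def \<tau>_def)
      qed
    qed
    show ?thesis
      by (rule Lim_transform_eventually[OF u_continuous[OF t \<tau>_lim \<tau>_le]])
         (use ev in eventually_elim, simp)
  qed
  show ?thesis unfolding strongly_measurable_expL_def
  proof (intro exI[of _ S] conjI allI)
    show "S n ` time_interval \<infinity> \<subseteq> expL p" for n using h_in by (auto simp: S_def)
    show "finite (S n ` time_interval \<infinity>)" for n
      by (rule finite_subset[OF _ fin[of n]]) (auto simp: S_def)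
    show "AE t in lebesgue. t \<in> time_interval \<infinity> \<longrightarrow> (\<lambda>n. expL_norm p (\<lambda>x. S n t x - u t x)) \<longlonglongrightarrow> 0"
      using lim by (auto simp: time_interval_def)
  qed (rule meas)
qed

lemma u_weak_mild: "weak_mild_solution p f \<infinity> v0 u"
proof -
  obtain M where "\<forall>t>0. expL_norm p (u t) \<le> M" using u_norm_bounded by blast
  then have "\<exists>M. AE t in lebesgue. t \<in> time_interval \<infinity> \<longrightarrow> expL_norm p (u t) \<le> M"
    by (intro exI[of _ M] AE_I2) (simp add: time_interval_def)
  then show ?thesis
    unfolding weak_mild_solution_def Linf_expL_def weak_star_initial_def
    using u_in_expL u_strongly_measurable duhamel_eq u_weak_star by (auto simp: time_interval_def)
qed

end

section \<open>The Cauchy problem\<close>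

lemma heat_cong_AE:
  fixes u v :: "real^'n \<Rightarrow> real"
  assumes "AE x in lebesgue. u x = v x" and [measurable]: "u \<in> borel_measurable lebesgue" "v \<in> borel_measurable lebesgue"
  shows "heat t u x = heat t v x"
proof -
  have [measurable]: "(\<lambda>y. heat_kernel t (x - y)) \<in> borel_measurable lebesgue"
    by (rule measurable_completion) simp
  show ?thesis unfolding heat_def
    by (rule integral_cong_AE) (use assms(1) in \<open>auto elim: eventually_mono\<close>)
qed

text \<open>In case (iii) the lower bound is the larger one because
  \<open>N / 2 < p / (p - 1)\<close>, so \<open>N (m - 1) / 2 < a\<close> in all cases, which is
  positivity. For \<open>m < 2\<close> the upper bound on \<open>a\<close> rearranges to
  \<open>1 / (m - 1) - 1 < N / (2 a)\<close>.\<close>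

lemma admissible_exponent_bounds:
  assumes "m > 1" "p > 1" "N > 0" and adm: "admissible_exponent N m p a"
  shows "N * (m - 1) / 2 < a" "0 < 1 / (m - 1) - N / (2 * a)" "1 / (m - 1) - N / (2 * a) < 1"
proof -
  have "N / 2 * (m - 1) < a"
  proof (cases "N / 2 < p / (p - 1)")
    case True
    then have "N / 2 * (m - 1) \<le> p / (p - 1) * (m - 1)" using assms by (intro mult_right_mono) auto
    also have "p / (p - 1) * (m - 1) < a" using True adm by (auto simp: admissible_exponent_def)
    finally show ?thesis .
  qed (use adm in \<open>auto simp: admissible_exponent_def\<close>)
  then show a: "N * (m - 1) / 2 < a" by simp
  have a0: "a > 0" using a assms by (intro le_less_trans[OF _ a]) auto
  show "0 < 1 / (m - 1) - N / (2 * a)" using a a0 assms by (simp add: field_simps)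
  have up: "ereal a < upper_exponent N m" using adm by (auto simp: admissible_exponent_def)
  show "1 / (m - 1) - N / (2 * a) < 1"
  proof (cases "m < 2")
    case True
    then have "a < N / 2 * (m - 1) * (1 / (2 - m))" using up by (simp add: upper_exponent_def)
    then have "a * (2 - m) < N / 2 * (m - 1)" using True by (simp add: field_simps)
    then have "(2 - m) / (m - 1) < N / (2 * a)" using a0 assms by (simp add: field_simps)
    moreover have "(2 - m) / (m - 1) = 1 / (m - 1) - 1" using assms by (simp add: field_simps)
    ultimately show ?thesis by simp
  next
    case False
    then have "1 / (m - 1) \<le> 1" by simp
    moreover have "N / (2 * a) > 0" using assms a0 by simp
    ultimately show ?thesis by linarith
  qed
qed

lemma (in heat_flow) heat_solution_exists: "\<exists>u. heat_solution m p r e \<phi> f C0 lam v0 \<beta> u"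
proof (rule solution_exists)
  fix u
  assume "(\<lambda>(t, x). u t x) \<in> borel_measurable (borel :: (real \<times> (real^'n)) measure)"
    "\<And>t x. t > 0 \<Longrightarrow> \<bar>u t x\<bar> \<le> W t x"
    "\<And>t x. t > 0 \<Longrightarrow> integrable (lborel \<Otimes>\<^sub>M lborel) (\<lambda>z. K (t, x) z * f (u (fst z) (snd z)))"
    "\<And>t x. t > 0 \<Longrightarrow> u t x = heat t v0 x + (\<integral>z. K (t, x) z * f (u (fst z) (snd z)) \<partial>(lborel \<Otimes>\<^sub>M lborel))"
  then have "heat_solution m p r e \<phi> f C0 lam v0 \<beta> u" by unfold_locales
  then show ?thesis by (rule exI[of _ u])
qed

theorem theorem1p2:
  fixes m p C0 lam N :: real and f :: "real \<Rightarrow> real"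
  defines "N \<equiv> real CARD('n::finite)"
  assumes "p > 1" and "m \<ge> p" and "N * (m - 1) / 2 \<ge> p"
    and "f 0 = 0" and "C0 > 0" and "lam > 0"
    and "\<And>u v. \<bar>f u - f v\<bar> \<le> C0 * \<bar>u - v\<bar> *
           (\<bar>u\<bar> powr (m - 1) * exp (lam * \<bar>u\<bar> powr p) + \<bar>v\<bar> powr (m - 1) * exp (lam * \<bar>v\<bar> powr p))"
  shows "(\<exists>\<epsilon>>0. \<forall>u0 :: real^'n \<Rightarrow> real. u0 \<in> expL p \<and> expL_norm p u0 \<le> \<epsilon> \<longrightarrow>
           (\<exists>u. weak_mild_solution p f \<infinity> u0 u \<and>
                ((\<lambda>t. expL_norm p (\<lambda>x. u t x - heat t u0 x)) \<longlongrightarrow> 0) (at_right 0) \<and>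
                (\<forall>a. admissible_exponent N m p a \<longrightarrow>
                   (\<exists>C>0. \<forall>t>0. u t \<in> Lp_space a \<and>
                      Lp_norm a (u t) \<le> C * t powr (- (1 / (m - 1) - N / (2 * a))))))) \<and>
         (\<forall>a. admissible_exponent N m p a \<longrightarrow>
            0 < 1 / (m - 1) - N / (2 * a) \<and> 1 / (m - 1) - N / (2 * a) < 1)"
proof (intro conjI allI impI)
  have N: "N > 0" by (simp add: N_def)
  have m1: "m > 1" using assms by simp
  note adm = admissible_exponent_bounds[OF m1 \<open>p > 1\<close> N]
  show "0 < 1 / (m - 1) - N / (2 * a)" "1 / (m - 1) - N / (2 * a) < 1"
    if "admissible_exponent N m p a" for a using adm(2,3)[OF that] by auto
  define r where "r = (1 + p) / 2"
  define \<beta> where "\<beta> = (r - 1) / (m - 1)"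
  have r: "1 < r" "r < p" using assms by (auto simp: r_def)
  have d: "N / 2 > 0" and qc: "N / 2 * (m - 1) \<ge> p" using N assms by auto
  \<comment> \<open>The function \<open>B\<close> is instantiated by the constant of
    \<open>Q_powr_bound\<close>, written out so that \<open>e\<close> is fixed before any datum is
    given.\<close>
  obtain e where e: "e > 0" and bound: "\<And>s Q. 0 < s \<Longrightarrow> 0 \<le> Q \<Longrightarrow>
    (\<forall>q\<ge>p. Q \<le> ((q / p) powr (q / p)) powr (r / q) * e powr r * s powr (- (N / 2 * r / q))) \<Longrightarrow>
    exp_young (p / r) (Q / e powr r) \<le> s powr (- (N / 2)) \<Longrightarrow>
    2 * C0 * ((Q powr (1 / r) + s powr \<beta> * Q) powr m * exp (lam * (Q powr (1 / r) + s powr \<beta> * Q) powr p))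
      \<le> \<beta> * s powr (\<beta> - 1) * Q"
    using majorant_bound[OF d r \<open>m \<ge> p\<close> qc \<open>C0 > 0\<close> \<open>lam > 0\<close>, of "\<lambda>q. ((q / p) powr (q / p)) powr (r / q)"]
    unfolding \<beta>_def[symmetric] by blast
  show "\<exists>\<epsilon>>0. \<forall>u0 :: real^'n \<Rightarrow> real. u0 \<in> expL p \<and> expL_norm p u0 \<le> \<epsilon> \<longrightarrow>
           (\<exists>u. weak_mild_solution p f \<infinity> u0 u \<and>
                ((\<lambda>t. expL_norm p (\<lambda>x. u t x - heat t u0 x)) \<longlongrightarrow> 0) (at_right 0) \<and>
                (\<forall>a. admissible_exponent N m p a \<longrightarrow>
                   (\<exists>C>0. \<forall>t>0. u t \<in> Lp_space a \<and>
                      Lp_norm a (u t) \<le> C * t powr (- (1 / (m - 1) - N / (2 * a))))))"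
  \<comment> \<open>Halving makes the norm strictly smaller than \<open>e\<close>, as
    \<open>exp_young_modular_le_one\<close> requires.\<close>
  proof (intro exI[of _ "e / 2"] conjI allI impI)
    fix u0 :: "real^'n \<Rightarrow> real"
    assume u0: "u0 \<in> expL p \<and> expL_norm p u0 \<le> e / 2"
    then have u0_meas [measurable]: "u0 \<in> borel_measurable lebesgue" using expL_measurable by blast
    \<comment> \<open>The construction needs Borel measurability jointly in time and space. Passing
      to a Borel representative changes neither the heat evolution nor the pairings with
      \<open>g\<close>.\<close>
    obtain v0 where v0: "v0 \<in> borel_measurable borel" and ae: "AE x in lborel. u0 x = v0 x"
      using completion_ex_borel_measurable_real[OF u0_meas] by auto
    have ae': "AE x in lebesgue. u0 x = v0 x" by (rule AE_completion[OF ae])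
    have v0_leb [measurable]: "v0 \<in> borel_measurable lebesgue" by (rule measurable_completion) (use v0 in simp)
    have heat_eq: "heat t u0 = heat t v0" for t
      by (rule ext) (rule heat_cong_AE[OF ae' u0_meas v0_leb])
    have "(\<integral>\<^sup>+x. ennreal (exp_young p (\<bar>v0 x\<bar> / e)) \<partial>lborel) = exp_modular p (\<lambda>x. \<bar>u0 x\<bar> / e)"
      unfolding nn_integral_lebesgue_eq by (rule nn_integral_cong_AE) (use ae in eventually_elim, simp)
    also have "\<dots> \<le> 1"
      using u0 e \<open>p > 1\<close> by (intro exp_young_modular_le_one) auto
    finally have modular: "(\<integral>\<^sup>+x. ennreal (exp_young p (\<bar>v0 x\<bar> / e)) \<partial>lborel) \<le> 1" .
    interpret small_datum m p r e "\<lambda>x. \<bar>v0 x\<bar>"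
      by unfold_locales (use r assms(3) qc e v0 modular in \<open>auto simp: N_def\<close>)
    have dN: "d = N / 2" by (simp add: d_def N_def)
    interpret heat_flow m p r e "\<lambda>x. \<bar>v0 x\<bar>" f C0 lam v0 \<beta>
    proof unfold_locales
      fix s x assume s: "(s::real) > 0"
      show "2 * C0 * ((Q s x powr (1 / r) + s powr \<beta> * Q s x) powr m *
          exp (lam * (Q s x powr (1 / r) + s powr \<beta> * Q s x) powr p)) \<le> \<beta> * s powr (\<beta> - 1) * Q s x"
        using Q_powr_bound[OF s, of _ x] Q_exp_bound[OF s, of x]
        by (intro bound s) (auto simp: A_def dN)
    qed (use assms v0 in \<open>auto simp: \<beta>_def\<close>)
    obtain u where "heat_solution m p r e (\<lambda>x. \<bar>v0 x\<bar>) f C0 lam v0 \<beta> u"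
      using heat_solution_exists by blast
    then interpret heat_solution m p r e "\<lambda>x. \<bar>v0 x\<bar>" f C0 lam v0 \<beta> u .
    show "\<exists>u. weak_mild_solution p f \<infinity> u0 u \<and>
                ((\<lambda>t. expL_norm p (\<lambda>x. u t x - heat t u0 x)) \<longlongrightarrow> 0) (at_right 0) \<and>
                (\<forall>a. admissible_exponent N m p a \<longrightarrow>
                   (\<exists>C>0. \<forall>t>0. u t \<in> Lp_space a \<and>
                      Lp_norm a (u t) \<le> C * t powr (- (1 / (m - 1) - N / (2 * a)))))"
    proof (intro exI[of _ u] conjI allI impI)
      have duhamel: "duhamel_eq f u0 u t \<longleftrightarrow> duhamel_eq f v0 u t" for t
        by (simp add: duhamel_eq_def heat_eq)
      have init: "(\<integral>x. u0 x * g x \<partial>lebesgue) = (\<integral>x. v0 x * g x \<partial>lebesgue)"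
        if "g \<in> orlicz_space (complementary_fun (exp_young p))" for g
        using expL_measurable[OF that] by (intro integral_cong_AE) (use ae' in \<open>auto elim: eventually_mono\<close>)
      show "weak_mild_solution p f \<infinity> u0 u"
        using u_weak_mild by (simp add: weak_mild_solution_def weak_star_initial_def duhamel init)
      show "((\<lambda>t. expL_norm p (\<lambda>x. u t x - heat t u0 x)) \<longlongrightarrow> 0) (at_right 0)"
        unfolding heat_eq by (rule u_minus_heat_tendsto)
      fix a assume "admissible_exponent N m p a"
      from adm(1)[OF this] have "d * (m - 1) < a" by (simp add: dN)
      from u_decay[OF this] show "\<exists>C>0. \<forall>t>0. u t \<in> Lp_space a \<and>
          Lp_norm a (u t) \<le> C * t powr (- (1 / (m - 1) - N / (2 * a)))"
        by (simp add: dN)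
    qed
  qed (use e in simp)
qed

end
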